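(* Let $\varphi$ be any norm on $\mathbb R^2$. Then there exists a unique minimizing movement of the unconstrained scheme (U) at regime $\varepsilon/\tau\to0$, and it satisfies $$E(t)=B_{4t}^\varphi,\qquad t\ge0.$$ Moreover, for every discrete solution $E_{\varepsilon,\tau}$ of (U) we have, in this regime, $$\chi_{E_{\varepsilon,\tau}(t)}\overset{*}{\rightharpoonup}\tfrac12\,\chi_{B_{4t}^\varphi}\quad\text{for all } t\ge0,\ \text{as }\varepsilon\to0$$ (weak$^*$ convergence in $L^\infty(\mathbb R^2)$).
   Context: $B_r^\varphi=\{\mathbf x\in\mathbb R^2:\varphi(\mathbf x)<r\}$ for $r>0$; for $r=0$, $B_0^\varphi$ is understood as $\{(0,0)\}$ (sets are compared through the Hausdorff distance). $\mathcal X$ is the space of subsets of $\mathbb R^2$ of finite perimeter, with the Hausdorff distance. For $\varepsilon>0$, $q_\varepsilon(\mathbf x)=\mathbf x+[-\varepsilon/2,\varepsilon/2]^2$, $q_\varepsilon=q_\varepsilon(0)$; $\mathcal D_\varepsilon$ is the class of sets $\bigcup_{\mathbf i\in\mathcal I}q_\varepsilon(\mathbf i)$ with $\mathcal I\subset\varepsilon\mathbb Z^2$, and $Z_\varepsilon(E)=E\cap\varepsilon\mathbb Z^2$ for $E\in\mathcal D_\varepsilon$. Energies are considered on sets of finite perimeter. For $\mathcal I\subset\varepsilon\mathbb Z^2$ and $\mathbf i\in\varepsilon\mathbb Z^2$ let $d_\varepsilon^\varphi(\mathbf i,\partial\mathcal I)=\inf\{\varphi(\mathbf i-\mathbf j):\mathbf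 j\in\mathcal I\}$ if $\mathbf i\notin\mathcal I$, and $=\inf\{\varphi(\mathbf i-\mathbf j):\mathbf j\in\varepsilon\mathbb Z^2\setminus\mathcal I\}$ if $\mathbf i\in\mathcal I$. For $\varepsilon,\tau>0$ and $E,F\in\mathcal D_\varepsilon$, $$\mathcal F_{\varepsilon,\tau}^\varphi(E,F)=-\varepsilon\,\mathcal H^1(\partial E)+\frac{\varepsilon^2}{\tau}\sum_{\mathbf i\in Z_\varepsilon(E)\triangle Z_\varepsilon(F)}d_\varepsilon^\varphi(\mathbf i,\partial Z_\varepsilon(F)).$$ **Scheme (U).** $E_{\varepsilon,\tau}^0=q_\varepsilon$, and for $k\ge0$, $E_{\varepsilon,\tau}^{k+1}$ is a minimizer of $\mathcal F_{\varepsilon,\tau}^\varphi(\cdot,E_{\varepsilon,\tau}^k)$ over $\mathcal D_\varepsilon$. A discrete solution is $E_{\varepsilon,\tau}(t)=E_{\varepsilon,\tau}^{\lfloor t/\tau\rfloor}$. A minimizing movement at regime $\varepsilon/\tau\to0$ is a curve $E:[0,+\infty)\to\mathcal X$ that is a pointwise (in $t$) limit, in the Hausdorff distance, of discrete solutions $E_{\varepsilon,\tau}$ as $\varepsilon,\tau\to0$ with $\varepsilon/\tau\to0$, up to subsequences. *)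

theory Defs
  imports "HOL-Analysis.Analysis"
begin

type_synonym plane = "real ^ 2"

definition is_norm :: "(plane \<Rightarrow> real) \<Rightarrow> bool" where
  "is_norm \<phi> \<longleftrightarrow>
     (\<forall>x. 0 \<le> \<phi> x) \<and> (\<forall>x. \<phi> x = 0 \<longleftrightarrow> x = 0) \<and>
     (\<forall>a x. \<phi> (a *\<^sub>R x) = \<bar>a\<bar> * \<phi> x) \<and> (\<forall>x y. \<phi> (x + y) \<le> \<phi> x + \<phi> y)"

definition norm_ball :: "(plane \<Rightarrow> real) \<Rightarrow> real \<Rightarrow> plane set" where
  "norm_ball \<phi> r = (if r = 0 then {0} else {x. \<phi> x < r})"

text \<open>One-dimensional Hausdorff measure. Countable covers may be padded with empty sets, whose
  diameter is 0; boundedness is required because the library's \<open>diameter\<close> is only meaningful on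
  bounded sets. No normalising constant occurs in dimension one.\<close>

definition hausdorff1_pre :: "real \<Rightarrow> plane set \<Rightarrow> ennreal" where
  "hausdorff1_pre \<delta> A =
     (INF U \<in> {U :: nat \<Rightarrow> plane set.
                A \<subseteq> (\<Union>n. U n) \<and> (\<forall>n. bounded (U n) \<and> diameter (U n) \<le> \<delta>)}.
        \<Sum>n. ennreal (diameter (U n)))"

definition hausdorff1 :: "plane set \<Rightarrow> ennreal" where
  "hausdorff1 A = (SUP \<delta>\<in>{0<..}. hausdorff1_pre \<delta> A)"

text \<open>Perimeter in the sense of De Giorgi, as the total variation of the distributional gradient
  of the characteristic function.\<close>

definition divergence :: "(plane \<Rightarrow> plane) \<Rightarrow> plane \<Rightarrow> real" where
  "divergence T x = trace (jacobian T (at x))"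

definition test_fields :: "(plane \<Rightarrow> plane) set" where
  "test_fields =
     {T. (\<forall>x. T differentiable (at x)) \<and> continuous_on UNIV (\<lambda>x. jacobian T (at x)) \<and>
         compact (closure {x. T x \<noteq> 0}) \<and> (\<forall>x. norm (T x) \<le> 1)}"

definition perimeter :: "plane set \<Rightarrow> ereal" where
  "perimeter E = (SUP T\<in>test_fields. ereal (LINT x:E|lebesgue. divergence T x))"

definition finite_perimeter :: "plane set \<Rightarrow> bool" where
  "finite_perimeter E \<longleftrightarrow> E \<in> sets lebesgue \<and> perimeter E < \<infinity>"

text \<open>With values in \<open>[0,\<infinity>]\<close>, the distance of a nonempty set to the empty set is \<open>\<infinity>\<close>. Two sets
  have distance 0 iff their closures agree.\<close>

definition hausdorff_distance :: "plane set \<Rightarrow> plane set \<Rightarrow> ennreal" where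
  "hausdorff_distance A B =
     max (SUP x\<in>A. INF y\<in>B. ennreal (dist x y)) (SUP y\<in>B. INF x\<in>A. ennreal (dist x y))"

definition grid :: "real \<Rightarrow> plane set" where
  "grid \<epsilon> = {x. \<forall>i. \<exists>k::int. x $ i = \<epsilon> * of_int k}"

definition cell :: "real \<Rightarrow> plane \<Rightarrow> plane set" where
  "cell \<epsilon> x = cbox (x - vec (\<epsilon> / 2)) (x + vec (\<epsilon> / 2))"

definition grid_sets :: "real \<Rightarrow> plane set set" where
  "grid_sets \<epsilon> = {(\<Union>i\<in>I. cell \<epsilon> i) | I. I \<subseteq> grid \<epsilon>}"

definition centres :: "real \<Rightarrow> plane set \<Rightarrow> plane set" where
  "centres \<epsilon> E = E \<inter> grid \<epsilon>"

text \<open>The infimum over the empty set is \<open>\<infinity>\<close>.\<close>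

definition bdry_dist :: "real \<Rightarrow> (plane \<Rightarrow> real) \<Rightarrow> plane \<Rightarrow> plane set \<Rightarrow> ennreal" where
  "bdry_dist \<epsilon> \<phi> i I =
     (if i \<in> I then INF j\<in>grid \<epsilon> - I. ennreal (\<phi> (i - j))
      else INF j\<in>I. ennreal (\<phi> (i - j)))"

text \<open>The energy is only used for grid sets of finite perimeter. For these the first summand is
  finite, so that no difference of infinities occurs; the second one may be \<open>\<infinity>\<close>.\<close>

definition energy :: "real \<Rightarrow> real \<Rightarrow> (plane \<Rightarrow> real) \<Rightarrow> plane set \<Rightarrow> plane set \<Rightarrow> ereal" where
  "energy \<epsilon> \<tau> \<phi> E F =
     - (ereal \<epsilon> * enn2ereal (hausdorff1 (frontier E))) +
     ereal (\<epsilon>\<^sup>2 / \<tau>) *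
       enn2ereal (\<Sum>\<^sub>\<infinity> i \<in> sym_diff (centres \<epsilon> E) (centres \<epsilon> F). bdry_dist \<epsilon> \<phi> i (centres \<epsilon> F))"

definition energy_minimizer ::
  "real \<Rightarrow> real \<Rightarrow> (plane \<Rightarrow> real) \<Rightarrow> plane set \<Rightarrow> plane set \<Rightarrow> bool" where
  "energy_minimizer \<epsilon> \<tau> \<phi> F E \<longleftrightarrow>
     E \<in> grid_sets \<epsilon> \<and> finite_perimeter E \<and>
     (\<forall>E'\<in>grid_sets \<epsilon>. finite_perimeter E' \<longrightarrow> energy \<epsilon> \<tau> \<phi> E F \<le> energy \<epsilon> \<tau> \<phi> E' F)"

definition discrete_scheme ::
  "real \<Rightarrow> real \<Rightarrow> (plane \<Rightarrow> real) \<Rightarrow> (nat \<Rightarrow> plane set) \<Rightarrow> bool" where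
  "discrete_scheme \<epsilon> \<tau> \<phi> S \<longleftrightarrow>
     S 0 = cell \<epsilon> 0 \<and> (\<forall>k. energy_minimizer \<epsilon> \<tau> \<phi> (S k) (S (Suc k)))"

definition discrete_solution ::
  "real \<Rightarrow> real \<Rightarrow> (plane \<Rightarrow> real) \<Rightarrow> (real \<Rightarrow> plane set) \<Rightarrow> bool" where
  "discrete_solution \<epsilon> \<tau> \<phi> E \<longleftrightarrow>
     (\<exists>S. discrete_scheme \<epsilon> \<tau> \<phi> S \<and> (\<forall>t\<ge>0. E t = S (nat \<lfloor>t / \<tau>\<rfloor>)))"

definition regime :: "(nat \<Rightarrow> real) \<Rightarrow> (nat \<Rightarrow> real) \<Rightarrow> bool" where
  "regime \<epsilon> \<tau> \<longleftrightarrow>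
     (\<forall>n. 0 < \<epsilon> n) \<and> (\<forall>n. 0 < \<tau> n) \<and> \<epsilon> \<longlonglongrightarrow> 0 \<and> \<tau> \<longlonglongrightarrow> 0 \<and>
     (\<lambda>n. \<epsilon> n / \<tau> n) \<longlonglongrightarrow> 0"

text \<open>A minimizing movement along given parameter sequences: a curve of sets of finite perimeter
  that is the pointwise Hausdorff limit of a subsequence of discrete solutions. Only times
  \<open>t \<ge> 0\<close> matter.\<close>

definition minimizing_movement ::
  "(plane \<Rightarrow> real) \<Rightarrow> (nat \<Rightarrow> real) \<Rightarrow> (nat \<Rightarrow> real) \<Rightarrow> (real \<Rightarrow> plane set) \<Rightarrow> bool" where
  "minimizing_movement \<phi> \<epsilon> \<tau> E \<longleftrightarrow>
     (\<forall>t\<ge>0. finite_perimeter (E t)) \<and>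
     (\<exists>D r. (\<forall>n. discrete_solution (\<epsilon> n) (\<tau> n) \<phi> (D n)) \<and> strict_mono (r :: nat \<Rightarrow> nat) \<and>
        (\<forall>t\<ge>0. (\<lambda>n. hausdorff_distance (D (r n) t) (E t)) \<longlonglongrightarrow> 0))"

definition Linfty :: "(plane \<Rightarrow> real) \<Rightarrow> bool" where
  "Linfty f \<longleftrightarrow> f \<in> borel_measurable lebesgue \<and> (\<exists>C. AE x in lebesgue. \<bar>f x\<bar> \<le> C)"

definition weak_star_converges :: "(nat \<Rightarrow> plane \<Rightarrow> real) \<Rightarrow> (plane \<Rightarrow> real) \<Rightarrow> bool" where
  "weak_star_converges f g \<longleftrightarrow>
     (\<forall>n. Linfty (f n)) \<and> Linfty g \<and>
     (\<forall>h. integrable lebesgue h \<longrightarrow>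
        (\<lambda>n. LINT x|lebesgue. f n x * h x) \<longlonglongrightarrow> (LINT x|lebesgue. g x * h x))"

end

theory Submission
  imports Defs "HOL-Real_Asymp.Real_Asymp"
begin

text \<open>The set is described by its lattice of centres. An isolated cell, none of whose four neighbours
  belongs to the set, contributes its full boundary length \<open>4 * \<epsilon>\<close>, and no cell contributes more.
  Adding a cell at distance \<open>d\<close> from the previous set costs \<open>\<epsilon>\<^sup>2 * d / \<tau>\<close> and gains at most
  \<open>4 * \<epsilon>\<^sup>2\<close>, so a minimizer contains nothing beyond distance \<open>4 * \<tau>\<close> from its predecessor
  (\<open>minimizer_near\<close>); and strictly within this distance every lattice point belongs to it or has a
  neighbour that does (\<open>minimizer_fills\<close>). By induction the set after \<open>k\<close> steps lies in the
  ball of radius \<open>4 * \<tau> * k\<close> and is \<open>O(\<epsilon>)\<close>-dense in the ball of radius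
  \<open>k * (4 * \<tau> - O(\<epsilon>))\<close> (\<open>scheme_upper\<close>, \<open>scheme_lower\<close>). At a fixed time \<open>t\<close>, both radii tend to
  \<open>4 * t\<close> because \<open>\<epsilon> / \<tau>\<close> tends to 0. This is the Hausdorff convergence.

  For the density, a minimizer is compared with a checkerboard in the ball filled by its predecessor.
  Since the predecessor is \<open>O(\<epsilon>)\<close>-dense there and has a missing neighbour next to each of its points
  (\<open>scheme_has_gaps\<close>), the dissipation of this competitor is \<open>O(\<epsilon> / \<tau>)\<close>. Its perimeter is the
  largest possible one up to a vanishing error, with every pair of neighbours cut. So in the
  minimizer, too, the fraction of horizontal pairs of neighbours that are not cut tends to 0
  (\<open>cut_volume_ge\<close>). The set and its shift by \<open>\<epsilon>\<close> in the first direction therefore nearly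
  partition the ball, and by continuity of translations in measure each of them has density one half
  (\<open>scheme_density\<close>).

  The Hausdorff measure enters only through two estimates: it is at most the number of cut sides
  times \<open>\<epsilon>\<close>, and it grows by \<open>4 * \<epsilon>\<close> when an isolated cell is added
  (\<open>hausdorff1_frontier_insert_isolated\<close>). Finite perimeter of balls and of finite unions of cells
  follows from the linear growth of the measure swept out by small shifts (\<open>shift_regular\<close>).\<close>

section \<open>One-dimensional Hausdorff measure\<close>

lemma hausdorff1_pre_le:
  assumes "A \<subseteq> (\<Union>n. U n)" "\<And>n. bounded (U n)" "\<And>n. diameter (U n) \<le> \<delta>"
  shows "hausdorff1_pre \<delta> A \<le> (\<Sum>n. ennreal (diameter (U n)))"
  unfolding hausdorff1_pre_def by (rule INF_lower) (use assms in auto)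

lemma hausdorff1_pre_antimono: "\<delta> \<le> \<delta>' \<Longrightarrow> hausdorff1_pre \<delta>' A \<le> hausdorff1_pre \<delta> A"
  unfolding hausdorff1_pre_def by (rule INF_superset_mono) (auto intro: order_trans)

lemma hausdorff1_mono:
  assumes "A \<subseteq> B" shows "hausdorff1 A \<le> hausdorff1 B"
proof -
  have "hausdorff1_pre \<delta> A \<le> hausdorff1_pre \<delta> B" for \<delta>
    unfolding hausdorff1_pre_def by (rule INF_superset_mono) (use assms in auto)
  then show ?thesis
    unfolding hausdorff1_def by (intro SUP_mono) auto
qed

lemma hausdorff1_upper: "0 < \<delta> \<Longrightarrow> hausdorff1_pre \<delta> A \<le> hausdorff1 A"
  unfolding hausdorff1_def by (rule SUP_upper) auto

text \<open>Two covers indexed by the natural numbers are merged by interleaving them.\<close>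

lemma suminf_interleave_le:
  fixes f g :: "nat \<Rightarrow> ennreal"
  shows "(\<Sum>n. if even n then f (n div 2) else g (n div 2)) \<le> suminf f + suminf g"
proof (rule suminf_le_const)
  let ?h = "\<lambda>n. if even n then f (n div 2) else g (n div 2)"
  show "summable ?h" by simp
  have eq: "(\<Sum>n<2*N. ?h n) = (\<Sum>n<N. f n) + (\<Sum>n<N. g n)" for N
    by (induction N) (auto simp: algebra_simps)
  show "(\<Sum>n<N. ?h n) \<le> suminf f + suminf g" for N
  proof -
    have "(\<Sum>n<N. ?h n) \<le> (\<Sum>n<2*N. ?h n)" by (rule sum_mono2) auto
    also have "\<dots> \<le> suminf f + suminf g"
      unfolding eq by (intro add_mono sum_le_suminf) auto
    finally show ?thesis .
  qed
qed

lemma le_INF_add_INF: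
  fixes x :: ennreal
  assumes "\<And>i j. i \<in> A \<Longrightarrow> j \<in> B \<Longrightarrow> x \<le> f i + g j"
  shows "x \<le> (INF i\<in>A. f i) + (INF j\<in>B. g j)"
proof -
  have add: "x \<le> c + (INF j\<in>J. h j)" if "\<And>j. j \<in> J \<Longrightarrow> x \<le> c + h j" for c :: ennreal and h and J :: "'c set"
  proof (cases "c = top")
    case False
    then have "x - c \<le> (INF j\<in>J. h j)"
      using that by (intro INF_greatest) (simp add: ennreal_minus_le_iff)
    then show ?thesis using False by (simp add: ennreal_minus_le_iff)
  qed simp
  have "x \<le> (INF j\<in>B. g j) + f i" if "i \<in> A" for i
    using add[of B "f i" g] assms that by (simp add: add.commute)
  then show ?thesis using add[of A "INF j\<in>B. g j" f] by (simp add: add.commute)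
qed

lemma hausdorff1_pre_Un:
  "hausdorff1_pre \<delta> (A \<union> B) \<le> hausdorff1_pre \<delta> A + hausdorff1_pre \<delta> B"
proof -
  let ?C = "\<lambda>A. {U :: nat \<Rightarrow> plane set.
                A \<subseteq> (\<Union>n. U n) \<and> (\<forall>n. bounded (U n) \<and> diameter (U n) \<le> \<delta>)}"
  let ?s = "\<lambda>U :: nat \<Rightarrow> plane set. \<Sum>n. ennreal (diameter (U n))"
  have 1: "hausdorff1_pre \<delta> (A \<union> B) \<le> ?s U + ?s V" if U: "U \<in> ?C A" and V: "V \<in> ?C B" for U V
  proof -
    define W where "W n = (if even n then U (n div 2) else V (n div 2))" for n
    have "U n = W (2*n)" "V n = W (2*n+1)" for n by (auto simp: W_def)
    then have "A \<union> B \<subseteq> (\<Union>n. W n)" using U V by blast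
    then have "hausdorff1_pre \<delta> (A \<union> B) \<le> ?s W"
      by (rule hausdorff1_pre_le) (use U V in \<open>auto simp: W_def\<close>)
    also have "?s W = (\<Sum>n. if even n then ennreal (diameter (U (n div 2))) else ennreal (diameter (V (n div 2))))"
      by (intro suminf_cong) (auto simp: W_def)
    also have "\<dots> \<le> ?s U + ?s V" by (rule suminf_interleave_le)
    finally show ?thesis .
  qed
  show ?thesis
    unfolding hausdorff1_pre_def[of \<delta> A] hausdorff1_pre_def[of \<delta> B] by (intro le_INF_add_INF 1)
qed

lemma hausdorff1_Un: "hausdorff1 (A \<union> B) \<le> hausdorff1 A + hausdorff1 B"
  unfolding hausdorff1_def[of "A \<union> B"]
proof (rule SUP_least)
  fix \<delta> :: real assume "\<delta> \<in> {0<..}"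
  then show "hausdorff1_pre \<delta> (A \<union> B) \<le> hausdorff1 A + hausdorff1 B"
    using hausdorff1_pre_Un hausdorff1_upper by (meson add_mono greaterThan_iff order_trans)
qed

lemma hausdorff1_empty [simp]: "hausdorff1 {} = 0"
proof -
  have "hausdorff1_pre \<delta> {} \<le> 0" if "\<delta> > 0" for \<delta>
    using hausdorff1_pre_le[of "{}" "\<lambda>_. {}" \<delta>] that by simp
  then show ?thesis unfolding hausdorff1_def by (simp add: SUP_eq_iff)
qed

lemma hausdorff1_UN_le:
  "finite S \<Longrightarrow> hausdorff1 (\<Union>i\<in>S. A i) \<le> (\<Sum>i\<in>S. hausdorff1 (A i))"
proof (induction S rule: finite_induct)
  case (insert x F)
  then show ?case
    by (auto intro!: order_trans[OF hausdorff1_Un] add_left_mono)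
qed simp

text \<open>Covers by sets whose diameter is smaller than the distance of \<open>A\<close> and \<open>K\<close> split into a cover
  of \<open>A\<close> and a cover of \<open>K\<close>.\<close>

lemma hausdorff1_Un_separated:
  assumes "closed A" "compact K" "A \<inter> K = {}"
  shows "hausdorff1 A + hausdorff1 K \<le> hausdorff1 (A \<union> K)"
proof -
  obtain d where d: "d > 0" "\<And>x y. x \<in> A \<Longrightarrow> y \<in> K \<Longrightarrow> d \<le> dist x y"
    using separate_closed_compact[OF assms] by blast
  have pre: "hausdorff1_pre \<delta> A + hausdorff1_pre \<delta> K \<le> hausdorff1_pre \<delta> (A \<union> K)" if \<delta>: "0 < \<delta>" "\<delta> < d" for \<delta>
    unfolding hausdorff1_pre_def[of \<delta> "A \<union> K"]
  proof (rule INF_greatest)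
    fix U :: "nat \<Rightarrow> plane set"
    assume "U \<in> {U. A \<union> K \<subseteq> (\<Union>n. U n) \<and> (\<forall>n. bounded (U n) \<and> diameter (U n) \<le> \<delta>)}"
    then have U: "A \<union> K \<subseteq> (\<Union>n. U n)" "\<And>n. bounded (U n)" "\<And>n. diameter (U n) \<le> \<delta>" by auto
    define V where "V B n = (if U n \<inter> B \<noteq> {} then U n else {})" for B n
    have le: "hausdorff1_pre \<delta> B \<le> (\<Sum>n. ennreal (diameter (V B n)))" if "B \<subseteq> A \<union> K" for B
    proof (rule hausdorff1_pre_le)
      show "B \<subseteq> (\<Union>n. V B n)"
      proof
        fix x assume "x \<in> B"
        then obtain n where "x \<in> U n" using U(1) \<open>B \<subseteq> A \<union> K\<close> by blast
        then have "x \<in> V B n" using \<open>x \<in> B\<close> by (auto simp: V_def)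
        then show "x \<in> (\<Union>n. V B n)" by blast
      qed
    qed (use U \<delta> in \<open>auto simp: V_def\<close>)
    have "hausdorff1_pre \<delta> A + hausdorff1_pre \<delta> K
        \<le> (\<Sum>n. ennreal (diameter (V A n))) + (\<Sum>n. ennreal (diameter (V K n)))"
      by (intro add_mono le) auto
    also have "\<dots> = (\<Sum>n. ennreal (diameter (V A n)) + ennreal (diameter (V K n)))"
      by (rule suminf_add) auto
    also have "\<dots> \<le> (\<Sum>n. ennreal (diameter (U n)))"
    proof (rule suminf_le)
      fix n
      have "\<not> (U n \<inter> A \<noteq> {} \<and> U n \<inter> K \<noteq> {})"
      proof
        assume "U n \<inter> A \<noteq> {} \<and> U n \<inter> K \<noteq> {}"
        then obtain x y where "x \<in> U n" "x \<in> A" "y \<in> U n" "y \<in> K" by blast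
        then have "d \<le> dist x y" "dist x y \<le> diameter (U n)"
          using d U(2) diameter_bounded_bound by blast+
        then show False using U(3)[of n] \<delta> by linarith
      qed
      then show "ennreal (diameter (V A n)) + ennreal (diameter (V K n)) \<le> ennreal (diameter (U n))"
        by (auto simp: V_def)
    qed auto
    finally show "hausdorff1_pre \<delta> A + hausdorff1_pre \<delta> K \<le> (\<Sum>n. ennreal (diameter (U n)))" .
  qed
  have "hausdorff1 A + hausdorff1 K = (SUP \<delta>\<in>{0<..}. hausdorff1_pre \<delta> A + hausdorff1_pre \<delta> K)"
    unfolding hausdorff1_def
  proof (rule SUP_add_directed_ennreal[symmetric])
    fix i j :: real assume "i \<in> {0<..}" "j \<in> {0<..}"
    then show "\<exists>k\<in>{0<..}. hausdorff1_pre i A + hausdorff1_pre j K \<le> hausdorff1_pre k A + hausdorff1_pre k K"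
      by (intro bexI[of _ "min i j"] add_mono hausdorff1_pre_antimono) auto
  qed
  also have "\<dots> \<le> hausdorff1 (A \<union> K)"
  proof (rule SUP_least)
    fix \<delta> :: real assume "\<delta> \<in> {0<..}"
    then have *: "0 < min \<delta> (d/2)" "min \<delta> (d/2) < d" using d by auto
    have "hausdorff1_pre \<delta> A + hausdorff1_pre \<delta> K
        \<le> hausdorff1_pre (min \<delta> (d/2)) A + hausdorff1_pre (min \<delta> (d/2)) K"
      by (intro add_mono hausdorff1_pre_antimono) auto
    also have "\<dots> \<le> hausdorff1 (A \<union> K)"
      using pre[OF *] hausdorff1_upper[OF *(1)] order_trans by blast
    finally show "hausdorff1_pre \<delta> A + hausdorff1_pre \<delta> K \<le> hausdorff1 (A \<union> K)" .
  qed
  finally show ?thesis .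
qed

lemma hausdorff1_curve_le:
  fixes \<gamma> :: "real \<Rightarrow> plane"
  assumes "a \<le> b" and lip: "\<And>s t. dist (\<gamma> s) (\<gamma> t) \<le> \<bar>s - t\<bar>" and A: "A \<subseteq> \<gamma> ` {a..b}"
  shows "hausdorff1 A \<le> ennreal (b - a)"
  unfolding hausdorff1_def
proof (rule SUP_least)
  fix \<delta> :: real assume "\<delta> \<in> {0<..}"
  then have \<delta>: "\<delta> > 0" by simp
  obtain N :: nat where N: "(b - a) / \<delta> < N" using reals_Archimedean2 by blast
  then have N0: "N > 0" using assms(1) \<delta> by (metis divide_nonneg_pos diff_ge_0_iff_ge of_nat_0 not_gr_zero not_le)
  define l where "l = (b - a) / N"
  have l: "0 \<le> l" "l \<le> \<delta>" "N * l = b - a"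
    using N N0 \<delta> assms(1) by (auto simp: l_def field_simps)
  define U where "U n = (if n < N then \<gamma> ` {a + n * l .. a + (n+1) * l} else {})" for n :: nat
  have dle: "dist x y \<le> l" if "x \<in> U n" "y \<in> U n" for x y n
  proof -
    from that obtain s t where st: "x = \<gamma> s" "y = \<gamma> t" "s \<in> {a + n * l .. a + (n+1) * l}" "t \<in> {a + n * l .. a + (n+1) * l}"
      by (auto simp: U_def split: if_splits)
    then have "\<bar>s - t\<bar> \<le> l" by (auto simp: algebra_simps abs_le_iff)
    then show ?thesis using lip[of s t] unfolding st(1,2) by linarith
  qed
  have diam: "diameter (U n) \<le> l" for n
    by (rule diameter_le) (use dle l in \<open>auto simp: dist_norm\<close>)
  have "hausdorff1_pre \<delta> A \<le> (\<Sum>n. ennreal (diameter (U n)))"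
  proof (rule hausdorff1_pre_le)
    show "A \<subseteq> (\<Union>n. U n)"
    proof
      fix x assume "x \<in> A"
      then obtain s where s: "x = \<gamma> s" "a \<le> s" "s \<le> b" using A by auto
      show "x \<in> (\<Union>n. U n)"
      proof (cases "l = 0")
        case True
        then have "s = a" using s l(3) by simp
        then have "x \<in> U 0" using N0 s True by (auto simp: U_def)
        then show ?thesis by blast
      next
        case False
        then have lp: "l > 0" using l by simp
        define m where "m = min (nat \<lfloor>(s - a) / l\<rfloor>) (N - 1)"
        have "m < N" using N0 by (auto simp: m_def)
        have q0: "0 \<le> (s-a)/l" using s lp by simp
        have "real m \<le> (s - a) / l"
          using of_int_floor_le[of "(s-a)/l"] q0 unfolding m_def
          by (metis (no_types, opaque_lifting) floor_of_nat le_floor_iff min.cobounded1 of_nat_nat zero_le_floor order_trans of_nat_le_iff of_int_of_nat_eq)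
        then have 1: "m * l \<le> s - a" using lp by (simp add: field_simps)
        have 2: "s - a \<le> (m + 1) * l"
        proof (cases "nat \<lfloor>(s - a) / l\<rfloor> \<le> N - 1")
          case True
          then have "m = nat \<lfloor>(s - a) / l\<rfloor>" by (simp add: m_def)
          then have "(s - a) / l \<le> m + 1" using q0 by linarith
          then show ?thesis using lp by (simp add: field_simps)
        next
          case False
          then have "m + 1 = N" using N0 by (auto simp: m_def)
          then have "real m + 1 = N" by linarith
          then show ?thesis using s l(3) by (simp add: add.commute)
        qed
        have "x \<in> U m" using \<open>m < N\<close> 1 2 s(1) by (auto simp: U_def)
        then show ?thesis by blast
      qed
    qed
    show "bounded (U n)" for n
      unfolding bounded_two_points using dle by blast
    show "diameter (U n) \<le> \<delta>" for n using diam[of n] l by linarith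
  qed
  also have "\<dots> = (\<Sum>n<N. ennreal (diameter (U n)))"
    by (rule suminf_finite) (auto simp: U_def)
  also have "\<dots> \<le> (\<Sum>n<N. ennreal l)" using diam by (intro sum_mono ennreal_leI)
  also have "\<dots> = ennreal (b - a)" using l by (simp add: ennreal_of_nat_eq_real_of_nat flip: ennreal_mult)
  finally show "hausdorff1_pre \<delta> A \<le> ennreal (b - a)" .
qed

text \<open>A coordinate projection does not increase diameters, so every cover of \<open>A\<close> projects to a cover
  of \<open>{a..b}\<close> by intervals of at most the same total length.\<close>

lemma hausdorff1_ge_projection:
  assumes "{a..b} \<subseteq> (\<lambda>x. x $ i) ` A"
  shows "ennreal (b - a) \<le> hausdorff1 A"
proof -
  have "ennreal (b - a) \<le> hausdorff1_pre 1 A"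
    unfolding hausdorff1_pre_def
  proof (rule INF_greatest)
    fix U :: "nat \<Rightarrow> plane set"
    assume "U \<in> {U. A \<subseteq> (\<Union>n. U n) \<and> (\<forall>n. bounded (U n) \<and> diameter (U n) \<le> 1)}"
    then have U: "A \<subseteq> (\<Union>n. U n)" "\<And>n. bounded (U n)" by auto
    have "\<exists>J. (\<lambda>x. x $ i) ` U n \<subseteq> J \<and> J \<in> sets lborel \<and> emeasure lborel J \<le> ennreal (diameter (U n))" for n
    proof (cases "U n = {}")
      case True then show ?thesis by (intro exI[of _ "{}"]) auto
    next
      case False
      let ?V = "(\<lambda>x. x $ i) ` U n"
      have bd: "bounded ?V" by (rule bounded_linear_image[OF U(2)]) (rule bounded_linear_vec_nth)
      have ne: "?V \<noteq> {}" using False by simp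
      have bdd: "bdd_above ?V" "bdd_below ?V" using bd bounded_imp_bdd_above bounded_imp_bdd_below by auto
      have "Sup ?V - Inf ?V \<le> diameter (U n)"
      proof -
        have "s \<le> Inf ?V + diameter (U n)" if "s \<in> ?V" for s
        proof -
          have "s - diameter (U n) \<le> Inf ?V"
          proof (rule cInf_greatest[OF ne])
            fix r assume "r \<in> ?V"
            with that obtain x y where xy: "x \<in> U n" "y \<in> U n" "s = x $ i" "r = y $ i" by auto
            have "s - r \<le> dist x y" using component_le_norm_cart[of "x - y" i] xy by (simp add: dist_norm)
            also have "\<dots> \<le> diameter (U n)" using diameter_bounded_bound[OF U(2)] xy by blast
            finally show "s - diameter (U n) \<le> r" by simp
          qed
          then show ?thesis by simp
        qed
        then have "Sup ?V \<le> Inf ?V + diameter (U n)" using cSup_least[OF ne] by blast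
        then show ?thesis by simp
      qed
      moreover have "?V \<subseteq> {Inf ?V .. Sup ?V}"
        unfolding subset_iff atLeastAtMost_iff using bdd cInf_lower[of _ ?V] cSup_upper[of _ ?V] by simp
      moreover have "Inf ?V \<le> Sup ?V" using bdd ne by (rule_tac cInf_le_cSup) auto
      ultimately show ?thesis
        by (intro exI[of _ "{Inf ?V .. Sup ?V}"]) (auto intro: ennreal_leI)
    qed
    then obtain J where J: "\<And>n. (\<lambda>x. x $ i) ` U n \<subseteq> J n" "\<And>n. J n \<in> sets lborel"
      "\<And>n. emeasure lborel (J n) \<le> ennreal (diameter (U n))" by metis
    have "ennreal (b - a) = emeasure lborel {a..b}"
      by (cases "a \<le> b") (auto simp: ennreal_neg)
    also have "\<dots> \<le> emeasure lborel (\<Union>n. J n)"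
    proof (rule emeasure_mono)
      show "{a..b} \<subseteq> (\<Union>n. J n)"
      proof
        fix t assume "t \<in> {a..b}"
        then obtain x where "x \<in> A" "t = x $ i" using assms by auto
        then obtain n where "x \<in> U n" using U(1) by auto
        then have "t \<in> J n" using J(1)[of n] \<open>t = x $ i\<close> by auto
        then show "t \<in> (\<Union>n. J n)" by blast
      qed
    qed (use J in auto)
    also have "\<dots> \<le> (\<Sum>n. emeasure lborel (J n))"
      by (rule emeasure_subadditive_countably) (use J in auto)
    also have "\<dots> \<le> (\<Sum>n. ennreal (diameter (U n)))" by (intro suminf_le J) auto
    finally show "ennreal (b - a) \<le> (\<Sum>n. ennreal (diameter (U n)))" .
  qed
  then show ?thesis using hausdorff1_upper[of 1 A] by simp
qed

section \<open>Grid sets and their boundary length\<close>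

text \<open>The grid set with centres \<open>I\<close>.\<close>

definition cells :: "real \<Rightarrow> plane set \<Rightarrow> plane set" where
  "cells \<epsilon> I = (\<Union>i\<in>I. cell \<epsilon> i)"

text \<open>Two points are neighbours if they differ by \<open>\<epsilon>\<close> in exactly one coordinate; for lattice points
  this means that their cells share a side.\<close>

definition nbr :: "real \<Rightarrow> plane \<Rightarrow> plane \<Rightarrow> bool" where
  "nbr \<epsilon> z w \<longleftrightarrow> (\<exists>i. w = z + axis i \<epsilon> \<or> z = w + axis i \<epsilon>)"

text \<open>The sides of cells orthogonal to the direction \<open>i\<close> that separate \<open>I\<close> from its complement, each
  represented by the lattice point preceding it.\<close>

definition cut :: "real \<Rightarrow> plane set \<Rightarrow> 2 \<Rightarrow> plane set" where
  "cut \<epsilon> I i = {z \<in> grid \<epsilon>. (z \<in> I) \<noteq> (z + axis i \<epsilon> \<in> I)}"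

text \<open>The interior of a cell.\<close>

definition open_cell :: "real \<Rightarrow> plane \<Rightarrow> plane set" where
  "open_cell \<epsilon> x = box (x - vec (\<epsilon> / 2)) (x + vec (\<epsilon> / 2))"

lemma plane_eqI: "(x :: plane) $ 1 = y $ 1 \<Longrightarrow> x $ 2 = y $ 2 \<Longrightarrow> x = y"
  by (simp add: vec_eq_iff forall_2)

lemma mem_cell: "x \<in> cell \<epsilon> z \<longleftrightarrow> (\<forall>i. \<bar>x $ i - z $ i\<bar> \<le> \<epsilon> / 2)"
proof -
  have "z $ i - \<epsilon> / 2 \<le> x $ i \<and> x $ i \<le> z $ i + \<epsilon> / 2 \<longleftrightarrow> \<bar>x $ i - z $ i\<bar> \<le> \<epsilon> / 2" for i by linarith
  then show ?thesis unfolding cell_def mem_box_cart by simp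
qed

lemma mem_open_cell: "x \<in> open_cell \<epsilon> z \<longleftrightarrow> (\<forall>i. \<bar>x $ i - z $ i\<bar> < \<epsilon> / 2)"
proof -
  have "z $ i - \<epsilon> / 2 < x $ i \<and> x $ i < z $ i + \<epsilon> / 2 \<longleftrightarrow> \<bar>x $ i - z $ i\<bar> < \<epsilon> / 2" for i by linarith
  then show ?thesis unfolding open_cell_def mem_box_cart by simp
qed

lemma nbr_sym: "nbr \<epsilon> z w \<longleftrightarrow> nbr \<epsilon> w z" by (auto simp: nbr_def)

lemma axis_nth_if: "axis i (a :: real) $ j = (if i = j then a else 0)" by (simp add: axis_def)

lemma norm_axis_real [simp]: "norm (axis i (a :: real)) = \<bar>a\<bar>"
proof -
  have "axis i a = a *\<^sub>R axis i 1" by (simp add: vec_eq_iff axis_def)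
  then show ?thesis by (simp add: norm_axis_1)
qed

lemma norm_nbr: "0 < \<epsilon> \<Longrightarrow> nbr \<epsilon> z w \<Longrightarrow> norm (z - w) = \<epsilon>"
  by (auto simp: nbr_def norm_minus_commute)

lemma zero_in_grid [simp]: "0 \<in> grid \<epsilon>"
  by (auto simp: grid_def intro: exI[of _ 0])

lemma grid_add: "z \<in> grid \<epsilon> \<Longrightarrow> w \<in> grid \<epsilon> \<Longrightarrow> z + w \<in> grid \<epsilon>"
  unfolding grid_def mem_Collect_eq vector_add_component
  by (metis distrib_left of_int_add)

lemma grid_diff: "z \<in> grid \<epsilon> \<Longrightarrow> w \<in> grid \<epsilon> \<Longrightarrow> z - w \<in> grid \<epsilon>"
  unfolding grid_def mem_Collect_eq vector_minus_component
  by (metis right_diff_distrib of_int_diff)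

lemma axis_in_grid: "axis i \<epsilon> \<in> grid \<epsilon>"
proof -
  have "\<exists>k. axis i \<epsilon> $ j = \<epsilon> * of_int k" for j
    by (rule exI[of _ "if i = j then 1 else 0"]) (simp add: axis_nth_if)
  then show ?thesis by (simp add: grid_def)
qed

lemma nbr_grid: "nbr \<epsilon> z w \<Longrightarrow> z \<in> grid \<epsilon> \<Longrightarrow> w \<in> grid \<epsilon>"
  unfolding nbr_def by (metis grid_add grid_diff axis_in_grid add_diff_cancel_right')

lemma grid_component_eq:
  assumes "0 < \<epsilon>" "z \<in> grid \<epsilon>" "w \<in> grid \<epsilon>" "\<bar>z $ i - w $ i\<bar> < \<epsilon>"
  shows "z $ i = w $ i"
proof -
  obtain k l :: int where kl: "z $ i = \<epsilon> * k" "w $ i = \<epsilon> * l" using assms(2,3) unfolding grid_def by blast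
  have "\<epsilon> * \<bar>real_of_int (k - l)\<bar> < \<epsilon> * 1" using assms by (simp add: kl abs_mult flip: right_diff_distrib)
  then have "\<bar>real_of_int (k - l)\<bar> < 1" using assms(1) by (simp only: mult_less_cancel_left_pos)
  then have "k = l" by linarith
  then show ?thesis by (simp add: kl)
qed

lemma grid_component_nbr:
  assumes "0 < \<epsilon>" "z \<in> grid \<epsilon>" "w \<in> grid \<epsilon>" "\<bar>z $ i - w $ i\<bar> \<le> \<epsilon>" "z $ i \<noteq> w $ i"
  shows "z $ i = w $ i + \<epsilon> \<or> w $ i = z $ i + \<epsilon>"
  using grid_component_eq[OF assms(1-3), of i] assms(4,5) by linarith

lemma grid_eqI:
  assumes "0 < \<epsilon>" "z \<in> grid \<epsilon>" "w \<in> grid \<epsilon>" "\<And>i. \<bar>z $ i - w $ i\<bar> < \<epsilon>"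
  shows "z = w"
  using grid_component_eq[OF assms(1-3)] assms(4) by (simp add: vec_eq_iff)

lemma open_cell_disjoint:
  assumes "0 < \<epsilon>" "z \<in> grid \<epsilon>" "w \<in> grid \<epsilon>" "x \<in> open_cell \<epsilon> z" "x \<in> cell \<epsilon> w"
  shows "z = w"
proof (rule grid_eqI[OF assms(1-3)])
  fix i show "\<bar>z $ i - w $ i\<bar> < \<epsilon>"
  proof -
    have "\<bar>x $ i - z $ i\<bar> < \<epsilon> / 2" "\<bar>x $ i - w $ i\<bar> \<le> \<epsilon> / 2"
      using assms(4,5) unfolding mem_open_cell mem_cell by auto
    then show ?thesis by linarith
  qed
qed

lemma open_cell_subset: "open_cell \<epsilon> z \<subseteq> cell \<epsilon> z"
  unfolding open_cell_def cell_def by (rule box_subset_cbox)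

lemma centre_in_open_cell: "0 < \<epsilon> \<Longrightarrow> z \<in> open_cell \<epsilon> z"
  by (simp add: mem_open_cell)

lemma cover_grid: 
  assumes "0 < \<epsilon>" 
  shows "\<exists>z\<in>grid \<epsilon>. x \<in> cell \<epsilon> z"
proof -
  define z :: plane where "z = (\<chi> i. \<epsilon> * of_int (round (x $ i / \<epsilon>)))"
  have "z \<in> grid \<epsilon>" by (auto simp: grid_def z_def)
  moreover have "\<bar>x $ i - z $ i\<bar> \<le> \<epsilon> / 2" for i
  proof -
    have "\<bar>of_int (round (x $ i / \<epsilon>)) - x $ i / \<epsilon>\<bar> \<le> 1/2" by (rule of_int_round_abs_le)
    then have "\<epsilon> * \<bar>of_int (round (x $ i / \<epsilon>)) - x $ i / \<epsilon>\<bar> \<le> \<epsilon> * (1/2)"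
      using assms by (intro mult_left_mono) auto
    moreover have "\<epsilon> * \<bar>of_int (round (x $ i / \<epsilon>)) - x $ i / \<epsilon>\<bar> = \<bar>\<epsilon> * (of_int (round (x $ i / \<epsilon>)) - x $ i / \<epsilon>)\<bar>"
      using assms by (simp add: abs_mult)
    moreover have "\<epsilon> * (of_int (round (x $ i / \<epsilon>)) - x $ i / \<epsilon>) = z $ i - x $ i"
      using assms by (simp add: z_def field_simps)
    ultimately show ?thesis by (simp add: abs_minus_commute)
  qed
  ultimately show ?thesis by (auto simp: mem_cell)
qed

lemma norm_diff_cell_le: "0 < \<epsilon> \<Longrightarrow> x \<in> cell \<epsilon> z \<Longrightarrow> norm (x - z) \<le> \<epsilon>"
  using norm_le_l1_cart[of "x - z"] by (simp add: mem_cell sum_2 forall_2)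

lemma finite_grid_bounded:
  assumes "0 < \<epsilon>" "bounded S"
  shows "finite (grid \<epsilon> \<inter> S)"
proof -
  obtain R where R: "\<And>x. x \<in> S \<Longrightarrow> norm x \<le> R" using assms(2) by (auto simp: bounded_iff)
  define N where "N = \<lceil>R / \<epsilon>\<rceil>"
  have "grid \<epsilon> \<inter> S \<subseteq> (\<lambda>(a, b). \<epsilon> *\<^sub>R vector [of_int a, of_int b]) ` ({-N..N} \<times> {-N..N})"
  proof
    fix z assume z: "z \<in> grid \<epsilon> \<inter> S"
    then obtain a b :: int where ab: "z $ 1 = \<epsilon> * a" "z $ 2 = \<epsilon> * b" unfolding grid_def by blast
    have bound: "k \<in> {-N..N}" if "\<bar>\<epsilon> * of_int k\<bar> \<le> R" for k :: int
    proof -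
      have "\<bar>real_of_int k\<bar> \<le> R / \<epsilon>" using that assms(1) by (simp add: abs_mult field_simps)
      then show ?thesis unfolding N_def by (simp add: abs_le_iff) linarith
    qed
    have "\<bar>z $ i\<bar> \<le> R" for i using component_le_norm_cart[of z i] R[of z] z by simp
    then have "(a, b) \<in> {-N..N} \<times> {-N..N}" using bound ab by (metis mem_Sigma_iff)
    moreover have "z = \<epsilon> *\<^sub>R vector [of_int a, of_int b]"
      by (rule plane_eqI) (simp_all add: ab)
    ultimately show "z \<in> (\<lambda>(a, b). \<epsilon> *\<^sub>R vector [of_int a, of_int b]) ` ({-N..N} \<times> {-N..N})" by force
  qed
  then show ?thesis by (rule finite_subset) auto
qed

lemma centres_cells:
  assumes "0 < \<epsilon>" "I \<subseteq> grid \<epsilon>"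
  shows "centres \<epsilon> (cells \<epsilon> I) = I"
proof
  show "centres \<epsilon> (cells \<epsilon> I) \<subseteq> I"
    unfolding centres_def cells_def
    using open_cell_disjoint[OF assms(1) _ _ centre_in_open_cell[OF assms(1)]] assms(2) by blast
  show "I \<subseteq> centres \<epsilon> (cells \<epsilon> I)"
    unfolding centres_def cells_def
    using centre_in_open_cell[OF assms(1)] open_cell_subset assms(2) by blast
qed

lemma closed_cell: "closed (cell \<epsilon> z)" unfolding cell_def by (rule closed_cbox)

lemma closed_cells:
  assumes "0 < \<epsilon>" "I \<subseteq> grid \<epsilon>"
  shows "closed (cells \<epsilon> I)"
  unfolding closed_def open_dist
proof
  fix x assume x: "x \<in> - cells \<epsilon> I"
  define J where "J = I \<inter> cball x (2 * \<epsilon>)"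
  have "finite J"
    using finite_grid_bounded[OF assms(1), of "cball x (2*\<epsilon>)"] assms(2)
    by (rule_tac finite_subset) (auto simp: J_def)
  then have "closed (\<Union>i\<in>J. cell \<epsilon> i)" by (intro closed_UN ballI closed_cell)
  moreover have "x \<notin> (\<Union>i\<in>J. cell \<epsilon> i)" using x by (auto simp: cells_def J_def)
  ultimately obtain e where e: "e > 0" "ball x e \<subseteq> - (\<Union>i\<in>J. cell \<epsilon> i)"
    by (meson ComplI open_Compl open_contains_ball)
  show "\<exists>e>0. \<forall>y. dist y x < e \<longrightarrow> y \<in> - cells \<epsilon> I"
  proof (intro exI[of _ "min e \<epsilon>"] conjI allI impI)
    fix y assume y: "dist y x < min e \<epsilon>"
    show "y \<in> - cells \<epsilon> I"
    proof
      assume "y \<in> cells \<epsilon> I"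
      then obtain z where z: "z \<in> I" "y \<in> cell \<epsilon> z" by (auto simp: cells_def)
      have "dist x z \<le> dist x y + dist y z" by (rule dist_triangle)
      then have "z \<in> J" using z(1) y norm_diff_cell_le[OF assms(1) z(2)] by (simp add: J_def dist_norm norm_minus_commute)
      then show False using e(2) y z(2) by (auto simp: dist_commute)
    qed
  qed (use e assms in auto)
qed

lemma closure_open_cell: "0 < \<epsilon> \<Longrightarrow> closure (open_cell \<epsilon> z) = cell \<epsilon> z"
  unfolding open_cell_def cell_def
  by (rule closure_box) (metis centre_in_open_cell open_cell_def empty_iff)

text \<open>The frontier of a grid set is symmetric in the set of centres and its complement in the lattice.\<close>

lemma frontier_cells:
  assumes "0 < \<epsilon>" "I \<subseteq> grid \<epsilon>"
  shows "frontier (cells \<epsilon> I) = cells \<epsilon> I \<inter> cells \<epsilon> (grid \<epsilon> - I)"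
proof -
  have "- cells \<epsilon> I \<subseteq> cells \<epsilon> (grid \<epsilon> - I)"
    using cover_grid[OF assms(1)] unfolding cells_def by fast
  then have 1: "closure (- cells \<epsilon> I) \<subseteq> cells \<epsilon> (grid \<epsilon> - I)"
    by (intro closure_minimal closed_cells assms) auto
  have "cell \<epsilon> z \<subseteq> closure (- cells \<epsilon> I)" if "z \<in> grid \<epsilon> - I" for z
  proof -
    have "open_cell \<epsilon> z \<subseteq> - cells \<epsilon> I"
      using open_cell_disjoint[OF assms(1)] that assms(2) unfolding cells_def by blast
    then show ?thesis using closure_mono closure_open_cell[OF assms(1)] by metis
  qed
  then have 2: "cells \<epsilon> (grid \<epsilon> - I) \<subseteq> closure (- cells \<epsilon> I)" by (auto simp: cells_def)
  show ?thesis
    using 1 2 closed_cells[OF assms] by (simp add: frontier_closures closure_closed)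
qed

lemma frontier_cells_compl:
  assumes "0 < \<epsilon>" "I \<subseteq> grid \<epsilon>"
  shows "frontier (cells \<epsilon> (grid \<epsilon> - I)) = frontier (cells \<epsilon> I)"
  using frontier_cells[OF assms] frontier_cells[OF assms(1), of "grid \<epsilon> - I"] assms(2)
  by (simp add: double_diff Int_commute)

lemma cells_common_point:
  assumes "0 < \<epsilon>" "z \<in> grid \<epsilon>" "w \<in> grid \<epsilon>" "x \<in> cell \<epsilon> z" "x \<in> cell \<epsilon> w"
  shows "z $ i = w $ i \<or> z $ i = w $ i + \<epsilon> \<or> w $ i = z $ i + \<epsilon>"
proof -
  have "\<bar>x $ i - z $ i\<bar> \<le> \<epsilon> / 2" "\<bar>x $ i - w $ i\<bar> \<le> \<epsilon> / 2" using assms by (auto simp: mem_cell)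
  then have "\<bar>z $ i - w $ i\<bar> \<le> \<epsilon>" by linarith
  then show ?thesis using grid_component_nbr[OF assms(1-3)] by blast
qed

text \<open>Two cells with a common point are joined by a third one through that point that differs from
  each of them in at most one coordinate.\<close>

lemma cells_corner:
  assumes "0 < \<epsilon>" "z \<in> grid \<epsilon>" "w \<in> grid \<epsilon>" "x \<in> cell \<epsilon> z" "x \<in> cell \<epsilon> w"
  obtains u where "u \<in> grid \<epsilon>" "x \<in> cell \<epsilon> u" "u = z \<or> nbr \<epsilon> z u" "u = w \<or> nbr \<epsilon> w u"
proof -
  define u :: plane where "u = vector [w $ 1, z $ 2]"
  have u: "u $ 1 = w $ 1" "u $ 2 = z $ 2" by (auto simp: u_def)
  have ax: "axis (1::2) \<epsilon> $ 1 = \<epsilon>" "axis (1::2) \<epsilon> $ 2 = 0" "axis (2::2) \<epsilon> $ 1 = 0" "axis (2::2) \<epsilon> $ 2 = \<epsilon>"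
    by (auto simp: axis_nth_if)
  show thesis
  proof
    show "u \<in> grid \<epsilon>" using assms(2,3) u by (auto simp: grid_def forall_2)
    show "x \<in> cell \<epsilon> u" using assms(4,5) u by (auto simp: mem_cell forall_2)
    have "z = u \<or> z = u + axis 1 \<epsilon> \<or> u = z + axis 1 \<epsilon>"
      using cells_common_point[OF assms, of 1] u ax by (auto simp: vec_eq_iff forall_2)
    then show "u = z \<or> nbr \<epsilon> z u" by (auto simp: nbr_def)
    have "w = u \<or> w = u + axis 2 \<epsilon> \<or> u = w + axis 2 \<epsilon>"
      using cells_common_point[OF assms, of 2] u ax by (auto simp: vec_eq_iff forall_2)
    then show "u = w \<or> nbr \<epsilon> w u" by (auto simp: nbr_def)
  qed
qed

lemma frontier_cells_subset_edges:
  assumes "0 < \<epsilon>" "I \<subseteq> grid \<epsilon>"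
  shows "frontier (cells \<epsilon> I) \<subseteq> (\<Union>i. \<Union>z\<in>cut \<epsilon> I i. cell \<epsilon> z \<inter> cell \<epsilon> (z + axis i \<epsilon>))"
proof
  fix x assume "x \<in> frontier (cells \<epsilon> I)"
  then obtain z w where zw: "z \<in> I" "w \<in> grid \<epsilon> - I" "x \<in> cell \<epsilon> z" "x \<in> cell \<epsilon> w"
    unfolding frontier_cells[OF assms] by (auto simp: cells_def)
  have "z \<in> grid \<epsilon>" "w \<in> grid \<epsilon>" using zw(1,2) assms(2) by auto
  from cells_corner[OF assms(1) this zw(3,4)]
  obtain u where u: "u \<in> grid \<epsilon>" "x \<in> cell \<epsilon> u" "u = z \<or> nbr \<epsilon> z u" "u = w \<or> nbr \<epsilon> w u"
    by metis
  have "\<exists>a b. nbr \<epsilon> a b \<and> a \<in> grid \<epsilon> \<and> b \<in> grid \<epsilon> \<and> x \<in> cell \<epsilon> a \<and> x \<in> cell \<epsilon> b \<and> a \<in> I \<and> b \<notin> I"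
  proof (cases "u \<in> I")
    case True
    then have "nbr \<epsilon> u w" using u(4) zw(2) nbr_sym by blast
    then show ?thesis using True u(1,2) zw(2,4) by blast
  next
    case False
    then have "nbr \<epsilon> z u" using u(3) zw(1) by blast
    then show ?thesis using False u(1,2) zw(1,3) assms(2) by blast
  qed
  then show "x \<in> (\<Union>i. \<Union>z\<in>cut \<epsilon> I i. cell \<epsilon> z \<inter> cell \<epsilon> (z + axis i \<epsilon>))"
    unfolding nbr_def cut_def by blast
qed

lemma other_index:
  fixes i :: 2
  obtains j :: 2 where "j \<noteq> i" "\<And>k. k = i \<or> k = j"
proof (cases "i = 1")
  case True
  show ?thesis
  proof (rule that)
    show "2 \<noteq> i" using True by simp
    show "k = i \<or> k = 2" for k using True exhaust_2[of k] by simp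
  qed
next
  case False
  show ?thesis
  proof (rule that)
    show "1 \<noteq> i" using False by simp
    show "k = i \<or> k = 1" for k using False exhaust_2[of k] exhaust_2[of i] by auto
  qed
qed

lemma hausdorff1_edge_le:
  assumes "0 < \<epsilon>"
  shows "hausdorff1 (cell \<epsilon> z \<inter> cell \<epsilon> (z + axis i \<epsilon>)) \<le> ennreal \<epsilon>"
proof -
  obtain j where j: "j \<noteq> i" "\<And>k. k = i \<or> k = j" using other_index[of i] by blast
  define \<gamma> where "\<gamma> s = z + axis i (\<epsilon> / 2) + axis j s" for s
  have "hausdorff1 (cell \<epsilon> z \<inter> cell \<epsilon> (z + axis i \<epsilon>)) \<le> ennreal (\<epsilon> / 2 - (- \<epsilon> / 2))"
  proof (rule hausdorff1_curve_le)
    have "\<gamma> s - \<gamma> t = axis j (s - t)" for s t by (simp add: \<gamma>_def vec_eq_iff axis_nth_if)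
    then show "dist (\<gamma> s) (\<gamma> t) \<le> \<bar>s - t\<bar>" for s t
      by (simp add: dist_norm)
    show "cell \<epsilon> z \<inter> cell \<epsilon> (z + axis i \<epsilon>) \<subseteq> \<gamma> ` {- \<epsilon> / 2..\<epsilon> / 2}"
    proof
      fix x assume x: "x \<in> cell \<epsilon> z \<inter> cell \<epsilon> (z + axis i \<epsilon>)"
      then have "\<bar>x $ i - z $ i\<bar> \<le> \<epsilon> / 2" "\<bar>x $ i - (z $ i + \<epsilon>)\<bar> \<le> \<epsilon> / 2" and xj: "\<bar>x $ j - z $ j\<bar> \<le> \<epsilon> / 2"
        by (auto simp: mem_cell axis_nth_if split: if_splits dest: spec[of _ i])
      then have xi: "x $ i = z $ i + \<epsilon> / 2" by linarith
      have "x $ k = \<gamma> (x $ j - z $ j) $ k" for k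
        using j(1) j(2)[of k] xi by (auto simp: \<gamma>_def axis_nth_if)
      then have "x = \<gamma> (x $ j - z $ j)" unfolding vec_eq_iff by blast
      moreover have "x $ j - z $ j \<in> {- \<epsilon> / 2..\<epsilon> / 2}"
        using abs_le_D1[OF xj] abs_le_D2[OF xj] by simp
      ultimately show "x \<in> \<gamma> ` {- \<epsilon> / 2..\<epsilon> / 2}" by blast
    qed
  qed (use assms in auto)
  then show ?thesis by simp
qed

lemma finite_cut:
  assumes "finite I"
  shows "finite (cut \<epsilon> I i)"
proof (rule finite_subset)
  show "cut \<epsilon> I i \<subseteq> I \<union> (\<lambda>z. z - axis i \<epsilon>) ` I"
    unfolding cut_def by (auto simp: image_iff algebra_simps) 
qed (use assms in auto)

lemma hausdorff1_frontier_cells_le: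
  assumes "0 < \<epsilon>" "I \<subseteq> grid \<epsilon>" "finite I"
  shows "hausdorff1 (frontier (cells \<epsilon> I)) \<le> ennreal (\<epsilon> * (\<Sum>i\<in>UNIV. card (cut \<epsilon> I i)))"
proof -
  have "hausdorff1 (frontier (cells \<epsilon> I))
      \<le> hausdorff1 (\<Union>i. \<Union>z\<in>cut \<epsilon> I i. cell \<epsilon> z \<inter> cell \<epsilon> (z + axis i \<epsilon>))"
    by (rule hausdorff1_mono[OF frontier_cells_subset_edges[OF assms(1,2)]])
  also have "\<dots> \<le> (\<Sum>i\<in>UNIV. hausdorff1 (\<Union>z\<in>cut \<epsilon> I i. cell \<epsilon> z \<inter> cell \<epsilon> (z + axis i \<epsilon>)))"
    by (rule hausdorff1_UN_le) simp
  also have "\<dots> \<le> (\<Sum>i\<in>UNIV. \<Sum>z\<in>cut \<epsilon> I i. hausdorff1 (cell \<epsilon> z \<inter> cell \<epsilon> (z + axis i \<epsilon>)))"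
    by (intro sum_mono hausdorff1_UN_le finite_cut assms)
  also have "\<dots> \<le> (\<Sum>i\<in>UNIV. \<Sum>z\<in>cut \<epsilon> I i. ennreal \<epsilon>)"
    by (intro sum_mono hausdorff1_edge_le assms)
  also have "\<dots> = ennreal (\<epsilon> * (\<Sum>i\<in>UNIV. card (cut \<epsilon> I i)))"
    using assms(1)
    by (simp add: ennreal_of_nat_eq_real_of_nat sum_2 distrib_left algebra_simps flip: ennreal_mult ennreal_plus)
  finally show ?thesis .
qed

lemma hausdorff1_frontier_cell_le:
  assumes "0 < \<epsilon>" "z \<in> grid \<epsilon>"
  shows "hausdorff1 (frontier (cell \<epsilon> z)) \<le> ennreal (4 * \<epsilon>)"
proof -
  have ne: "axis i \<epsilon> \<noteq> 0" for i :: 2 using assms(1) by (simp add: axis_eq_0_iff)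
  have "cut \<epsilon> {z} i = {z, z - axis i \<epsilon>}" for i :: 2
    using assms ne[of i] grid_diff[OF assms(2) axis_in_grid] by (auto simp: cut_def algebra_simps)
  moreover have "z \<noteq> z - axis i \<epsilon>" for i :: 2 using ne[of i] by simp
  ultimately have "card (cut \<epsilon> {z} i) = 2" for i :: 2 by simp
  then show ?thesis
    using hausdorff1_frontier_cells_le[of \<epsilon> "{z}"] assms by (simp add: cells_def sum_2 mult.commute)
qed

text \<open>Next to an isolated cell no part of the old frontier is lost: a frontier point of \<open>cells \<epsilon> I\<close> on
  the cell of \<open>z\<close> is a corner, where a third cell outside \<open>I\<close> meets it.\<close>

lemma frontier_cells_insert_isolated:
  assumes "0 < \<epsilon>" "I \<subseteq> grid \<epsilon>" "z \<in> grid \<epsilon>" "z \<notin> I" "\<And>w. nbr \<epsilon> z w \<Longrightarrow> w \<notin> I"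
  shows "frontier (cells \<epsilon> I) \<subseteq> frontier (cells \<epsilon> (insert z I))"
proof
  fix x assume "x \<in> frontier (cells \<epsilon> I)"
  then obtain y w where yw: "y \<in> I" "w \<in> grid \<epsilon> - I" "x \<in> cell \<epsilon> y" "x \<in> cell \<epsilon> w"
    unfolding frontier_cells[OF assms(1,2)] by (auto simp: cells_def)
  have "\<exists>u\<in>grid \<epsilon> - insert z I. x \<in> cell \<epsilon> u"
  proof (cases "w = z")
    case True
    have yg: "y \<in> grid \<epsilon>" using yw(1) assms(2) by blast
    obtain u where u: "u \<in> grid \<epsilon>" "x \<in> cell \<epsilon> u" "u = y \<or> nbr \<epsilon> y u" "u = z \<or> nbr \<epsilon> z u"
      using cells_corner[OF assms(1) yg assms(3) yw(3)] yw(4) True by metis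
    have "\<not> nbr \<epsilon> z y" "y \<noteq> z" using assms(4,5) yw(1) by auto
    then have "u \<noteq> z" "u \<notin> I" using u(3,4) assms(5) nbr_sym by blast+
    then show ?thesis using u by blast
  qed (use yw in blast)
  then show "x \<in> frontier (cells \<epsilon> (insert z I))"
    using yw(1,3) assms(2,3) by (subst frontier_cells[OF assms(1)]) (auto simp: cells_def)
qed

text \<open>The four sides of an isolated cell, shortened by \<open>\<delta>\<close> at both ends, are compact, pairwise
  disjoint and disjoint from the old frontier. Hence their lengths add up, and \<open>\<delta>\<close> tends to 0.\<close>

lemma hausdorff1_frontier_insert_isolated:
  assumes "0 < \<epsilon>" "I \<subseteq> grid \<epsilon>" "z \<in> grid \<epsilon>" "z \<notin> I" "\<And>w. nbr \<epsilon> z w \<Longrightarrow> w \<notin> I"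
  shows "hausdorff1 (frontier (cells \<epsilon> I)) + ennreal (4 * \<epsilon>)
       \<le> hausdorff1 (frontier (cells \<epsilon> (insert z I)))"
proof (rule ennreal_le_epsilon)
  fix e :: real assume "0 < e"
  define \<delta> where "\<delta> = min (\<epsilon> / 4) (e / 8)"
  have \<delta>: "0 < \<delta>" "\<delta> < \<epsilon> / 2" "8 * \<delta> \<le> e" using assms(1) \<open>0 < e\<close> by (auto simp: \<delta>_def min_def)
  define K :: "2 \<Rightarrow> real \<Rightarrow> plane set" where
    "K i s = {x. x $ i = z $ i + s * (\<epsilon> / 2) \<and> (\<forall>j. j \<noteq> i \<longrightarrow> \<bar>x $ j - z $ j\<bar> \<le> \<epsilon> / 2 - \<delta>)}" for i s
  let ?F = "frontier (cells \<epsilon> I)" and ?F' = "frontier (cells \<epsilon> (insert z I))"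
  have compK: "compact (K i s)" for i s
  proof -
    obtain j where j: "j \<noteq> i" "\<And>k. k = i \<or> k = j" using other_index[of i] by blast
    have all: "(\<forall>k. P k) \<longleftrightarrow> P i \<and> P j" for P using j(2) by metis
    let ?c = "z + axis i (s * (\<epsilon> / 2))" and ?h = "axis j (\<epsilon> / 2 - \<delta>)"
    have "K i s = cbox (?c - ?h) (?c + ?h)"
    proof (rule set_eqI)
      fix x
      have "x \<in> K i s \<longleftrightarrow> x $ i = z $ i + s * (\<epsilon> / 2) \<and> \<bar>x $ j - z $ j\<bar> \<le> \<epsilon> / 2 - \<delta>"
        unfolding K_def mem_Collect_eq all using j(1) by auto
      moreover have "x \<in> cbox (?c - ?h) (?c + ?h) \<longleftrightarrow>
          (z $ i + s * (\<epsilon> / 2) \<le> x $ i \<and> x $ i \<le> z $ i + s * (\<epsilon> / 2)) \<and>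
          (z $ j - (\<epsilon> / 2 - \<delta>) \<le> x $ j \<and> x $ j \<le> z $ j + (\<epsilon> / 2 - \<delta>))"
        unfolding mem_box_cart all using j(1) by (simp add: axis_nth_if)
      ultimately show "x \<in> K i s \<longleftrightarrow> x \<in> cbox (?c - ?h) (?c + ?h)" by linarith
    qed
    then show ?thesis by simp
  qed
  have lenK: "ennreal (\<epsilon> - 2 * \<delta>) \<le> hausdorff1 (K i s)" for i s
  proof -
    obtain j where j: "j \<noteq> i" "\<And>k. k = i \<or> k = j" using other_index[of i] by blast
    let ?a = "z $ j - (\<epsilon> / 2 - \<delta>)" and ?b = "z $ j + (\<epsilon> / 2 - \<delta>)"
    have "{?a..?b} \<subseteq> (\<lambda>x. x $ j) ` K i s"
    proof
      fix t assume t: "t \<in> {?a..?b}"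
      define x :: plane where "x = (\<chi> k. if k = i then z $ i + s * (\<epsilon> / 2) else t)"
      have "x \<in> K i s" "x $ j = t"
        using t j by (auto simp: K_def x_def abs_le_iff) (smt (verit) j(2))+
      then show "t \<in> (\<lambda>x. x $ j) ` K i s" by force
    qed
    from hausdorff1_ge_projection[OF this] show ?thesis by (simp add: algebra_simps)
  qed
  have sub: "K i s \<subseteq> ?F'" and dis: "cells \<epsilon> I \<inter> K i s = {}" if s: "s = 1 \<or> s = -1" for i s
  proof -
    define z' where "z' = z + axis i (s * \<epsilon>)"
    have nz': "nbr \<epsilon> z z'" using s by (auto simp: nbr_def z'_def vec_eq_iff axis_def intro!: exI[of _ i])
    have inz: "x \<in> cell \<epsilon> z" and inz': "x \<in> cell \<epsilon> z'" if "x \<in> K i s" for x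
    proof -
      have "\<bar>x $ k - z $ k\<bar> \<le> \<epsilon> / 2 \<and> \<bar>x $ k - z' $ k\<bar> \<le> \<epsilon> / 2" for k
        using that s \<delta>(1) assms(1) by (cases "k = i") (auto simp: K_def z'_def axis_nth_if)
      then show "x \<in> cell \<epsilon> z" "x \<in> cell \<epsilon> z'" by (auto simp: mem_cell)
    qed
    have "z' \<noteq> z" using norm_nbr[OF assms(1) nz'] assms(1) by auto
    then have "z' \<in> grid \<epsilon> - insert z I" using nbr_grid[OF nz' assms(3)] assms(5)[OF nz'] by blast
    then show "K i s \<subseteq> ?F'"
      using inz inz' assms(2,3) by (subst frontier_cells[OF assms(1)]) (auto simp: cells_def)
    show "cells \<epsilon> I \<inter> K i s = {}"
    proof (rule ccontr)
      assume "cells \<epsilon> I \<inter> K i s \<noteq> {}"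
      then obtain x w where x: "x \<in> K i s" "x \<in> cell \<epsilon> w" "w \<in> I" by (auto simp: cells_def)
      then have wg: "w \<in> grid \<epsilon>" using assms(2) by blast
      have eq: "z $ k = w $ k" if "k \<noteq> i" for k
      proof (rule grid_component_eq[OF assms(1,3) wg])
        have "\<bar>x $ k - z $ k\<bar> \<le> \<epsilon> / 2 - \<delta>" "\<bar>x $ k - w $ k\<bar> \<le> \<epsilon> / 2"
          using x that by (auto simp: K_def mem_cell)
        then show "\<bar>z $ k - w $ k\<bar> < \<epsilon>" using \<delta>(1) by linarith
      qed
      consider "z $ i = w $ i" | "z $ i = w $ i + \<epsilon>" | "w $ i = z $ i + \<epsilon>"
        using cells_common_point[OF assms(1,3) wg inz[OF x(1)] x(2)] by blast
      then have "z = w \<or> z = w + axis i \<epsilon> \<or> w = z + axis i \<epsilon>"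
      proof cases
        case 1 then have "z = w" using eq by (metis vec_eq_iff) then show ?thesis by blast
      next
        case 2 then have "z = w + axis i \<epsilon>" using eq by (auto simp: vec_eq_iff axis_nth_if) then show ?thesis by blast
      next
        case 3 then have "w = z + axis i \<epsilon>" using eq by (auto simp: vec_eq_iff axis_nth_if) then show ?thesis by blast
      qed
      then show False using assms(4,5) x(3) by (auto simp: nbr_def)
    qed
  qed
  have "?F \<subseteq> cells \<epsilon> I" unfolding frontier_cells[OF assms(1,2)] by blast
  then have disF: "?F \<inter> K i s = {}" if "s = 1 \<or> s = -1" for i s using dis[OF that] by blast
  have disK: "K i s \<inter> K i' s' = {}" if "s = 1 \<or> s = -1" "s' = 1 \<or> s' = -1" "(i, s) \<noteq> (i', s')" for i s i' s'
  proof (cases "i = i'")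
    case True then show ?thesis using that assms(1) by (auto simp: K_def)
  next
    case False
    have "\<not> \<bar>s * (\<epsilon> / 2)\<bar> \<le> \<epsilon> / 2 - \<delta>" using that(1) \<delta>(1) assms(1) by auto
    then show ?thesis using False by (auto simp: K_def)
  qed
  have clK: "closed (K i s)" for i s using compK compact_imp_closed by blast
  have step: "hausdorff1 A + ennreal (\<epsilon> - 2 * \<delta>) \<le> hausdorff1 (A \<union> K i s)"
    if "closed A" "A \<inter> K i s = {}" for A i s
    using hausdorff1_Un_separated[OF that(1) compK that(2)] lenK[of i s] by (meson add_left_mono order_trans)
  let ?A1 = "?F \<union> K 1 1" let ?A2 = "?A1 \<union> K 1 (-1)" let ?A3 = "?A2 \<union> K 2 1" let ?A4 = "?A3 \<union> K 2 (-1)"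
  let ?l = "ennreal (\<epsilon> - 2 * \<delta>)"
  have cl: "closed ?F" "closed ?A1" "closed ?A2" "closed ?A3"
    by (intro closed_Un clK frontier_closed)+
  have dis1: "?F \<inter> K 1 1 = {}" by (rule disF) simp
  have dis2: "?A1 \<inter> K 1 (-1) = {}"
    using disF[of "-1" 1] disK[of 1 "-1" 1 1] by (simp add: Int_Un_distrib2)
  have dis3: "?A2 \<inter> K 2 1 = {}"
    using disF[of 1 2] disK[of 1 1 1 2] disK[of "-1" 1 1 2] by (simp add: Int_Un_distrib2)
  have dis4: "?A3 \<inter> K 2 (-1) = {}"
    using disF[of "-1" 2] disK[of 1 "-1" 1 2] disK[of "-1" "-1" 1 2] disK[of 1 "-1" 2 2]
    by (simp add: Int_Un_distrib2)
  have "hausdorff1 ?F + ?l + ?l + ?l + ?l \<le> hausdorff1 ?A1 + ?l + ?l + ?l"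
    by (intro add_right_mono step cl dis1)
  also have "\<dots> \<le> hausdorff1 ?A2 + ?l + ?l" by (intro add_right_mono step cl dis2)
  also have "\<dots> \<le> hausdorff1 ?A3 + ?l" by (intro add_right_mono step cl dis3)
  also have "\<dots> \<le> hausdorff1 ?A4" by (intro step cl dis4)
  also have "\<dots> \<le> hausdorff1 ?F'"
    using sub frontier_cells_insert_isolated[OF assms] by (intro hausdorff1_mono) auto
  finally have "hausdorff1 ?F + ?l + ?l + ?l + ?l \<le> hausdorff1 ?F'" .
  moreover have "?l + ?l + ?l + ?l = ennreal (4 * \<epsilon> - 8 * \<delta>)"
    using \<delta> by (simp flip: ennreal_plus)
  ultimately have main: "hausdorff1 ?F + ennreal (4 * \<epsilon> - 8 * \<delta>) \<le> hausdorff1 ?F'"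
    by (simp add: add.assoc)
  have "ennreal (4 * \<epsilon>) \<le> ennreal (4 * \<epsilon> - 8 * \<delta>) + ennreal e"
  proof -
    have "ennreal (4 * \<epsilon>) \<le> ennreal ((4 * \<epsilon> - 8 * \<delta>) + e)" using \<delta> by (intro ennreal_leI) simp
    then show ?thesis using \<delta> \<open>0 < e\<close> by (subst (asm) ennreal_plus) simp_all
  qed
  then have "hausdorff1 ?F + ennreal (4 * \<epsilon>) \<le> hausdorff1 ?F + ennreal (4 * \<epsilon> - 8 * \<delta>) + ennreal e"
    by (metis add.assoc add_left_mono)
  also have "\<dots> \<le> hausdorff1 ?F' + ennreal e" by (rule add_right_mono[OF main])
  finally show "hausdorff1 ?F + ennreal (4 * \<epsilon>) \<le> hausdorff1 ?F' + ennreal e" .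
qed

text \<open>Passing to complements turns an isolated cell into a hole.\<close>

lemma hausdorff1_frontier_remove_surrounded:
  assumes "0 < \<epsilon>" "I \<subseteq> grid \<epsilon>" "z \<in> I" "\<And>w. nbr \<epsilon> z w \<Longrightarrow> w \<in> I"
  shows "hausdorff1 (frontier (cells \<epsilon> I)) + ennreal (4 * \<epsilon>)
       \<le> hausdorff1 (frontier (cells \<epsilon> (I - {z})))"
proof -
  have eq: "insert z (grid \<epsilon> - I) = grid \<epsilon> - (I - {z})" using assms(2,3) by auto
  have "hausdorff1 (frontier (cells \<epsilon> (grid \<epsilon> - I))) + ennreal (4 * \<epsilon>)
      \<le> hausdorff1 (frontier (cells \<epsilon> (insert z (grid \<epsilon> - I))))"
    by (rule hausdorff1_frontier_insert_isolated) (use assms(1-3) assms(4) in auto)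
  moreover have "frontier (cells \<epsilon> (grid \<epsilon> - (I - {z}))) = frontier (cells \<epsilon> (I - {z}))"
    by (rule frontier_cells_compl) (use assms(1,2) in auto)
  ultimately show ?thesis
    unfolding eq frontier_cells_compl[OF assms(1,2)] by simp
qed

lemma hausdorff1_frontier_insert_le:
  assumes "0 < \<epsilon>" "z \<in> grid \<epsilon>"
  shows "hausdorff1 (frontier (cells \<epsilon> (insert z I)))
       \<le> hausdorff1 (frontier (cells \<epsilon> I)) + ennreal (4 * \<epsilon>)"
proof -
  have "cells \<epsilon> (insert z I) = cells \<epsilon> I \<union> cell \<epsilon> z" by (auto simp: cells_def)
  then have "hausdorff1 (frontier (cells \<epsilon> (insert z I)))
      \<le> hausdorff1 (frontier (cells \<epsilon> I) \<union> frontier (cell \<epsilon> z))"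
    using frontier_Un_subset[of "cells \<epsilon> I" "cell \<epsilon> z"] by (intro hausdorff1_mono) simp
  also have "\<dots> \<le> hausdorff1 (frontier (cells \<epsilon> I)) + hausdorff1 (frontier (cell \<epsilon> z))"
    by (rule hausdorff1_Un)
  also have "\<dots> \<le> hausdorff1 (frontier (cells \<epsilon> I)) + ennreal (4 * \<epsilon>)"
    using hausdorff1_frontier_cell_le[OF assms] by (rule add_left_mono)
  finally show ?thesis .
qed

text \<open>The perimeter of a grid set as a real number; it is finite for finite sets of lattice points, and
  otherwise the value 0 may be a default.\<close>

definition per :: "real \<Rightarrow> plane set \<Rightarrow> real" where
  "per \<epsilon> I = enn2real (hausdorff1 (frontier (cells \<epsilon> I)))"

lemma hausdorff1_frontier_eq_per:
  assumes "0 < \<epsilon>" "I \<subseteq> grid \<epsilon>" "finite I"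
  shows "hausdorff1 (frontier (cells \<epsilon> I)) = ennreal (per \<epsilon> I)"
  using order_le_less_trans[OF hausdorff1_frontier_cells_le[OF assms] ennreal_less_top]
  by (simp add: per_def)

lemma per_nonneg [simp]: "0 \<le> per \<epsilon> I" by (simp add: per_def)

lemma per_le_cut:
  assumes "0 < \<epsilon>" "I \<subseteq> grid \<epsilon>" "finite I"
  shows "per \<epsilon> I \<le> \<epsilon> * (\<Sum>i\<in>UNIV. card (cut \<epsilon> I i))"
  using hausdorff1_frontier_cells_le[OF assms] assms(1) unfolding hausdorff1_frontier_eq_per[OF assms]
  by (subst (asm) ennreal_le_iff) (auto intro!: mult_nonneg_nonneg sum_nonneg)

lemma per_insert_le:
  assumes "0 < \<epsilon>" "I \<subseteq> grid \<epsilon>" "finite I" "z \<in> grid \<epsilon>"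
  shows "per \<epsilon> (insert z I) \<le> per \<epsilon> I + 4 * \<epsilon>"
  using hausdorff1_frontier_insert_le[OF assms(1,4), of I] assms
  by (simp add: hausdorff1_frontier_eq_per flip: ennreal_plus)

lemma per_insert_isolated:
  assumes "0 < \<epsilon>" "I \<subseteq> grid \<epsilon>" "finite I" "z \<in> grid \<epsilon>" "z \<notin> I" "\<And>w. nbr \<epsilon> z w \<Longrightarrow> w \<notin> I"
  shows "per \<epsilon> I + 4 * \<epsilon> \<le> per \<epsilon> (insert z I)"
  using hausdorff1_frontier_insert_isolated[OF assms(1,2,4,5)] assms
  by (simp add: hausdorff1_frontier_eq_per flip: ennreal_plus)

lemma per_remove_surrounded:
  assumes "0 < \<epsilon>" "I \<subseteq> grid \<epsilon>" "finite I" "z \<in> I" "\<And>w. nbr \<epsilon> z w \<Longrightarrow> w \<in> I"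
  shows "per \<epsilon> I + 4 * \<epsilon> \<le> per \<epsilon> (I - {z})"
proof -
  have "I - {z} \<subseteq> grid \<epsilon>" "finite (I - {z})" using assms by auto
  then show ?thesis
    using hausdorff1_frontier_remove_surrounded[OF assms(1,2,4,5)] assms
    by (simp add: hausdorff1_frontier_eq_per flip: ennreal_plus)
qed

section \<open>Norms on the plane\<close>

lemma is_norm_minus: "is_norm \<phi> \<Longrightarrow> \<phi> (- x) = \<phi> x"
  unfolding is_norm_def by (metis abs_minus_cancel abs_one mult_1 scaleR_minus1_left)

lemma is_norm_diff_commute: "is_norm \<phi> \<Longrightarrow> \<phi> (x - y) = \<phi> (y - x)"
  using is_norm_minus[of \<phi> "x - y"] by simp

lemma is_norm_triangle: "is_norm \<phi> \<Longrightarrow> \<phi> (x + y) \<le> \<phi> x + \<phi> y"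
  by (simp add: is_norm_def)

lemma is_norm_triangle_diff: "is_norm \<phi> \<Longrightarrow> \<phi> x \<le> \<phi> y + \<phi> (x - y)"
  using is_norm_triangle[of \<phi> y "x - y"] by simp

lemma is_norm_scale: "is_norm \<phi> \<Longrightarrow> \<phi> (a *\<^sub>R x) = \<bar>a\<bar> * \<phi> x"
  by (simp add: is_norm_def)

lemma is_norm_nonneg: "is_norm \<phi> \<Longrightarrow> 0 \<le> \<phi> x" by (simp add: is_norm_def)

lemma is_norm_zero: "is_norm \<phi> \<Longrightarrow> \<phi> 0 = 0" by (simp add: is_norm_def)

lemma is_norm_upper_bound:
  assumes "is_norm \<phi>"
  obtains K where "0 < K" "\<And>x. \<phi> x \<le> K * norm x"
proof
  let ?K = "\<phi> (axis 1 1) + \<phi> (axis 2 1) + 1 :: real"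
  show "0 < ?K" using is_norm_nonneg[OF assms] by (smt (verit))
  fix x
  have "x = (x $ 1) *\<^sub>R axis 1 1 + (x $ 2) *\<^sub>R (axis 2 1 :: plane)"
    by (simp add: vec_eq_iff forall_2 axis_def)
  then have "\<phi> x \<le> \<bar>x $ 1\<bar> * \<phi> (axis 1 1) + \<bar>x $ 2\<bar> * \<phi> (axis 2 1)"
    using is_norm_triangle[OF assms] is_norm_scale[OF assms] by metis
  also have "\<dots> \<le> norm x * \<phi> (axis 1 1) + norm x * \<phi> (axis 2 1)"
    by (intro add_mono mult_right_mono component_le_norm_cart is_norm_nonneg[OF assms])
  also have "\<dots> \<le> ?K * norm x" by (simp add: algebra_simps)
  finally show "\<phi> x \<le> ?K * norm x" .
qed

lemma is_norm_continuous:
  assumes "is_norm \<phi>"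
  shows "continuous_on S \<phi>"
proof -
  obtain K where K: "0 < K" "\<And>x. \<phi> x \<le> K * norm x" using is_norm_upper_bound[OF assms] by blast
  have "\<bar>\<phi> x - \<phi> y\<bar> \<le> K * dist x y" for x y
    using is_norm_triangle_diff[OF assms, of x y] is_norm_triangle_diff[OF assms, of y x]
      is_norm_diff_commute[OF assms, of x y] K(2)[of "x - y"] by (simp add: dist_norm)
  then have "K-lipschitz_on UNIV \<phi>"
    using K(1) by (intro lipschitz_onI) (auto simp: dist_real_def)
  then show ?thesis using lipschitz_on_continuous_on continuous_on_subset by blast
qed

lemma is_norm_lower_bound:
  assumes "is_norm \<phi>"
  obtains c where "0 < c" "\<And>x. c * norm x \<le> \<phi> x"
proof -
  have "compact (sphere (0 :: plane) 1)" "sphere (0 :: plane) 1 \<noteq> {}"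
    by auto
  from continuous_attains_inf[OF this is_norm_continuous[OF assms]]
  obtain u where u: "u \<in> sphere 0 1" "\<And>x. x \<in> sphere 0 1 \<Longrightarrow> \<phi> u \<le> \<phi> x"
    by (metis (no_types))
  show thesis
  proof
    have "u \<noteq> 0" using u(1) by auto
    then show "0 < \<phi> u" using assms unfolding is_norm_def by (metis order_le_less)
    fix x show "\<phi> u * norm x \<le> \<phi> x"
    proof (cases "x = 0")
      case False
      then have "\<phi> u \<le> \<phi> ((1 / norm x) *\<^sub>R x)" by (intro u(2)) simp
      also have "\<dots> = \<phi> x / norm x" using False by (simp add: is_norm_scale[OF assms])
      finally show ?thesis using False by (simp add: field_simps)
    qed (simp add: is_norm_zero[OF assms])
  qed
qed

lemma is_norm_bounded_ball:
  assumes "is_norm \<phi>"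
  shows "bounded {x. \<phi> x \<le> r}"
proof -
  obtain c where c: "0 < c" "\<And>x. c * norm x \<le> \<phi> x" using is_norm_lower_bound[OF assms] by blast
  have "norm x \<le> r / c" if "\<phi> x \<le> r" for x
    using c(2)[of x] that c(1) by (simp add: field_simps)
  then show ?thesis by (auto simp: bounded_iff)
qed

section \<open>The energy on finite sets of lattice points\<close>

text \<open>The distance to the boundary of \<open>J\<close> as a real number. It agrees with the extended one when \<open>J\<close> is
  finite and nonempty.\<close>

definition bdry_dist_real :: "real \<Rightarrow> (plane \<Rightarrow> real) \<Rightarrow> plane set \<Rightarrow> plane \<Rightarrow> real" where
  "bdry_dist_real \<epsilon> \<phi> J i = enn2real (bdry_dist \<epsilon> \<phi> i J)"

text \<open>The dissipation term of the energy, in terms of the sets of centres.\<close>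

definition cost :: "real \<Rightarrow> real \<Rightarrow> (plane \<Rightarrow> real) \<Rightarrow> plane set \<Rightarrow> plane set \<Rightarrow> real" where
  "cost \<epsilon> \<tau> \<phi> I J = \<epsilon>\<^sup>2 / \<tau> * (\<Sum>i\<in>sym_diff I J. bdry_dist_real \<epsilon> \<phi> J i)"

text \<open>The energy of finite sets of centres as a real number.\<close>

definition lattice_energy :: "real \<Rightarrow> real \<Rightarrow> (plane \<Rightarrow> real) \<Rightarrow> plane set \<Rightarrow> plane set \<Rightarrow> real" where
  "lattice_energy \<epsilon> \<tau> \<phi> I J = cost \<epsilon> \<tau> \<phi> I J - \<epsilon> * per \<epsilon> I"

lemma infinite_grid:
  assumes "0 < \<epsilon>" shows "infinite (grid \<epsilon>)"
proof
  assume "finite (grid \<epsilon>)"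
  then have "bounded (\<Union>z\<in>grid \<epsilon>. cell \<epsilon> z)"
    by (intro bounded_UN) (auto simp: cell_def)
  moreover have "(\<Union>z\<in>grid \<epsilon>. cell \<epsilon> z) = UNIV" using cover_grid[OF assms] by fast
  ultimately show False using not_bounded_UNIV by metis
qed

lemma bdry_dist_finite:
  assumes "0 < \<epsilon>" "finite J" "J \<noteq> {}"
  shows "bdry_dist \<epsilon> \<phi> i J < \<infinity>"
proof -
  have "grid \<epsilon> - J \<noteq> {}" using infinite_grid[OF assms(1)] assms(2) by (metis Diff_eq_empty_iff finite_subset)
  then obtain k where k: "k \<in> grid \<epsilon> - J" by blast
  obtain j where j: "j \<in> J" using assms(3) by blast
  have "bdry_dist \<epsilon> \<phi> i J \<le> max (ennreal (\<phi> (i - k))) (ennreal (\<phi> (i - j)))"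
    unfolding bdry_dist_def using INF_lower[OF k] INF_lower[OF j]
    by (auto simp: le_max_iff_disj)
  also have "\<dots> < \<infinity>" by (simp add: max_def)
  finally show ?thesis .
qed

lemma bdry_dist_eq:
  assumes "0 < \<epsilon>" "finite J" "J \<noteq> {}"
  shows "bdry_dist \<epsilon> \<phi> i J = ennreal (bdry_dist_real \<epsilon> \<phi> J i)"
  using bdry_dist_finite[OF assms] by (simp add: bdry_dist_real_def)

lemma bdry_dist_real_nonneg [simp]: "0 \<le> bdry_dist_real \<epsilon> \<phi> J i"
  by (simp add: bdry_dist_real_def)

lemma bdry_dist_real_le_outside:
  assumes "is_norm \<phi>" "i \<notin> J" "j \<in> J"
  shows "bdry_dist_real \<epsilon> \<phi> J i \<le> \<phi> (i - j)"
proof -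
  have "bdry_dist \<epsilon> \<phi> i J \<le> ennreal (\<phi> (i - j))"
    unfolding bdry_dist_def using assms by (auto intro: INF_lower)
  then show ?thesis
    unfolding bdry_dist_real_def using enn2real_mono[of _ "ennreal (\<phi> (i - j))"]
    by (simp add: is_norm_nonneg[OF assms(1)])
qed

lemma bdry_dist_real_le_inside:
  assumes "is_norm \<phi>" "i \<in> J" "j \<in> grid \<epsilon> - J"
  shows "bdry_dist_real \<epsilon> \<phi> J i \<le> \<phi> (i - j)"
proof -
  have "bdry_dist \<epsilon> \<phi> i J \<le> ennreal (\<phi> (i - j))"
    unfolding bdry_dist_def using assms by (auto intro: INF_lower)
  then show ?thesis
    unfolding bdry_dist_real_def using enn2real_mono[of _ "ennreal (\<phi> (i - j))"]
    by (simp add: is_norm_nonneg[OF assms(1)])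
qed

lemma bdry_dist_real_attained:
  assumes "is_norm \<phi>" "finite J" "J \<noteq> {}" "i \<notin> J"
  obtains j where "j \<in> J" "bdry_dist_real \<epsilon> \<phi> J i = \<phi> (i - j)"
proof -
  obtain j where j: "j \<in> J" "\<And>k. k \<in> J \<Longrightarrow> \<phi> (i - j) \<le> \<phi> (i - k)"
    using ex_min_if_finite[of "(\<lambda>j. \<phi> (i - j)) ` J"] assms(2,3)
    by (metis (no_types, lifting) arg_min_if_finite(1) arg_min_least)
  have "bdry_dist \<epsilon> \<phi> i J = ennreal (\<phi> (i - j))"
    unfolding bdry_dist_def using assms(4) j
    by (auto intro!: antisym INF_lower INF_greatest ennreal_leI)
  then have "bdry_dist_real \<epsilon> \<phi> J i = \<phi> (i - j)"
    by (simp add: bdry_dist_real_def is_norm_nonneg[OF assms(1)])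
  then show thesis using that j(1) by blast
qed

lemma bdry_dist_lower_bound:
  assumes "is_norm \<phi>" "0 < \<epsilon>" "i \<in> grid \<epsilon>" "J \<subseteq> grid \<epsilon>" "\<And>x. c * norm x \<le> \<phi> x" "0 < c"
  shows "ennreal (c * \<epsilon>) \<le> bdry_dist \<epsilon> \<phi> i J"
proof -
  have "c * \<epsilon> \<le> \<phi> (i - j)" if j: "j \<in> grid \<epsilon>" "i \<noteq> j" for j
  proof -
    obtain k where "\<not> \<bar>i $ k - j $ k\<bar> < \<epsilon>"
      using grid_eqI[OF assms(2,3) j(1)] j(2) by blast
    then have "\<epsilon> \<le> norm (i - j)" using component_le_norm_cart[of "i - j" k] by simp
    then have "c * \<epsilon> \<le> c * norm (i - j)" using assms(6) by simp
    then show ?thesis using assms(5) order_trans by blast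
  qed
  then show ?thesis
    unfolding bdry_dist_def using assms(4) by (auto intro!: INF_greatest ennreal_leI)
qed

lemma energy_cells:
  assumes "0 < \<epsilon>" "0 < \<tau>" "I \<subseteq> grid \<epsilon>" "finite I" "J \<subseteq> grid \<epsilon>" "finite J" "J \<noteq> {}"
  shows "energy \<epsilon> \<tau> \<phi> (cells \<epsilon> I) (cells \<epsilon> J) = ereal (lattice_energy \<epsilon> \<tau> \<phi> I J)"
proof -
  have "(\<Sum>\<^sub>\<infinity> i \<in> sym_diff I J. bdry_dist \<epsilon> \<phi> i J) = (\<Sum>i\<in>sym_diff I J. bdry_dist \<epsilon> \<phi> i J)"
    using assms by (intro infsum_finite) auto
  also have "\<dots> = ennreal (\<Sum>i\<in>sym_diff I J. bdry_dist_real \<epsilon> \<phi> J i)"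
    by (simp add: bdry_dist_eq[OF assms(1,6,7)])
  finally show ?thesis
    unfolding energy_def centres_cells[OF assms(1,3)] centres_cells[OF assms(1,5)]
      hausdorff1_frontier_eq_per[OF assms(1,3,4)] lattice_energy_def cost_def
    by (simp add: enn2ereal_ennreal sum_nonneg)
qed

text \<open>Boundary distances of lattice points are bounded below by a positive constant, so infinitely many of them sum to
  \<open>\<infinity>\<close>. As \<open>x + \<infinity> = \<infinity>\<close> holds in \<^typ>\<open>ereal\<close> also for \<open>x = - \<infinity>\<close>, the perimeter term
  plays no role here.\<close>

lemma energy_cells_infinite:
  assumes "is_norm \<phi>" "0 < \<epsilon>" "0 < \<tau>" "I \<subseteq> grid \<epsilon>" "infinite I" "J \<subseteq> grid \<epsilon>" "finite J"
  shows "energy \<epsilon> \<tau> \<phi> (cells \<epsilon> I) (cells \<epsilon> J) = \<infinity>"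
proof -
  obtain c where c: "0 < c" "\<And>x. c * norm x \<le> \<phi> x" using is_norm_lower_bound[OF assms(1)] by blast
  have inf: "infinite (sym_diff I J)" using assms(5,7) by (auto simp: Diff_infinite_finite)
  have "(\<Sum>\<^sub>\<infinity> i \<in> sym_diff I J. bdry_dist \<epsilon> \<phi> i J) = \<infinity>"
  proof (rule infsum_superconst_infinite_ennreal)
    show "ennreal (c * \<epsilon>) \<le> bdry_dist \<epsilon> \<phi> i J" if "i \<in> sym_diff I J" for i
      by (rule bdry_dist_lower_bound) (use assms c that in auto)
  qed (use assms c inf in auto)
  then show ?thesis
    unfolding energy_def centres_cells[OF assms(2,4)] centres_cells[OF assms(2,6)]
    using assms(2,3) by simp
qed

section \<open>Sets of finite perimeter\<close>

text \<open>The measure swept out by a shift along a coordinate axis is at most linear in the length of the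
  shift, for lengths up to 1. This
  is preserved by finite unions and, by a difference quotient argument, implies finite
  perimeter.\<close>

definition shift_regular :: "plane set \<Rightarrow> bool" where
  "shift_regular E \<longleftrightarrow> E \<in> sets borel \<and> E \<in> lmeasurable \<and>
     (\<exists>C. \<forall>i. \<forall>h\<in>{0<..1}. measure lebesgue ((+) (h *\<^sub>R axis i 1) ` E - E) \<le> C * h)"

lemma measure_Diff_Int:
  assumes "A \<in> lmeasurable" "B \<in> lmeasurable"
  shows "measure lebesgue (A - B) = measure lebesgue A - measure lebesgue (A \<inter> B)"
proof -
  have "A - B = A - A \<inter> B" by blast
  then show ?thesis
    using assms by (metis fmeasurableD fmeasurableD2 Int_lower1 fmeasurable.Int infinity_ennreal_def measure_Diff)
qed

lemma integral_indicator_translation: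
  fixes f :: "plane \<Rightarrow> real"
  assumes "E \<in> sets borel" "f \<in> borel_measurable borel"
  shows "(LINT x|lebesgue. indicator E x * f (x + v)) = (LINT x|lebesgue. indicator ((+) v ` E) x * f x)"
proof -
  have im: "(+) v ` E = (\<lambda>x. x - v) -` E" by (force simp: image_iff algebra_simps)
  have "(\<lambda>x. x - v) \<in> borel_measurable borel" by measurable
  from measurable_sets[OF this assms(1)] have E': "(+) v ` E \<in> sets borel" by (simp add: im)
  have 1: "(\<lambda>x. indicator E x * f (x + v)) \<in> borel_measurable lborel"
    using assms by measurable
  have 2: "(\<lambda>x. indicator ((+) v ` E) x * f x) \<in> borel_measurable lborel"
    using assms E' by measurable
  have "(LINT x|lebesgue. indicator ((+) v ` E) x * f x) = (LINT x|lborel. indicator ((+) v ` E) x * f x)"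
    by (rule integral_completion[OF 2])
  also have "\<dots> = (LINT x|distr lborel borel ((+) v). indicator ((+) v ` E) x * f x)"
    by (simp only: lborel_distr_plus)
  also have "\<dots> = (LINT x|lborel. indicator ((+) v ` E) (v + x) * f (v + x))"
    using 2 by (subst integral_distr) auto
  also have "\<dots> = (LINT x|lborel. indicator E x * f (x + v))"
    by (intro Bochner_Integration.integral_cong) (auto simp: indicator_def add.commute)
  also have "\<dots> = (LINT x|lebesgue. indicator E x * f (x + v))"
    by (rule integral_completion[OF 1, symmetric])
  finally show ?thesis by simp
qed

lemma integral_indicator_diff_le:
  fixes f :: "plane \<Rightarrow> real"
  assumes A: "A \<in> lmeasurable" and B: "B \<in> lmeasurable"
    and f: "f \<in> borel_measurable lebesgue" "\<And>x. \<bar>f x\<bar> \<le> 1"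
  shows "\<bar>(LINT x|lebesgue. indicator A x * f x) - (LINT x|lebesgue. indicator B x * f x)\<bar>
       \<le> measure lebesgue (A - B) + measure lebesgue (B - A)"
proof -
  have int: "integrable lebesgue (\<lambda>x. indicator S x * f x)" if "S \<in> lmeasurable" for S
  proof (rule Bochner_Integration.integrable_bound)
    show "integrable lebesgue (indicator S :: plane \<Rightarrow> real)"
      using that by (intro integrable_real_indicator) (auto simp: fmeasurable_def)
    show "(\<lambda>x. indicator S x * f x) \<in> borel_measurable lebesgue"
      using f(1) that by (intro borel_measurable_times borel_measurable_indicator) auto
  qed (use f(2) in \<open>auto simp: indicator_def\<close>)
  have meas: "A - B \<in> lmeasurable" "B - A \<in> lmeasurable" using A B by auto
  then have int': "integrable lebesgue (\<lambda>x. indicator (A - B) x + indicator (B - A) x :: real)"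
    by (intro Bochner_Integration.integrable_add integrable_real_indicator) (auto simp: fmeasurable_def)
  have "\<bar>(LINT x|lebesgue. indicator A x * f x) - (LINT x|lebesgue. indicator B x * f x)\<bar>
      = \<bar>LINT x|lebesgue. indicator A x * f x - indicator B x * f x\<bar>"
    using int A B by simp
  also have "\<dots> \<le> (LINT x|lebesgue. \<bar>indicator A x * f x - indicator B x * f x\<bar>)"
    by (rule integral_abs_bound)
  also have "\<dots> \<le> (LINT x|lebesgue. indicator (A - B) x + indicator (B - A) x)"
    using int A B int' f(2)
    by (intro integral_mono) (auto simp: indicator_def intro!: Bochner_Integration.integrable_abs Bochner_Integration.integrable_diff)
  also have "\<dots> = measure lebesgue (A - B) + measure lebesgue (B - A)"
    using meas by (subst Bochner_Integration.integral_add) (auto simp: fmeasurable_def intro!: integrable_real_indicator)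
  finally show ?thesis .
qed

lemma test_field_component:
  fixes i :: 2
  defines "e \<equiv> axis i 1 :: plane"
  assumes "T \<in> test_fields"
  obtains B where
    "\<And>x. ((\<lambda>s. T (x + s *\<^sub>R e) $ i) has_real_derivative jacobian T (at x) $ i $ i) (at 0)"
    "\<And>x. \<bar>jacobian T (at x) $ i $ i\<bar> \<le> B"
    "\<And>x h. 0 \<le> h \<Longrightarrow> \<bar>T (x + h *\<^sub>R e) $ i - T x $ i\<bar> \<le> B * h"
proof -
  let ?D = "\<lambda>x. jacobian T (at x) $ i $ i"
  have T: "\<And>x. T differentiable (at x)" "continuous_on UNIV (\<lambda>x. jacobian T (at x))"
    "compact (closure {x. T x \<noteq> 0})" using assms by (auto simp: test_fields_def)
  have der: "((\<lambda>s. T (x + s *\<^sub>R e) $ i) has_real_derivative ?D (x + t *\<^sub>R e)) (at t)" for x t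
  proof -
    have 1: "(T has_derivative (\<lambda>h. jacobian T (at (x + t *\<^sub>R e)) *v h)) (at (x + t *\<^sub>R e))"
      using T(1) jacobian_works by blast
    have 2: "((\<lambda>s. x + s *\<^sub>R e) has_derivative (\<lambda>s. s *\<^sub>R e)) (at t)"
      by (auto intro!: derivative_eq_intros)
    have "((\<lambda>s. T (x + s *\<^sub>R e)) has_derivative (\<lambda>s. jacobian T (at (x + t *\<^sub>R e)) *v (s *\<^sub>R e))) (at t)"
      using diff_chain_at[OF 2 1] by (simp add: o_def)
    then have "((\<lambda>s. T (x + s *\<^sub>R e) $ i) has_derivative (\<lambda>s. (jacobian T (at (x + t *\<^sub>R e)) *v (s *\<^sub>R e)) $ i)) (at t)"
      by (rule bounded_linear.has_derivative[OF bounded_linear_vec_nth])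
    moreover have "(jacobian T (at (x + t *\<^sub>R e)) *v (s *\<^sub>R e)) $ i = ?D (x + t *\<^sub>R e) * s" for s
      by (simp add: e_def matrix_vector_mult_scaleR matrix_vector_mul_component inner_axis)
    ultimately show ?thesis by (simp add: has_field_derivative_def)
  qed
  have cont: "continuous_on UNIV ?D"
    using T(2) by (intro bounded_linear.continuous_on[OF bounded_linear_vec_nth])
  have zero: "?D x = 0" if "x \<notin> closure {x. T x \<noteq> 0}" for x
  proof -
    let ?S = "(\<lambda>s. x + s *\<^sub>R e) -` (- closure {x. T x \<noteq> 0})"
    have "open ?S" by (intro open_vimage) (auto intro!: continuous_intros)
    then have "eventually (\<lambda>s. s \<in> ?S) (nhds 0)"
      using that by (intro eventually_nhds_in_open) auto
    then have ev: "eventually (\<lambda>s. T (x + s *\<^sub>R e) $ i = 0) (nhds 0)"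
    proof eventually_elim
      case (elim s)
      then have "x + s *\<^sub>R e \<notin> {x. T x \<noteq> 0}" using closure_subset[of "{x. T x \<noteq> 0}"] by auto
      then show ?case by simp
    qed
    have "((\<lambda>s. T (x + s *\<^sub>R e) $ i) has_real_derivative 0) (at 0)"
      by (subst DERIV_cong_ev[OF refl ev refl]) auto
    moreover have "((\<lambda>s. T (x + s *\<^sub>R e) $ i) has_real_derivative ?D x) (at 0)"
      using der[of x 0] by simp
    ultimately show ?thesis using DERIV_unique by blast
  qed
  have "compact (?D ` closure {x. T x \<noteq> 0})"
    by (rule compact_continuous_image[OF continuous_on_subset[OF cont subset_UNIV] T(3)])
  then have "bounded (?D ` closure {x. T x \<noteq> 0})" by (rule compact_imp_bounded)
  then obtain B0 where B0: "\<And>x. x \<in> closure {x. T x \<noteq> 0} \<Longrightarrow> \<bar>?D x\<bar> \<le> B0"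
    unfolding bounded_iff by auto
  have B: "\<bar>?D x\<bar> \<le> max B0 0" for x
    using B0[of x] zero[of x] by (cases "x \<in> closure {x. T x \<noteq> 0}") auto
  show thesis
  proof
    show "((\<lambda>s. T (x + s *\<^sub>R e) $ i) has_real_derivative ?D x) (at 0)" for x
      using der[of x 0] by simp
    show "\<bar>?D x\<bar> \<le> max B0 0" for x by (rule B)
    fix x and h :: real assume h: "0 \<le> h"
    have "norm (T (x + h *\<^sub>R e) $ i - T (x + 0 *\<^sub>R e) $ i) \<le> max B0 0 * norm (h - 0)"
    proof (rule field_differentiable_bound[of UNIV "\<lambda>s. T (x + s *\<^sub>R e) $ i"])
      fix z :: real show "((\<lambda>s. T (x + s *\<^sub>R e) $ i) has_field_derivative ?D (x + z *\<^sub>R e)) (at z within UNIV)"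
        using der by simp
    qed (use B in auto)
    then show "\<bar>T (x + h *\<^sub>R e) $ i - T x $ i\<bar> \<le> max B0 0 * h" using h by simp
  qed
qed

text \<open>The partial derivative is a bounded limit of difference quotients. Their integrals over \<open>E\<close> are
  differences of integrals of the field over a shift of \<open>E\<close> and over \<open>E\<close>.\<close>

lemma set_integral_partial_derivative_le:
  fixes i :: 2
  assumes T: "T \<in> test_fields" and E: "E \<in> sets borel" "E \<in> lmeasurable"
    and C: "\<And>h. h \<in> {0<..1} \<Longrightarrow> measure lebesgue ((+) (h *\<^sub>R axis i 1) ` E - E) \<le> C * h"
  shows "set_integrable lebesgue E (\<lambda>x. jacobian T (at x) $ i $ i)"
    and "(LINT x:E|lebesgue. jacobian T (at x) $ i $ i) \<le> 2 * C"
proof -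
  let ?e = "axis i 1 :: plane" and ?D = "\<lambda>x. jacobian T (at x) $ i $ i"
  obtain B where B: "\<And>x. ((\<lambda>s. T (x + s *\<^sub>R ?e) $ i) has_real_derivative ?D x) (at 0)"
    "\<And>x. \<bar>?D x\<bar> \<le> B" "\<And>x h. 0 \<le> h \<Longrightarrow> \<bar>T (x + h *\<^sub>R ?e) $ i - T x $ i\<bar> \<le> B * h"
    using test_field_component[OF T, of i] by blast
  define h :: "nat \<Rightarrow> real" where "h n = 1 / (real n + 1)" for n
  have h: "0 < h n" "h n \<in> {0<..1}" for n by (auto simp: h_def)
  define q where "q n x = indicator E x * ((T (x + h n *\<^sub>R ?e) $ i - T x $ i) / h n)" for n x
  have "continuous_on UNIV (\<lambda>x. T x $ i)"
  proof (rule bounded_linear.continuous_on[OF bounded_linear_vec_nth])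
    have "\<And>x. T differentiable (at x)" using T by (auto simp: test_fields_def)
    then show "continuous_on UNIV T"
      by (simp add: continuous_at_imp_continuous_on differentiable_imp_continuous_within)
  qed
  then have Tb: "(\<lambda>x. T x $ i) \<in> borel_measurable borel" by (rule borel_measurable_continuous_onI)
  have "continuous_on UNIV ?D"
    using T by (intro bounded_linear.continuous_on[OF bounded_linear_vec_nth]) (auto simp: test_fields_def)
  then have Db: "?D \<in> borel_measurable borel" by (rule borel_measurable_continuous_onI)
  have toleb: "f \<in> borel_measurable lebesgue" if "f \<in> borel_measurable borel" for f :: "plane \<Rightarrow> real"
    using that by (intro measurable_completion) simp
  have Tshift: "(\<lambda>x. T (x + v) $ i) \<in> borel_measurable borel" for v
    using measurable_compose[of "\<lambda>x. x + v" borel borel "\<lambda>x. T x $ i"] Tb by simp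
  have qm: "q n \<in> borel_measurable lebesgue" for n
    unfolding q_def using E(1) Tb Tshift
    by (intro toleb borel_measurable_times borel_measurable_divide borel_measurable_diff
        borel_measurable_indicator borel_measurable_const)
  have gm: "(\<lambda>x. indicator E x * ?D x) \<in> borel_measurable lebesgue"
    using E(1) Db by (intro toleb borel_measurable_times borel_measurable_indicator)
  have indi: "integrable lebesgue (\<lambda>x. B * indicator E x)"
    using E(2) by (intro integrable_mult_right integrable_real_indicator) (auto simp: fmeasurable_def)
  have hlim: "filterlim h (at 0) sequentially"
    unfolding h_def by real_asymp
  have lim: "(\<lambda>n. q n x) \<longlonglongrightarrow> indicator E x * ?D x" for x
  proof -
    have "((\<lambda>s. (T (x + s *\<^sub>R ?e) $ i - T x $ i) / s) \<longlongrightarrow> ?D x) (at 0)"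
      using B(1)[of x] by (simp add: has_field_derivative_iff)
    from tendsto_mult_left[OF filterlim_compose[OF this hlim]] show ?thesis unfolding q_def .
  qed
  have qB: "norm (q n x) \<le> B * indicator E x" for n x
  proof -
    have "\<bar>T (x + h n *\<^sub>R ?e) $ i - T x $ i\<bar> / h n \<le> B"
      using B(3)[of "h n" x] h(1)[of n] by (simp add: field_simps)
    then show ?thesis using h(1)[of n] by (auto simp: q_def indicator_def abs_mult abs_divide)
  qed
  have int: "integrable lebesgue (\<lambda>x. indicator E x * ?D x)"
    by (rule integrable_dominated_convergence[of _ lebesgue q "\<lambda>x. B * indicator E x"])
       (use gm qm indi lim qB in auto)
  have conv: "(\<lambda>n. LINT x|lebesgue. q n x) \<longlonglongrightarrow> (LINT x|lebesgue. indicator E x * ?D x)"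
    by (rule integral_dominated_convergence[where w = "\<lambda>x. B * indicator E x"])
       (use gm qm indi lim qB in auto)
  have Tle: "\<bar>T x $ i\<bar> \<le> 1" for x
    using component_le_norm_cart[of "T x" i] T by (auto simp: test_fields_def intro: order_trans)
  have intT: "integrable lebesgue (\<lambda>x. indicator E x * T (x + v) $ i)" for v
  proof (rule Bochner_Integration.integrable_bound)
    show "integrable lebesgue (indicator E :: plane \<Rightarrow> real)"
      using E(2) by (intro integrable_real_indicator) (auto simp: fmeasurable_def)
    show "(\<lambda>x. indicator E x * T (x + v) $ i) \<in> borel_measurable lebesgue"
      using E(1) Tshift by (intro toleb borel_measurable_times borel_measurable_indicator)
  qed (use Tle in \<open>auto simp: indicator_def\<close>)
  have "(LINT x|lebesgue. q n x) \<le> 2 * C" for n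
  proof -
    let ?E' = "(+) (h n *\<^sub>R ?e) ` E"
    have E': "?E' \<in> lmeasurable" using measurable_translation[OF E(2)] .
    have "(LINT x|lebesgue. q n x)
        = (LINT x|lebesgue. (indicator E x * T (x + h n *\<^sub>R ?e) $ i - indicator E x * T (x + 0) $ i) / h n)"
      by (simp add: q_def diff_divide_distrib right_diff_distrib)
    also have "\<dots> = ((LINT x|lebesgue. indicator E x * T (x + h n *\<^sub>R ?e) $ i)
        - (LINT x|lebesgue. indicator E x * T (x + 0) $ i)) / h n"
      using intT by (simp only: Bochner_Integration.integral_diff integral_divide_zero)
    also have "\<dots> = ((LINT x|lebesgue. indicator ?E' x * T x $ i)
        - (LINT x|lebesgue. indicator E x * T x $ i)) / h n"
      by (simp only: integral_indicator_translation[OF E(1) Tb] add_0_right)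
    also have "\<dots> \<le> (measure lebesgue (?E' - E) + measure lebesgue (E - ?E')) / h n"
    proof (rule divide_right_mono)
      show "(LINT x|lebesgue. indicator ?E' x * T x $ i) - (LINT x|lebesgue. indicator E x * T x $ i)
          \<le> measure lebesgue (?E' - E) + measure lebesgue (E - ?E')"
        using integral_indicator_diff_le[OF E' E(2) toleb[OF Tb] Tle] by linarith
    qed (use h(1)[of n] in simp)
    also have "measure lebesgue (E - ?E') = measure lebesgue (?E' - E)"
      using measure_Diff_Int[OF E' E(2)] measure_Diff_Int[OF E(2) E'] measure_translation[of "h n *\<^sub>R ?e" E]
      by (simp add: Int_commute)
    also have "(measure lebesgue (?E' - E) + measure lebesgue (?E' - E)) / h n \<le> (C * h n + C * h n) / h n"
      using C[OF h(2)] h(1)[of n] by (intro divide_right_mono add_mono) auto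
    also have "\<dots> = 2 * C" using h(1)[of n] by simp
    finally show ?thesis .
  qed
  then have "(LINT x|lebesgue. indicator E x * ?D x) \<le> 2 * C"
    using conv by (intro LIMSEQ_le_const2[OF conv]) auto
  then show "(LINT x:E|lebesgue. ?D x) \<le> 2 * C" by (simp add: set_lebesgue_integral_def)
  show "set_integrable lebesgue E ?D" using int by (simp add: set_integrable_def)
qed

lemma shift_regular_finite_perimeter:
  assumes "shift_regular E"
  shows "finite_perimeter E"
proof -
  obtain C where E: "E \<in> sets borel" "E \<in> lmeasurable"
    and C: "\<And>i h. h \<in> {0<..1} \<Longrightarrow> measure lebesgue ((+) (h *\<^sub>R axis i 1) ` E - E) \<le> C * h"
    using assms unfolding shift_regular_def by blast
  have "perimeter E \<le> ereal (4 * C)"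
    unfolding perimeter_def
  proof (rule SUP_least)
    fix T assume T: "T \<in> test_fields"
    note part = set_integral_partial_derivative_le[OF T E C]
    have "(LINT x:E|lebesgue. divergence T x)
        = (LINT x:E|lebesgue. jacobian T (at x) $ 1 $ 1 + jacobian T (at x) $ 2 $ 2)"
      by (simp add: divergence_def trace_def sum_2)
    also have "\<dots> = (LINT x:E|lebesgue. jacobian T (at x) $ 1 $ 1) + (LINT x:E|lebesgue. jacobian T (at x) $ 2 $ 2)"
      by (rule set_integral_add(2)[OF part(1) part(1)])
    also have "\<dots> \<le> 4 * C" using part(2)[of 1] part(2)[of 2] by simp
    finally show "ereal (LINT x:E|lebesgue. divergence T x) \<le> ereal (4 * C)" by simp
  qed
  also have "\<dots> < \<infinity>" by simp
  finally show ?thesis using E(2) by (auto simp: finite_perimeter_def)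
qed

lemma shift_regular_empty [simp]: "shift_regular {}"
  by (auto simp: shift_regular_def intro: exI[of _ 0])

lemma shift_regular_Un:
  assumes "shift_regular A" "shift_regular B"
  shows "shift_regular (A \<union> B)"
proof -
  obtain C where A: "A \<in> sets borel" "A \<in> lmeasurable"
    and C: "\<And>i h. h \<in> {0<..1} \<Longrightarrow> measure lebesgue ((+) (h *\<^sub>R axis i 1) ` A - A) \<le> C * h"
    using assms(1) unfolding shift_regular_def by blast
  obtain D where B: "B \<in> sets borel" "B \<in> lmeasurable"
    and D: "\<And>i h. h \<in> {0<..1} \<Longrightarrow> measure lebesgue ((+) (h *\<^sub>R axis i 1) ` B - B) \<le> D * h"
    using assms(2) unfolding shift_regular_def by blast
  have "measure lebesgue ((+) v ` (A \<union> B) - (A \<union> B))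
      \<le> measure lebesgue ((+) v ` A - A) + measure lebesgue ((+) v ` B - B)" for v
  proof -
    have m: "(+) v ` A \<in> lmeasurable" "(+) v ` B \<in> lmeasurable"
      using A B measurable_translation by blast+
    have "measure lebesgue ((+) v ` (A \<union> B) - (A \<union> B))
        \<le> measure lebesgue (((+) v ` A - A) \<union> ((+) v ` B - B))"
      using m A B by (intro measure_mono_fmeasurable) (auto simp: image_Un)
    also have "\<dots> \<le> measure lebesgue ((+) v ` A - A) + measure lebesgue ((+) v ` B - B)"
      using m A B by (intro measure_Un_le) auto
    finally show ?thesis .
  qed
  then have "measure lebesgue ((+) (h *\<^sub>R axis i 1) ` (A \<union> B) - (A \<union> B)) \<le> (C + D) * h"
    if "h \<in> {0<..1}" for i h
    using C[OF that, of i] D[OF that, of i] by (smt (verit) distrib_right)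
  then show ?thesis using A B unfolding shift_regular_def by blast
qed

lemma shift_regular_translation:
  assumes "shift_regular A"
  shows "shift_regular ((+) a ` A)"
proof -
  obtain C where A: "A \<in> sets borel" "A \<in> lmeasurable"
    and C: "\<And>i h. h \<in> {0<..1} \<Longrightarrow> measure lebesgue ((+) (h *\<^sub>R axis i 1) ` A - A) \<le> C * h"
    using assms(1) unfolding shift_regular_def by blast
  have im: "(+) a ` A = (\<lambda>x. x - a) -` A" by (force simp: image_iff algebra_simps)
  have "(\<lambda>x. x - a) \<in> borel_measurable borel" by measurable
  from measurable_sets[OF this A(1)] have "(+) a ` A \<in> sets borel" by (simp add: im)
  moreover have "(+) a ` A \<in> lmeasurable" by (rule measurable_translation[OF A(2)])
  moreover have "(+) v ` (+) a ` A - (+) a ` A = (+) a ` ((+) v ` A - A)" for v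
    by (auto simp: image_iff algebra_simps)
  ultimately show ?thesis using C unfolding shift_regular_def by (simp only: measure_translation) blast
qed

text \<open>A convex body containing a disc of radius \<open>\<rho>\<close> about the origin is contained, after a shift by
  \<open>h\<close>, in its dilation by the factor \<open>1 + h / \<rho>\<close>.\<close>

lemma shift_regular_convex:
  assumes "convex S" "bounded S" "S \<in> sets borel" "0 < \<rho>" "cball 0 \<rho> \<subseteq> S"
  shows "shift_regular S"
proof -
  have meas: "S \<in> lmeasurable" using measurable_convex assms(1,2) by blast
  let ?m = "measure lebesgue S"
  have "measure lebesgue ((+) (h *\<^sub>R axis i 1) ` S - S) \<le> (?m * (2 / \<rho> + 1 / \<rho>\<^sup>2)) * h"
    if h: "h \<in> {0<..1}" for i h
  proof -
    let ?v = "h *\<^sub>R axis i 1 :: plane"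
    define s where "s = 1 + h / \<rho>"
    have s: "1 \<le> s" using h assms(4) by (simp add: s_def)
    let ?dS = "(\<lambda>x. s *\<^sub>R x + 0) ` S"
    have in_dS: "y \<in> ?dS" if "(1 / s) *\<^sub>R y \<in> S" for y
      using that s by (intro image_eqI[of _ _ "(1 / s) *\<^sub>R y"]) auto
    have 0: "0 \<in> S" using assms(4,5) by auto
    have e: "\<rho> *\<^sub>R axis i 1 \<in> S" using assms(4,5) by auto
    have conv: "(1 - u) *\<^sub>R x + u *\<^sub>R y \<in> S" if "x \<in> S" "y \<in> S" "0 \<le> u" "u \<le> 1" for x y u
      using convexD_alt[OF assms(1) that] .
    have sub1: "S \<subseteq> ?dS"
    proof
      fix x assume "x \<in> S"
      from conv[OF 0 this, of "1 / s"] show "x \<in> ?dS" using s by (intro in_dS) simp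
    qed
    have sub2: "(+) ?v ` S \<subseteq> ?dS"
    proof
      fix y assume "y \<in> (+) ?v ` S"
      then obtain x where x: "x \<in> S" "y = ?v + x" by auto
      let ?u = "1 - 1 / s"
      have "(1 - ?u) *\<^sub>R x + ?u *\<^sub>R (\<rho> *\<^sub>R axis i 1) \<in> S"
        using s by (intro conv x(1) e) auto
      moreover have "?u * \<rho> = h / s"
        using s assms(4) by (simp add: s_def field_simps)
      ultimately show "y \<in> ?dS"
        by (intro in_dS) (simp add: x(2) scaleR_add_right add.commute)
    qed
    have mdS: "measure lebesgue ?dS = s\<^sup>2 * ?m"
      using measure_lebesgue_affine[of s 0 S] by simp
    have dS: "?dS \<in> lmeasurable"
    proof (intro measurable_convex)
      show "bounded ?dS" using assms(2) by (simp add: bounded_scaling)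
      show "convex ?dS" using assms(1) by (simp add: convex_scaling)
    qed
    have "measure lebesgue ((+) ?v ` S - S) \<le> measure lebesgue (?dS - S)"
      using sub2 dS meas measurable_translation[OF meas] by (intro measure_mono_fmeasurable) auto
    also have "\<dots> = s\<^sup>2 * ?m - ?m"
      using measure_Diff_Int[OF dS meas] sub1 mdS by (simp add: Int_absorb1)
    also have "\<dots> = ?m * (2 * h / \<rho> + h * h / \<rho>\<^sup>2)"
      using assms(4) by (simp add: s_def power2_eq_square field_simps)
    also have "\<dots> \<le> ?m * (2 * h / \<rho> + h / \<rho>\<^sup>2)"
      using h by (intro mult_left_mono add_left_mono divide_right_mono) (auto simp: mult_left_le)
    also have "\<dots> = (?m * (2 / \<rho> + 1 / \<rho>\<^sup>2)) * h" by (simp add: field_simps)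
    finally show ?thesis .
  qed
  then show ?thesis using meas assms(3) unfolding shift_regular_def by blast
qed

lemma finite_perimeter_cells:
  assumes "0 < \<epsilon>" "finite I"
  shows "finite_perimeter (cells \<epsilon> I)"
proof -
  have 0: "shift_regular (cell \<epsilon> 0)"
  proof (rule shift_regular_convex)
    show "cball 0 (\<epsilon> / 2) \<subseteq> cell \<epsilon> 0"
    proof
      fix x :: plane assume "x \<in> cball 0 (\<epsilon> / 2)"
      then have "\<bar>x $ i - 0 $ i\<bar> \<le> \<epsilon> / 2" for i using component_le_norm_cart[of x i] by simp
      then show "x \<in> cell \<epsilon> 0" by (simp add: mem_cell)
    qed
  qed (use assms in \<open>auto simp: cell_def\<close>)
  have "cell \<epsilon> z = (+) z ` cell \<epsilon> 0" for z
  proof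
    show "cell \<epsilon> z \<subseteq> (+) z ` cell \<epsilon> 0"
    proof
      fix x assume "x \<in> cell \<epsilon> z"
      then have "x - z \<in> cell \<epsilon> 0" "x = z + (x - z)" by (simp_all add: mem_cell)
      then show "x \<in> (+) z ` cell \<epsilon> 0" by blast
    qed
  qed (auto simp: mem_cell)
  then have cell: "shift_regular (cell \<epsilon> z)" for z using shift_regular_translation[OF 0] by metis
  from assms(2) have "shift_regular (cells \<epsilon> I)"
    by (induction I rule: finite_induct) (auto simp: cells_def intro: shift_regular_Un cell)
  then show ?thesis by (rule shift_regular_finite_perimeter)
qed

lemma is_norm_convex_ball:
  assumes "is_norm \<phi>"
  shows "convex {x. \<phi> x < r}"
proof (rule convexI)
  fix x y u v assume *: "x \<in> {x. \<phi> x < r}" "y \<in> {x. \<phi> x < r}" "0 \<le> u" "0 \<le> v" "u + v = (1::real)"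
  have "\<phi> (u *\<^sub>R x + v *\<^sub>R y) \<le> u * \<phi> x + v * \<phi> y"
    using is_norm_triangle[OF assms, of "u *\<^sub>R x" "v *\<^sub>R y"] * by (simp add: is_norm_scale[OF assms])
  also have "\<dots> < r" using * by (auto intro: convex_bound_lt)
  finally show "u *\<^sub>R x + v *\<^sub>R y \<in> {x. \<phi> x < r}" by simp
qed

lemma is_norm_open_ball:
  assumes "is_norm \<phi>"
  shows "open {x. \<phi> x < r}"
  by (rule open_Collect_less[OF is_norm_continuous[OF assms] continuous_on_const])

lemma finite_perimeter_norm_ball:
  assumes "is_norm \<phi>" "0 \<le> r"
  shows "finite_perimeter (norm_ball \<phi> r)"
proof (cases "r = 0")
  case True
  have "shift_regular {0}"
  proof -
    have "measure lebesgue ((+) v ` {0} - {0}) \<le> 0" for v :: plane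
      by (cases "v = 0") (auto simp: insert_Diff_if)
    moreover have "{0 :: plane} \<in> lmeasurable" by (rule lmeasurable_compact) simp
    ultimately show ?thesis by (auto simp: shift_regular_def intro!: exI[of _ 0])
  qed
  then show ?thesis using True shift_regular_finite_perimeter by (simp add: norm_ball_def)
next
  case False
  then have r: "0 < r" using assms by simp
  obtain K where K: "0 < K" "\<And>x. \<phi> x \<le> K * norm x" using is_norm_upper_bound[OF assms(1)] by blast
  have "shift_regular {x. \<phi> x < r}"
  proof (rule shift_regular_convex[OF is_norm_convex_ball[OF assms(1)]])
    show "bounded {x. \<phi> x < r}" using is_norm_bounded_ball[OF assms(1), of r] by (rule bounded_subset) auto
    show "{x. \<phi> x < r} \<in> sets borel" by (rule borel_open[OF is_norm_open_ball[OF assms(1)]])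
    show "0 < r / (2 * K)" using r K by simp
    show "cball 0 (r / (2 * K)) \<subseteq> {x. \<phi> x < r}"
    proof
      fix x :: plane assume "x \<in> cball 0 (r / (2 * K))"
      then have "K * norm x \<le> r / 2" using K(1) by (simp add: field_simps)
      then show "x \<in> {x. \<phi> x < r}" using K(2)[of x] r by simp
    qed
  qed
  then show ?thesis using False shift_regular_finite_perimeter by (simp add: norm_ball_def)
qed

section \<open>Minimizers\<close>

text \<open>\<open>I\<close> is the set of centres of a minimizer for the previous set with centres \<open>J\<close>.\<close>

definition lattice_minimizer ::
  "real \<Rightarrow> real \<Rightarrow> (plane \<Rightarrow> real) \<Rightarrow> plane set \<Rightarrow> plane set \<Rightarrow> bool" where
  "lattice_minimizer \<epsilon> \<tau> \<phi> J I \<longleftrightarrow> I \<subseteq> grid \<epsilon> \<and> finite I \<and>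
     (\<forall>I'. I' \<subseteq> grid \<epsilon> \<longrightarrow> finite I' \<longrightarrow> lattice_energy \<epsilon> \<tau> \<phi> I J \<le> lattice_energy \<epsilon> \<tau> \<phi> I' J)"

lemma grid_sets_eq: "grid_sets \<epsilon> = {cells \<epsilon> I | I. I \<subseteq> grid \<epsilon>}"
  by (simp add: grid_sets_def cells_def)

text \<open>Every minimizer has finitely many centres, since the energy of the previous set is finite.\<close>

lemma energy_minimizer_cells_iff:
  assumes "is_norm \<phi>" "0 < \<epsilon>" "0 < \<tau>" "J \<subseteq> grid \<epsilon>" "finite J" "J \<noteq> {}"
  shows "energy_minimizer \<epsilon> \<tau> \<phi> (cells \<epsilon> J) E \<longleftrightarrow> (\<exists>I. E = cells \<epsilon> I \<and> lattice_minimizer \<epsilon> \<tau> \<phi> J I)"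
proof
  assume min: "energy_minimizer \<epsilon> \<tau> \<phi> (cells \<epsilon> J) E"
  then obtain I where I: "I \<subseteq> grid \<epsilon>" "E = cells \<epsilon> I" by (auto simp: energy_minimizer_def grid_sets_eq)
  have le: "energy \<epsilon> \<tau> \<phi> (cells \<epsilon> I) (cells \<epsilon> J) \<le> ereal (lattice_energy \<epsilon> \<tau> \<phi> I' J)"
    if "I' \<subseteq> grid \<epsilon>" "finite I'" for I'
  proof -
    have "cells \<epsilon> I' \<in> grid_sets \<epsilon>" using that(1) by (auto simp: grid_sets_eq)
    then have "energy \<epsilon> \<tau> \<phi> E (cells \<epsilon> J) \<le> energy \<epsilon> \<tau> \<phi> (cells \<epsilon> I') (cells \<epsilon> J)"
      using min finite_perimeter_cells[OF assms(2) that(2)] unfolding energy_minimizer_def by blast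
    then show ?thesis using energy_cells[OF assms(2,3) that assms(4-6), of \<phi>] I(2) by simp
  qed
  have fin: "finite I"
  proof (rule ccontr)
    assume "infinite I"
    then have "energy \<epsilon> \<tau> \<phi> (cells \<epsilon> I) (cells \<epsilon> J) = \<infinity>"
      using energy_cells_infinite[OF assms(1-3) I(1) _ assms(4,5)] by blast
    then show False using le[OF assms(4,5)] by simp
  qed
  then have "lattice_minimizer \<epsilon> \<tau> \<phi> J I"
    using le energy_cells[OF assms(2,3) I(1) fin assms(4-6)] I(1) by (auto simp: lattice_minimizer_def)
  then show "\<exists>I. E = cells \<epsilon> I \<and> lattice_minimizer \<epsilon> \<tau> \<phi> J I" using I(2) by blast
next
  assume "\<exists>I. E = cells \<epsilon> I \<and> lattice_minimizer \<epsilon> \<tau> \<phi> J I"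
  then obtain I where E: "E = cells \<epsilon> I" and I: "I \<subseteq> grid \<epsilon>" "finite I"
    and min: "\<And>I'. I' \<subseteq> grid \<epsilon> \<Longrightarrow> finite I' \<Longrightarrow> lattice_energy \<epsilon> \<tau> \<phi> I J \<le> lattice_energy \<epsilon> \<tau> \<phi> I' J"
    by (auto simp: lattice_minimizer_def)
  have "energy \<epsilon> \<tau> \<phi> E (cells \<epsilon> J) \<le> energy \<epsilon> \<tau> \<phi> (cells \<epsilon> I') (cells \<epsilon> J)" if I': "I' \<subseteq> grid \<epsilon>" for I'
  proof (cases "finite I'")
    case True
    then show ?thesis
      using min[OF I' True] E energy_cells[OF assms(2,3) I assms(4-6)] energy_cells[OF assms(2,3) I' True assms(4-6)]
      by simp
  next
    case False
    then show ?thesis using energy_cells_infinite[OF assms(1-3) I' _ assms(4,5)] by simp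
  qed
  then show "energy_minimizer \<epsilon> \<tau> \<phi> (cells \<epsilon> J) E"
    using E I finite_perimeter_cells[OF assms(2) I(2)] by (auto simp: energy_minimizer_def grid_sets_eq)
qed

lemma cost_insert_new:
  assumes "finite I" "finite J" "z \<notin> I" "z \<notin> J"
  shows "cost \<epsilon> \<tau> \<phi> (insert z I) J = cost \<epsilon> \<tau> \<phi> I J + \<epsilon>\<^sup>2 / \<tau> * bdry_dist_real \<epsilon> \<phi> J z"
proof -
  have "sym_diff (insert z I) J = insert z (sym_diff I J)" "z \<notin> sym_diff I J" "finite (sym_diff I J)"
    using assms by auto
  then show ?thesis by (simp add: cost_def distrib_left)
qed

lemma cost_insert_old:
  assumes "finite I" "finite J" "z \<notin> I" "z \<in> J"
  shows "cost \<epsilon> \<tau> \<phi> I J = cost \<epsilon> \<tau> \<phi> (insert z I) J + \<epsilon>\<^sup>2 / \<tau> * bdry_dist_real \<epsilon> \<phi> J z"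
proof -
  have "sym_diff I J = insert z (sym_diff (insert z I) J)" "z \<notin> sym_diff (insert z I) J"
    "finite (sym_diff (insert z I) J)"
    using assms by auto
  then show ?thesis by (simp add: cost_def distrib_left)
qed

lemma cost_nonneg: "0 < \<tau> \<Longrightarrow> 0 \<le> cost \<epsilon> \<tau> \<phi> I J"
  unfolding cost_def by (intro mult_nonneg_nonneg sum_nonneg) auto

text \<open>A new cell adds at most \<open>4 * \<epsilon>\<close> to the perimeter, so it does not pay if its distance to \<open>J\<close>
  exceeds \<open>4 * \<tau>\<close>.\<close>

lemma lattice_energy_insert_far:
  assumes "0 < \<epsilon>" "0 < \<tau>" "I \<subseteq> grid \<epsilon>" "finite I" "finite J" "z \<in> grid \<epsilon>" "z \<notin> I" "z \<notin> J"
  shows "lattice_energy \<epsilon> \<tau> \<phi> I J + \<epsilon>\<^sup>2 / \<tau> * (bdry_dist_real \<epsilon> \<phi> J z - 4 * \<tau>)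
      \<le> lattice_energy \<epsilon> \<tau> \<phi> (insert z I) J"
proof -
  have "\<epsilon> * per \<epsilon> (insert z I) \<le> \<epsilon> * (per \<epsilon> I + 4 * \<epsilon>)"
    using per_insert_le[OF assms(1,3,4,6)] assms(1) by simp
  moreover have "\<epsilon>\<^sup>2 / \<tau> * (bdry_dist_real \<epsilon> \<phi> J z - 4 * \<tau>) = \<epsilon>\<^sup>2 / \<tau> * bdry_dist_real \<epsilon> \<phi> J z - 4 * \<epsilon>\<^sup>2"
    using assms(2) by (simp add: right_diff_distrib)
  ultimately show ?thesis
    using cost_insert_new[OF assms(4,5,7,8)]
    by (simp add: lattice_energy_def power2_eq_square distrib_left algebra_simps)
qed

lemma minimizer_grid: "lattice_minimizer \<epsilon> \<tau> \<phi> J I \<Longrightarrow> I \<subseteq> grid \<epsilon>"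
  and minimizer_finite: "lattice_minimizer \<epsilon> \<tau> \<phi> J I \<Longrightarrow> finite I"
  and minimizer_le: "lattice_minimizer \<epsilon> \<tau> \<phi> J I \<Longrightarrow> I' \<subseteq> grid \<epsilon> \<Longrightarrow> finite I' \<Longrightarrow>
    lattice_energy \<epsilon> \<tau> \<phi> I J \<le> lattice_energy \<epsilon> \<tau> \<phi> I' J"
  by (auto simp: lattice_minimizer_def)

context
  fixes \<phi> :: "plane \<Rightarrow> real" and \<epsilon> \<tau> :: real and J I :: "plane set"
  assumes norm: "is_norm \<phi>" and eps: "0 < \<epsilon>" and tau: "0 < \<tau>"
    and J: "J \<subseteq> grid \<epsilon>" "finite J" "J \<noteq> {}"
    and min: "lattice_minimizer \<epsilon> \<tau> \<phi> J I"
begin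

lemma minimizer_near:
  assumes "z \<in> I"
  shows "\<exists>j\<in>J. \<phi> (z - j) \<le> 4 * \<tau>"
proof (cases "z \<in> J")
  case True
  then show ?thesis using tau by (intro bexI[of _ z]) (auto simp: is_norm_zero[OF norm])
next
  case False
  obtain j where j: "j \<in> J" "bdry_dist_real \<epsilon> \<phi> J z = \<phi> (z - j)"
    using bdry_dist_real_attained[OF norm J(2,3) False] by blast
  have "I - {z} \<subseteq> grid \<epsilon>" "finite (I - {z})" using minimizer_grid[OF min] minimizer_finite[OF min] by auto
  moreover have "z \<in> grid \<epsilon>" using minimizer_grid[OF min] assms by blast
  ultimately have "lattice_energy \<epsilon> \<tau> \<phi> (I - {z}) J + \<epsilon>\<^sup>2 / \<tau> * (\<phi> (z - j) - 4 * \<tau>)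
      \<le> lattice_energy \<epsilon> \<tau> \<phi> (insert z (I - {z})) J"
    using lattice_energy_insert_far[OF eps tau, of "I - {z}" J z \<phi>] J(2) False j(2) by simp
  also have "insert z (I - {z}) = I" using assms by blast
  also have "lattice_energy \<epsilon> \<tau> \<phi> I J \<le> lattice_energy \<epsilon> \<tau> \<phi> (I - {z}) J"
    using minimizer_grid[OF min] minimizer_finite[OF min] by (intro minimizer_le[OF min]) auto
  finally have "\<epsilon>\<^sup>2 / \<tau> * (\<phi> (z - j) - 4 * \<tau>) \<le> 0" by simp
  moreover have "0 < \<epsilon>\<^sup>2 / \<tau>" using eps tau by simp
  ultimately have "\<phi> (z - j) - 4 * \<tau> \<le> 0" using mult_pos_pos[of "\<epsilon>\<^sup>2 / \<tau>"] by (meson not_le)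
  then show ?thesis using j(1) by auto
qed

text \<open>An isolated cell adds exactly \<open>4 * \<epsilon>\<close> to the perimeter. It therefore pays within distance
  \<open>4 * \<tau>\<close> of \<open>J\<close>, and no room for it can be left there.\<close>

lemma minimizer_fills:
  assumes "z \<in> grid \<epsilon>" "j \<in> J" "\<phi> (z - j) < 4 * \<tau>"
  shows "z \<in> I \<or> (\<exists>w\<in>I. nbr \<epsilon> z w)"
proof (rule ccontr)
  assume "\<not> ?thesis"
  then have z: "z \<notin> I" "\<And>w. nbr \<epsilon> z w \<Longrightarrow> w \<notin> I" by auto
  have per: "per \<epsilon> I + 4 * \<epsilon> \<le> per \<epsilon> (insert z I)"
    by (rule per_insert_isolated[OF eps minimizer_grid[OF min] minimizer_finite[OF min] assms(1) z])
  then have per': "\<epsilon> * (per \<epsilon> I + 4 * \<epsilon>) \<le> \<epsilon> * per \<epsilon> (insert z I)" using eps by simp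
  have "cost \<epsilon> \<tau> \<phi> (insert z I) J < cost \<epsilon> \<tau> \<phi> I J + 4 * \<epsilon>\<^sup>2"
  proof (cases "z \<in> J")
    case True
    have "0 \<le> \<epsilon>\<^sup>2 / \<tau> * bdry_dist_real \<epsilon> \<phi> J z" using tau by simp
    moreover have "0 < \<epsilon>\<^sup>2" using eps by simp
    ultimately show ?thesis using cost_insert_old[OF minimizer_finite[OF min] J(2) z(1) True, of \<epsilon> \<tau> \<phi>] by linarith
  next
    case False
    have "bdry_dist_real \<epsilon> \<phi> J z < 4 * \<tau>"
      using bdry_dist_real_le_outside[OF norm False assms(2), of \<epsilon>] assms(3) by simp
    then have "\<epsilon>\<^sup>2 / \<tau> * bdry_dist_real \<epsilon> \<phi> J z < \<epsilon>\<^sup>2 / \<tau> * (4 * \<tau>)"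
      using eps tau by (intro mult_strict_left_mono) auto
    also have "\<dots> = 4 * \<epsilon>\<^sup>2" using tau by simp
    finally show ?thesis using cost_insert_new[OF minimizer_finite[OF min] J(2) z(1) False] by simp
  qed
  then have "lattice_energy \<epsilon> \<tau> \<phi> (insert z I) J < lattice_energy \<epsilon> \<tau> \<phi> I J"
    using per' by (simp add: lattice_energy_def power2_eq_square distrib_left)
  moreover have "lattice_energy \<epsilon> \<tau> \<phi> I J \<le> lattice_energy \<epsilon> \<tau> \<phi> (insert z I) J"
    using minimizer_grid[OF min] minimizer_finite[OF min] assms(1) by (intro minimizer_le[OF min]) auto
  ultimately show False by simp
qed

lemma minimizer_nonempty: "I \<noteq> {}"
proof -
  obtain j where j: "j \<in> J" using J(3) by blast
  then have "j \<in> I \<or> (\<exists>w\<in>I. nbr \<epsilon> j w)"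
    using J(1) tau by (intro minimizer_fills[of j j]) (auto simp: is_norm_zero[OF norm])
  then show ?thesis by blast
qed

text \<open>Removing a cell all of whose neighbours are present adds \<open>4 * \<epsilon>\<close> to the perimeter, at a small
  cost if \<open>J\<close> has gaps near every point. By induction all sets of the scheme have gaps.\<close>

lemma minimizer_has_gaps:
  assumes gaps: "\<And>z. z \<in> J \<Longrightarrow> \<exists>w. nbr \<epsilon> z w \<and> w \<notin> J"
    and K: "\<And>x. \<phi> x \<le> K * norm x" "K * \<epsilon> < 4 * \<tau>" and z: "z \<in> I"
  shows "\<exists>w. nbr \<epsilon> z w \<and> w \<notin> I"
proof (rule ccontr)
  assume "\<not> ?thesis"
  then have all: "\<And>w. nbr \<epsilon> z w \<Longrightarrow> w \<in> I" by blast
  let ?I = "I - {z}"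
  have I: "?I \<subseteq> grid \<epsilon>" "finite ?I" "z \<notin> ?I" "insert z ?I = I"
    using minimizer_grid[OF min] minimizer_finite[OF min] z by auto
  have "per \<epsilon> I + 4 * \<epsilon> \<le> per \<epsilon> ?I"
    by (rule per_remove_surrounded[OF eps minimizer_grid[OF min] minimizer_finite[OF min] z all])
  then have per': "\<epsilon> * (per \<epsilon> I + 4 * \<epsilon>) \<le> \<epsilon> * per \<epsilon> ?I" using eps by simp
  have "cost \<epsilon> \<tau> \<phi> ?I J < cost \<epsilon> \<tau> \<phi> I J + 4 * \<epsilon>\<^sup>2"
  proof (cases "z \<in> J")
    case True
    obtain w where w: "nbr \<epsilon> z w" "w \<notin> J" using gaps True by blast
    have "w \<in> grid \<epsilon> - J" using nbr_grid[OF w(1)] True J(1) w(2) by blast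
    then have "bdry_dist_real \<epsilon> \<phi> J z \<le> \<phi> (z - w)" by (rule bdry_dist_real_le_inside[OF norm True])
    also have "\<dots> \<le> K * \<epsilon>" using K(1)[of "z - w"] norm_nbr[OF eps w(1)] by simp
    finally have "bdry_dist_real \<epsilon> \<phi> J z < 4 * \<tau>" using K(2) by simp
    then have "\<epsilon>\<^sup>2 / \<tau> * bdry_dist_real \<epsilon> \<phi> J z < \<epsilon>\<^sup>2 / \<tau> * (4 * \<tau>)"
      using eps tau by (intro mult_strict_left_mono) auto
    also have "\<dots> = 4 * \<epsilon>\<^sup>2" using tau by simp
    finally show ?thesis using cost_insert_old[OF I(2) J(2) I(3) True, of \<epsilon> \<tau> \<phi>] I(4) by simp
  next
    case False
    have "0 \<le> \<epsilon>\<^sup>2 / \<tau> * bdry_dist_real \<epsilon> \<phi> J z" using tau by simp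
    moreover have "0 < \<epsilon>\<^sup>2" using eps by simp
    ultimately show ?thesis
      using cost_insert_new[OF I(2) J(2) I(3) False, of \<epsilon> \<tau> \<phi>] unfolding I(4) by linarith
  qed
  then have "lattice_energy \<epsilon> \<tau> \<phi> ?I J < lattice_energy \<epsilon> \<tau> \<phi> I J"
    using per' by (simp add: lattice_energy_def power2_eq_square distrib_left)
  moreover have "lattice_energy \<epsilon> \<tau> \<phi> I J \<le> lattice_energy \<epsilon> \<tau> \<phi> ?I J"
    using I by (intro minimizer_le[OF min]) auto
  ultimately show False by simp
qed

end

text \<open>It suffices to minimize over the finitely many sets of lattice points at distance at most
  \<open>4 * \<tau>\<close> from \<open>J\<close>.\<close>

lemma lattice_minimizer_exists:
  assumes norm: "is_norm \<phi>" and eps: "0 < \<epsilon>" and tau: "0 < \<tau>"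
    and J: "J \<subseteq> grid \<epsilon>" "finite J" "J \<noteq> {}"
  shows "\<exists>I. lattice_minimizer \<epsilon> \<tau> \<phi> J I"
proof -
  define G where "G = grid \<epsilon> \<inter> (\<Union>j\<in>J. {z. \<phi> (z - j) \<le> 4 * \<tau>})"
  have "bounded {z. \<phi> (z - j) \<le> 4 * \<tau>}" for j
  proof -
    have "{z. \<phi> (z - j) \<le> 4 * \<tau>} = (+) j ` {x. \<phi> x \<le> 4 * \<tau>}"
      by (auto simp: image_iff intro!: exI[of _ "_ - j"])
    then show ?thesis using bounded_translation[OF is_norm_bounded_ball[OF norm]] by metis
  qed
  then have finG: "finite G" unfolding G_def using J(2) by (intro finite_grid_bounded[OF eps] bounded_UN) auto
  have JG: "J \<subseteq> G" using J(1) tau by (auto simp: G_def intro!: bexI[of _ "_ :: plane"] simp: is_norm_zero[OF norm])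
  have restrict: "lattice_energy \<epsilon> \<tau> \<phi> A J \<le> lattice_energy \<epsilon> \<tau> \<phi> (A \<union> D) J"
    if "finite D" "D \<inter> G = {}" "D \<subseteq> grid \<epsilon>" "A \<subseteq> grid \<epsilon>" "finite A" for A D
    using that
  proof (induction D rule: finite_induct)
    case (insert z D)
    have IH: "lattice_energy \<epsilon> \<tau> \<phi> A J \<le> lattice_energy \<epsilon> \<tau> \<phi> (A \<union> D) J" using insert by auto
    show ?case
    proof (cases "z \<in> A")
      case True
      then have "A \<union> insert z D = A \<union> D" by blast
      then show ?thesis using IH by simp
    next
      case False
      have zJ: "z \<notin> J" using insert.prems JG by blast
      obtain j where j: "j \<in> J" "bdry_dist_real \<epsilon> \<phi> J z = \<phi> (z - j)"
        using bdry_dist_real_attained[OF norm J(2,3) zJ] by blast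
      have "4 * \<tau> < \<phi> (z - j)" using insert.prems j(1) by (force simp: G_def)
      then have "0 \<le> \<epsilon>\<^sup>2 / \<tau> * (bdry_dist_real \<epsilon> \<phi> J z - 4 * \<tau>)" using j(2) tau by simp
      moreover have "lattice_energy \<epsilon> \<tau> \<phi> (A \<union> D) J + \<epsilon>\<^sup>2 / \<tau> * (bdry_dist_real \<epsilon> \<phi> J z - 4 * \<tau>)
          \<le> lattice_energy \<epsilon> \<tau> \<phi> (insert z (A \<union> D)) J"
        using insert False zJ J(2) by (intro lattice_energy_insert_far[OF eps tau]) auto
      ultimately show ?thesis using IH by simp
    qed
  qed simp
  have "finite (Pow G)" "Pow G \<noteq> {}" using finG by auto
  then obtain I where I: "I \<in> Pow G" "\<And>I'. I' \<in> Pow G \<Longrightarrow> lattice_energy \<epsilon> \<tau> \<phi> I J \<le> lattice_energy \<epsilon> \<tau> \<phi> I' J"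
    using arg_min_if_finite(1)[of "Pow G" "\<lambda>I. lattice_energy \<epsilon> \<tau> \<phi> I J"]
      arg_min_least[of "Pow G" _ "\<lambda>I. lattice_energy \<epsilon> \<tau> \<phi> I J"] by blast
  have "lattice_energy \<epsilon> \<tau> \<phi> I J \<le> lattice_energy \<epsilon> \<tau> \<phi> I' J" if I': "I' \<subseteq> grid \<epsilon>" "finite I'" for I'
  proof -
    have "lattice_energy \<epsilon> \<tau> \<phi> I J \<le> lattice_energy \<epsilon> \<tau> \<phi> (I' \<inter> G) J" by (intro I(2)) auto
    also have "\<dots> \<le> lattice_energy \<epsilon> \<tau> \<phi> ((I' \<inter> G) \<union> (I' - G)) J"
      using I' by (intro restrict) auto
    also have "(I' \<inter> G) \<union> (I' - G) = I'" by blast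
    finally show ?thesis .
  qed
  moreover have "I \<subseteq> grid \<epsilon>" "finite I" using I(1) finite_subset[OF _ finG, of I] by (auto simp: G_def)
  ultimately show ?thesis by (auto simp: lattice_minimizer_def)
qed

section \<open>The scheme\<close>

text \<open>A discrete scheme in terms of the sets of centres.\<close>

definition lattice_scheme :: "real \<Rightarrow> real \<Rightarrow> (plane \<Rightarrow> real) \<Rightarrow> (nat \<Rightarrow> plane set) \<Rightarrow> bool" where
  "lattice_scheme \<epsilon> \<tau> \<phi> I \<longleftrightarrow> I 0 = {0} \<and> (\<forall>k. lattice_minimizer \<epsilon> \<tau> \<phi> (I k) (I (Suc k)))"

lemma lattice_scheme_basic:
  assumes "is_norm \<phi>" "0 < \<epsilon>" "0 < \<tau>" "lattice_scheme \<epsilon> \<tau> \<phi> I"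
  shows "I k \<subseteq> grid \<epsilon> \<and> finite (I k) \<and> I k \<noteq> {}"
proof (induction k)
  case 0
  then show ?case using assms(4) by (auto simp: lattice_scheme_def)
next
  case (Suc k)
  have "lattice_minimizer \<epsilon> \<tau> \<phi> (I k) (I (Suc k))" using assms(4) by (auto simp: lattice_scheme_def)
  then show ?case
    using minimizer_grid minimizer_finite minimizer_nonempty assms(1-3) Suc by metis
qed

lemma discrete_scheme_lattice:
  assumes "is_norm \<phi>" "0 < \<epsilon>" "0 < \<tau>" "discrete_scheme \<epsilon> \<tau> \<phi> S"
  obtains I where "lattice_scheme \<epsilon> \<tau> \<phi> I" "\<And>k. S k = cells \<epsilon> (I k)"
proof -
  define P where "P k J \<longleftrightarrow> S k = cells \<epsilon> J \<and> J \<subseteq> grid \<epsilon> \<and> finite J \<and> J \<noteq> {}" for k J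
  define I where "I k = centres \<epsilon> (S k)" for k
  have P: "P k (I k)" for k
  proof (induction k)
    case 0
    have "S 0 = cells \<epsilon> {0}" using assms(4) by (simp add: discrete_scheme_def cells_def)
    then show ?case using centres_cells[OF assms(2), of "{0}"] by (simp add: P_def I_def)
  next
    case (Suc k)
    have "energy_minimizer \<epsilon> \<tau> \<phi> (cells \<epsilon> (I k)) (S (Suc k))"
      using assms(4) Suc unfolding discrete_scheme_def P_def by metis
    then obtain A where A: "S (Suc k) = cells \<epsilon> A" "lattice_minimizer \<epsilon> \<tau> \<phi> (I k) A"
      using energy_minimizer_cells_iff[OF assms(1-3)] Suc unfolding P_def by blast
    then have "A \<subseteq> grid \<epsilon>" "finite A" "A \<noteq> {}"
      using minimizer_nonempty[OF assms(1-3)] Suc by (auto simp: lattice_minimizer_def P_def)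
    then show ?case using A(1) centres_cells[OF assms(2)] by (simp add: P_def I_def)
  qed
  have "lattice_minimizer \<epsilon> \<tau> \<phi> (I k) (I (Suc k))" for k
  proof -
    have "energy_minimizer \<epsilon> \<tau> \<phi> (cells \<epsilon> (I k)) (S (Suc k))"
      using assms(4) P[of k] unfolding discrete_scheme_def P_def by metis
    then obtain A where A: "S (Suc k) = cells \<epsilon> A" "lattice_minimizer \<epsilon> \<tau> \<phi> (I k) A"
      using energy_minimizer_cells_iff[OF assms(1-3)] P[of k] unfolding P_def by blast
    then have "A = I (Suc k)" using centres_cells[OF assms(2)] by (simp add: I_def lattice_minimizer_def)
    then show ?thesis using A(2) by simp
  qed
  moreover have "I 0 = {0}"
  proof -
    have "S 0 = cells \<epsilon> {0}" using assms(4) by (simp add: discrete_scheme_def cells_def)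
    then show ?thesis using centres_cells[OF assms(2), of "{0}"] by (simp add: I_def)
  qed
  ultimately have "lattice_scheme \<epsilon> \<tau> \<phi> I" by (simp add: lattice_scheme_def)
  then show thesis using P that by (simp add: P_def)
qed

lemma discrete_solution_exists:
  assumes "is_norm \<phi>" "0 < \<epsilon>" "0 < \<tau>"
  shows "\<exists>D. discrete_solution \<epsilon> \<tau> \<phi> D"
proof -
  let ?P = "\<lambda>J. J \<subseteq> grid \<epsilon> \<and> finite J \<and> J \<noteq> {}"
  have "\<exists>I. \<forall>k. (?P (I k) \<and> (k = 0 \<longrightarrow> I k = {0})) \<and> lattice_minimizer \<epsilon> \<tau> \<phi> (I k) (I (Suc k))"
  proof (rule dependent_nat_choice)
    show "\<exists>J. ?P J \<and> (0 = (0::nat) \<longrightarrow> J = {0})" by auto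
    fix J and n :: nat assume J: "?P J \<and> (n = 0 \<longrightarrow> J = {0})"
    obtain I where I: "lattice_minimizer \<epsilon> \<tau> \<phi> J I" using lattice_minimizer_exists[OF assms] J by blast
    then have "?P I" using J minimizer_nonempty[OF assms] by (auto simp: lattice_minimizer_def)
    then show "\<exists>I. (?P I \<and> (Suc n = 0 \<longrightarrow> I = {0})) \<and> lattice_minimizer \<epsilon> \<tau> \<phi> J I" using I by auto
  qed
  then obtain I where I: "\<And>k. ?P (I k)" "I 0 = {0}" "\<And>k. lattice_minimizer \<epsilon> \<tau> \<phi> (I k) (I (Suc k))" by metis
  have "discrete_scheme \<epsilon> \<tau> \<phi> (\<lambda>k. cells \<epsilon> (I k))"
    unfolding discrete_scheme_def
  proof (intro conjI allI)
    show "cells \<epsilon> (I 0) = cell \<epsilon> 0" using I(2) by (simp add: cells_def)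
    show "energy_minimizer \<epsilon> \<tau> \<phi> (cells \<epsilon> (I k)) (cells \<epsilon> (I (Suc k)))" for k
    proof -
      have "I k \<subseteq> grid \<epsilon>" "finite (I k)" "I k \<noteq> {}" using I(1)[of k] by auto
      from energy_minimizer_cells_iff[OF assms this] show ?thesis using I(3)[of k] by blast
    qed
  qed
  then show ?thesis unfolding discrete_solution_def by (intro exI[of _ "\<lambda>t. cells \<epsilon> (I (nat \<lfloor>t / \<tau>\<rfloor>))"]) blast
qed

lemma norm_nbr_le:
  assumes "0 < \<epsilon>" "\<And>x. \<phi> x \<le> K * norm x" "nbr \<epsilon> z w"
  shows "\<phi> (z - w) \<le> K * \<epsilon>"
  using assms(2)[of "z - w"] norm_nbr[OF assms(1,3)] by simp

lemma norm_in_cell_le: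
  assumes "0 < \<epsilon>" "0 < K" "\<And>x. \<phi> x \<le> K * norm x" "x \<in> cell \<epsilon> z"
  shows "\<phi> (x - z) \<le> K * \<epsilon>"
  using assms(3)[of "x - z"] norm_diff_cell_le[OF assms(1,4)] assms(2) by (meson mult_le_cancel_left_pos order_trans)

context
  fixes \<phi> :: "plane \<Rightarrow> real" and \<epsilon> \<tau> :: real and I :: "nat \<Rightarrow> plane set"
  assumes norm: "is_norm \<phi>" and eps: "0 < \<epsilon>" and tau: "0 < \<tau>"
    and scheme: "lattice_scheme \<epsilon> \<tau> \<phi> I"
begin

lemma scheme_minimizer: "lattice_minimizer \<epsilon> \<tau> \<phi> (I k) (I (Suc k))"
  using scheme by (simp add: lattice_scheme_def)

lemma scheme_grid: "I k \<subseteq> grid \<epsilon>" and scheme_finite: "finite (I k)" and scheme_nonempty: "I k \<noteq> {}"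
  using lattice_scheme_basic[OF norm eps tau scheme] by auto

lemma scheme_upper: "z \<in> I k \<Longrightarrow> \<phi> z \<le> 4 * \<tau> * k"
proof (induction k arbitrary: z)
  case 0
  then show ?case using scheme by (simp add: lattice_scheme_def is_norm_zero[OF norm])
next
  case (Suc k)
  obtain j where j: "j \<in> I k" "\<phi> (z - j) \<le> 4 * \<tau>"
    using minimizer_near[OF norm eps tau scheme_grid scheme_finite scheme_nonempty scheme_minimizer Suc.prems] by blast
  have "\<phi> z \<le> \<phi> j + \<phi> (z - j)" by (rule is_norm_triangle_diff[OF norm])
  also have "\<dots> \<le> 4 * \<tau> * k + 4 * \<tau>" using Suc.IH[OF j(1)] j(2) by simp
  finally show ?case by (simp add: algebra_simps)
qed

text \<open>One step moves the front by \<open>4 * \<tau>\<close> in the norm, up to an error of the order of the lattice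
  spacing; the constant \<open>4 * K\<close> absorbs this error in the radius.\<close>

lemma scheme_lower:
  fixes K :: real
  assumes K: "0 < K" "\<And>x. \<phi> x \<le> K * norm x"
  shows "\<phi> y \<le> k * (4 * \<tau> - 4 * K * \<epsilon>) \<Longrightarrow> \<exists>j\<in>I k. \<phi> (y - j) \<le> 2 * K * \<epsilon>"
proof (induction k arbitrary: y)
  case 0
  then have "y = 0" using norm by (simp add: is_norm_def) (metis order_antisym)
  then show ?case using scheme K eps by (simp add: lattice_scheme_def is_norm_zero[OF norm])
next
  case (Suc k)
  let ?\<rho> = "4 * \<tau> - 4 * K * \<epsilon>"
  \<comment> \<open>The target is approached along the ray: the point reached at the previous step lies on it.\<close>
  define y' where "y' = (k / (k + 1)) *\<^sub>R y"
  have "\<phi> y / (k + 1) \<le> ?\<rho>" using Suc.prems by (simp add: field_simps)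
  moreover have "\<phi> y' = k * (\<phi> y / (k + 1))" by (simp add: y'_def is_norm_scale[OF norm])
  moreover have "y - y' = (1 / (k + 1)) *\<^sub>R y"
  proof -
    have "y - y' = (1 - k / (k + 1)) *\<^sub>R y" by (simp add: y'_def scaleR_left_diff_distrib)
    also have "1 - k / (k + 1) = 1 / (real k + 1)" by (simp add: field_simps)
    finally show ?thesis by (simp add: add.commute)
  qed
  then have "\<phi> (y - y') = \<phi> y / (k + 1)" by (simp add: is_norm_scale[OF norm])
  ultimately have 1: "\<phi> y' \<le> k * ?\<rho>" and 2: "\<phi> (y - y') \<le> ?\<rho>"
    using mult_left_mono[of "\<phi> y / (k + 1)" ?\<rho> "real k"] by simp_all
  obtain j where j: "j \<in> I k" "\<phi> (y' - j) \<le> 2 * K * \<epsilon>" using Suc.IH[OF 1] by blast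
  obtain z where z: "z \<in> grid \<epsilon>" "y \<in> cell \<epsilon> z" using cover_grid[OF eps] by blast
  have yz: "\<phi> (y - z) \<le> K * \<epsilon>" by (rule norm_in_cell_le[OF eps K z(2)])
  have "\<phi> (z - j) \<le> \<phi> (z - y) + (\<phi> (y - y') + \<phi> (y' - j))"
    using is_norm_triangle[OF norm, of "z - y" "y - j"] is_norm_triangle[OF norm, of "y - y'" "y' - j"] by simp
  also have "\<dots> \<le> K * \<epsilon> + (?\<rho> + 2 * K * \<epsilon>)"
    using yz 2 j(2) is_norm_diff_commute[OF norm, of z y] by simp
  also have "\<dots> < 4 * \<tau>" using K(1) eps by simp
  finally have "z \<in> I (Suc k) \<or> (\<exists>w\<in>I (Suc k). nbr \<epsilon> z w)"
    using minimizer_fills[OF norm eps tau scheme_grid scheme_finite scheme_nonempty scheme_minimizer z(1) j(1)] by blast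
  then obtain w where w: "w \<in> I (Suc k)" "\<phi> (z - w) \<le> K * \<epsilon>"
    using norm_nbr_le[OF eps K(2)] K(1) eps is_norm_zero[OF norm] by force
  have "\<phi> (y - w) \<le> \<phi> (y - z) + \<phi> (z - w)" using is_norm_triangle[OF norm, of "y - z" "z - w"] by simp
  then show ?case using w yz by (intro bexI[OF _ w(1)]) simp
qed

lemma scheme_has_gaps:
  assumes K: "\<And>x. \<phi> x \<le> K * norm x" and small: "K * \<epsilon> < 4 * \<tau>" and z: "z \<in> I k"
  shows "\<exists>w. nbr \<epsilon> z w \<and> w \<notin> I k"
  using z
proof (induction k arbitrary: z)
  case 0
  have I0: "I 0 = {0}" using scheme by (simp add: lattice_scheme_def)
  have nb: "nbr \<epsilon> 0 (axis 1 \<epsilon>)" by (auto simp: nbr_def)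
  have "axis 1 \<epsilon> \<noteq> (0 :: plane)" using eps by (simp add: axis_eq_0_iff)
  then show ?case using 0 nb I0 by (intro exI[of _ "axis 1 \<epsilon>"]) auto
next
  case (Suc k)
  show ?case
    by (rule minimizer_has_gaps[OF norm eps tau scheme_grid scheme_finite scheme_nonempty scheme_minimizer
          Suc.IH K small Suc.prems])
qed

end

section \<open>Hausdorff convergence\<close>

lemma hausdorff_distance_commute: "hausdorff_distance A B = hausdorff_distance B A"
  by (simp add: hausdorff_distance_def max.commute dist_commute)

lemma hausdorff_distance_triangle:
  "hausdorff_distance A C \<le> hausdorff_distance A B + hausdorff_distance B C"
proof -
  have half: "(SUP x\<in>A. INF z\<in>C. ennreal (dist x z))
      \<le> (SUP x\<in>A. INF y\<in>B. ennreal (dist x y)) + (SUP y\<in>B. INF z\<in>C. ennreal (dist y z))" for A B C :: "plane set"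
  proof (rule SUP_least)
    fix x assume x: "x \<in> A"
    let ?s = "SUP y\<in>B. INF z\<in>C. ennreal (dist y z)"
    have "(INF z\<in>C. ennreal (dist x z)) \<le> ennreal (dist x y) + ?s" if y: "y \<in> B" for y
    proof -
      have "(INF z\<in>C. ennreal (dist x z)) \<le> (INF w\<in>{y}. ennreal (dist x w)) + (INF z\<in>C. ennreal (dist y z))"
      proof (rule le_INF_add_INF)
        fix w z assume "w \<in> {y}" "z \<in> C"
        then have "(INF z\<in>C. ennreal (dist x z)) \<le> ennreal (dist x z)" by (intro INF_lower)
        also have "\<dots> \<le> ennreal (dist x w + dist y z)"
          using \<open>w \<in> {y}\<close> dist_triangle[of x z y] by (intro ennreal_leI) simp
        finally show "(INF z\<in>C. ennreal (dist x z)) \<le> ennreal (dist x w) + ennreal (dist y z)" by simp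
      qed
      also have "\<dots> \<le> ennreal (dist x y) + ?s" using y by (intro add_mono) (auto intro: SUP_upper)
      finally show ?thesis .
    qed
    then have "(INF z\<in>C. ennreal (dist x z)) \<le> (INF y\<in>B. ennreal (dist x y)) + (INF u\<in>{()}. ?s)"
      by (intro le_INF_add_INF) auto
    also have "\<dots> \<le> (SUP x\<in>A. INF y\<in>B. ennreal (dist x y)) + ?s"
      using x by (intro add_mono) (auto intro: SUP_upper)
    finally show "(INF z\<in>C. ennreal (dist x z)) \<le> (SUP x\<in>A. INF y\<in>B. ennreal (dist x y)) + ?s" .
  qed
  have "(SUP z\<in>C. INF x\<in>A. ennreal (dist x z))
      \<le> (SUP y\<in>B. INF x\<in>A. ennreal (dist x y)) + (SUP z\<in>C. INF y\<in>B. ennreal (dist y z))"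
    using half[where A = C and B = B and C = A] by (simp add: dist_commute add.commute)
  then show ?thesis
    unfolding hausdorff_distance_def using half[where A = A and B = B and C = C]
    by (intro max.boundedI) (meson add_mono max.cobounded1 max.cobounded2 order_trans)+
qed

lemma hausdorff_distance_leI:
  assumes "\<And>x. x \<in> A \<Longrightarrow> \<exists>y\<in>B. dist x y \<le> r" "\<And>y. y \<in> B \<Longrightarrow> \<exists>x\<in>A. dist x y \<le> r"
  shows "hausdorff_distance A B \<le> ennreal r"
  unfolding hausdorff_distance_def
proof (intro max.boundedI SUP_least)
  fix x assume "x \<in> A"
  then obtain y where "y \<in> B" "dist x y \<le> r" using assms(1) by blast
  then show "(INF y\<in>B. ennreal (dist x y)) \<le> ennreal r" by (intro INF_lower2[of y]) (auto intro: ennreal_leI)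
next
  fix y assume "y \<in> B"
  then obtain x where "x \<in> A" "dist x y \<le> r" using assms(2) by blast
  then show "(INF x\<in>A. ennreal (dist x y)) \<le> ennreal r" by (intro INF_lower2[of x]) (auto intro: ennreal_leI)
qed

lemma centre_in_cells: "z \<in> I \<Longrightarrow> 0 < \<epsilon> \<Longrightarrow> z \<in> cells \<epsilon> I"
  by (auto simp: cells_def mem_cell intro!: bexI[of _ z])

text \<open>The parameter \<open>s\<close> is a contraction factor that takes the limit ball into the region which the
  scheme is known to have reached after \<open>k\<close> steps.\<close>

lemma hausdorff_distance_scheme_le:
  assumes norm: "is_norm \<phi>" and eps: "0 < \<epsilon>" "\<epsilon> < 1" and tau: "0 < \<tau>"
    and scheme: "lattice_scheme \<epsilon> \<tau> \<phi> I"
    and K: "0 < K" "\<And>x. \<phi> x \<le> K * norm x" and c: "0 < c" "\<And>x. c * norm x \<le> \<phi> x"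
    and t: "0 < t" "\<tau> * k \<le> t" and s: "0 < s" "s \<le> 1" "s * (4 * t) \<le> k * (4 * \<tau> - 4 * K * \<epsilon>)"
  shows "hausdorff_distance (cells \<epsilon> (I k)) (norm_ball \<phi> (4 * t))
       \<le> ennreal (\<epsilon> + \<epsilon> * (4 * t / c) + (1 - s) * (4 * t / c) + 2 * K * \<epsilon> / c)"
proof (rule hausdorff_distance_leI)
  have ball: "norm_ball \<phi> (4 * t) = {x. \<phi> x < 4 * t}" using t by (simp add: norm_ball_def)
  have cb: "norm x \<le> \<phi> x / c" for x using c(2)[of x] c(1) by (simp add: field_simps)
  have pos: "0 \<le> \<epsilon> * (4 * t / c)" "0 \<le> (1 - s) * (4 * t / c)" "0 \<le> 2 * K * \<epsilon> / c"
    using eps t c(1) s K(1) by auto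
  {
    fix x assume "x \<in> cells \<epsilon> (I k)"
    then obtain z where z: "z \<in> I k" "x \<in> cell \<epsilon> z" by (auto simp: cells_def)
    have "\<phi> z \<le> 4 * \<tau> * k" by (rule scheme_upper[OF norm eps(1) tau scheme z(1)])
    then have \<phi>z: "\<phi> z \<le> 4 * t" using t(2) by linarith
    \<comment> \<open>The ball is open, so the point is moved inwards a little.\<close>
    let ?y = "(1 - \<epsilon>) *\<^sub>R z"
    have "\<phi> ?y = (1 - \<epsilon>) * \<phi> z" using eps by (simp add: is_norm_scale[OF norm])
    also have "\<dots> \<le> (1 - \<epsilon>) * (4 * t)" using \<phi>z eps by (intro mult_left_mono) auto
    also have "\<dots> < 4 * t" using eps t(1) by simp
    finally have "?y \<in> norm_ball \<phi> (4 * t)" by (simp add: ball)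
    moreover have "dist x ?y \<le> \<epsilon> + \<epsilon> * (4 * t / c)"
    proof -
      have "dist x ?y = norm ((x - z) + \<epsilon> *\<^sub>R z)" by (simp add: dist_norm algebra_simps)
      also have "\<dots> \<le> norm (x - z) + \<epsilon> * norm z" using norm_triangle_ineq[of "x - z" "\<epsilon> *\<^sub>R z"] eps by simp
      also have "norm z \<le> 4 * t / c" using cb[of z] \<phi>z c(1) by (meson divide_right_mono less_imp_le order_trans)
      finally show ?thesis using norm_diff_cell_le[OF eps(1) z(2)] eps by (simp add: add_mono mult_left_mono)
    qed
    ultimately show "\<exists>y\<in>norm_ball \<phi> (4 * t). dist x y \<le> \<epsilon> + \<epsilon> * (4 * t / c) + (1 - s) * (4 * t / c) + 2 * K * \<epsilon> / c"
      using pos by (intro bexI[of _ ?y]) auto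
  }
  fix y assume "y \<in> norm_ball \<phi> (4 * t)"
  then have y: "\<phi> y < 4 * t" by (simp add: ball)
  have "\<phi> (s *\<^sub>R y) = s * \<phi> y" using s by (simp add: is_norm_scale[OF norm])
  also have "\<dots> \<le> s * (4 * t)" using y s by (intro mult_left_mono) auto
  finally have "\<phi> (s *\<^sub>R y) \<le> k * (4 * \<tau> - 4 * K * \<epsilon>)" using s(3) by linarith
  from scheme_lower[OF norm eps(1) tau scheme K this]
  obtain j where j: "j \<in> I k" "\<phi> (s *\<^sub>R y - j) \<le> 2 * K * \<epsilon>" by blast
  have "dist j y \<le> (1 - s) * (4 * t / c) + 2 * K * \<epsilon> / c"
  proof -
    have "dist j y = norm ((1 - s) *\<^sub>R y + (s *\<^sub>R y - j))" by (simp add: dist_norm norm_minus_commute algebra_simps)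
    also have "\<dots> \<le> (1 - s) * norm y + norm (s *\<^sub>R y - j)"
      using norm_triangle_ineq[of "(1 - s) *\<^sub>R y" "s *\<^sub>R y - j"] s by simp
    also have "\<dots> \<le> (1 - s) * (4 * t / c) + 2 * K * \<epsilon> / c"
    proof (intro add_mono mult_left_mono)
      show "norm y \<le> 4 * t / c" using cb[of y] y c(1) by (meson divide_right_mono less_imp_le order_trans)
      show "norm (s *\<^sub>R y - j) \<le> 2 * K * \<epsilon> / c"
        using cb[of "s *\<^sub>R y - j"] j(2) c(1) by (meson divide_right_mono less_imp_le order_trans)
    qed (use s in auto)
    finally show ?thesis .
  qed
  then show "\<exists>x\<in>cells \<epsilon> (I k). dist x y \<le> \<epsilon> + \<epsilon> * (4 * t / c) + (1 - s) * (4 * t / c) + 2 * K * \<epsilon> / c"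
    using centre_in_cells[OF j(1) eps(1)] pos eps by (intro bexI[of _ j]) auto
qed

text \<open>The number of time steps of length \<open>\<tau>\<close> completed at time \<open>t\<close>.\<close>

definition step_index :: "real \<Rightarrow> real \<Rightarrow> nat" where
  "step_index \<tau> t = nat \<lfloor>t / \<tau>\<rfloor>"

lemma step_index_bounds:
  assumes "0 < \<tau>" "0 \<le> t"
  shows "\<tau> * step_index \<tau> t \<le> t" "t - \<tau> \<le> \<tau> * step_index \<tau> t"
proof -
  have "real (step_index \<tau> t) = of_int \<lfloor>t / \<tau>\<rfloor>" using assms by (simp add: step_index_def)
  then have "real (step_index \<tau> t) \<le> t / \<tau>" "t / \<tau> - 1 \<le> real (step_index \<tau> t)" by linarith+
  then show "\<tau> * step_index \<tau> t \<le> t" "t - \<tau> \<le> \<tau> * step_index \<tau> t"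
    using assms(1) by (simp_all add: field_simps)
qed

lemma step_index_lim:
  assumes "regime \<epsilon> \<tau>" "0 \<le> t"
  shows "(\<lambda>n. \<tau> n * step_index (\<tau> n) t) \<longlonglongrightarrow> t"
proof (rule tendsto_sandwich[of "\<lambda>n. t - \<tau> n" _ _ "\<lambda>_. t"])
  have "\<tau> \<longlonglongrightarrow> 0" using assms(1) by (simp add: regime_def)
  from tendsto_diff[OF tendsto_const[of t] this] show "(\<lambda>n. t - \<tau> n) \<longlonglongrightarrow> t" by simp
qed (use assms step_index_bounds in \<open>auto simp: regime_def\<close>)

lemma inner_radius_lim:
  fixes \<epsilon> \<tau> :: "nat \<Rightarrow> real" and t K :: real
  assumes "regime \<epsilon> \<tau>" "0 \<le> t"
  shows "(\<lambda>n. step_index (\<tau> n) t * (4 * \<tau> n - 4 * K * \<epsilon> n)) \<longlonglongrightarrow> 4 * t"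
proof -
  have "(\<lambda>n. \<epsilon> n / \<tau> n) \<longlonglongrightarrow> 0" "\<And>n. 0 < \<tau> n" using assms(1) by (auto simp: regime_def)
  then have "(\<lambda>n. (\<tau> n * step_index (\<tau> n) t) * (4 - 4 * K * (\<epsilon> n / \<tau> n))) \<longlonglongrightarrow> t * (4 - 4 * K * 0)"
    by (intro tendsto_intros step_index_lim[OF assms])
  moreover have "(\<lambda>n. (\<tau> n * step_index (\<tau> n) t) * (4 - 4 * K * (\<epsilon> n / \<tau> n)))
      = (\<lambda>n. step_index (\<tau> n) t * (4 * \<tau> n - 4 * K * \<epsilon> n))"
  proof
    fix n
    have "\<tau> n * (4 - 4 * K * (\<epsilon> n / \<tau> n)) = 4 * \<tau> n - 4 * K * \<epsilon> n"
      using \<open>0 < \<tau> n\<close> by (simp add: right_diff_distrib)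
    then show "(\<tau> n * step_index (\<tau> n) t) * (4 - 4 * K * (\<epsilon> n / \<tau> n)) = step_index (\<tau> n) t * (4 * \<tau> n - 4 * K * \<epsilon> n)"
      by (metis mult.assoc mult.left_commute)
  qed
  ultimately show ?thesis by (simp add: mult.commute)
qed

lemma discrete_solution_lattice:
  assumes "is_norm \<phi>" "0 < \<epsilon>" "0 < \<tau>" "discrete_solution \<epsilon> \<tau> \<phi> D"
  obtains I where "lattice_scheme \<epsilon> \<tau> \<phi> I" "\<And>t. 0 \<le> t \<Longrightarrow> D t = cells \<epsilon> (I (step_index \<tau> t))"
  using assms(4) discrete_scheme_lattice[OF assms(1-3)] unfolding discrete_solution_def step_index_def by metis

lemma discrete_solutions_hausdorff_lim:
  assumes norm: "is_norm \<phi>" and reg: "regime \<epsilon> \<tau>"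
    and D: "\<And>n. discrete_solution (\<epsilon> n) (\<tau> n) \<phi> (D n)" and t: "0 \<le> t"
  shows "(\<lambda>n. hausdorff_distance (D n t) (norm_ball \<phi> (4 * t))) \<longlonglongrightarrow> 0"
proof -
  have pos: "\<And>n. 0 < \<epsilon> n" "\<And>n. 0 < \<tau> n" and eps0: "\<epsilon> \<longlonglongrightarrow> 0" using reg by (auto simp: regime_def)
  have "\<exists>I. lattice_scheme (\<epsilon> n) (\<tau> n) \<phi> I \<and> (\<forall>t\<ge>0. D n t = cells (\<epsilon> n) (I (step_index (\<tau> n) t)))" for n
    using discrete_solution_lattice[OF norm pos D] by metis
  then obtain I where I: "\<And>n. lattice_scheme (\<epsilon> n) (\<tau> n) \<phi> (I n)"
    "\<And>n t. 0 \<le> t \<Longrightarrow> D n t = cells (\<epsilon> n) (I n (step_index (\<tau> n) t))" by metis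
  obtain K where K: "0 < K" "\<And>x. \<phi> x \<le> K * norm x" using is_norm_upper_bound[OF norm] by blast
  obtain c where c: "0 < c" "\<And>x. c * norm x \<le> \<phi> x" using is_norm_lower_bound[OF norm] by blast
  have "\<exists>g. g \<longlonglongrightarrow> 0 \<and> (\<forall>\<^sub>F n in sequentially. hausdorff_distance (D n t) (norm_ball \<phi> (4 * t)) \<le> ennreal (g n))"
  proof (cases "t = 0")
    \<comment> \<open>Here the limit is the singleton of the origin.\<close>
    case True
    have "hausdorff_distance (D n t) (norm_ball \<phi> (4 * t)) \<le> ennreal (\<epsilon> n)" for n
    proof -
      have "I n 0 = {0}" using I(1) by (simp add: lattice_scheme_def)
      then have Dn: "D n t = cell (\<epsilon> n) 0" using I(2)[OF t] True by (simp add: step_index_def cells_def)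
      have "0 \<in> cell (\<epsilon> n) 0" using pos(1)[of n] by (simp add: mem_cell)
      then show ?thesis
        unfolding Dn using True norm_diff_cell_le[OF pos(1), of _ n 0] pos(1)[of n]
        by (intro hausdorff_distance_leI) (auto simp: norm_ball_def dist_norm)
    qed
    then show ?thesis using eps0 by (intro exI[of _ \<epsilon>]) auto
  next
    case False
    with t have t: "0 < t" by simp
    define r where "r n = step_index (\<tau> n) t * (4 * \<tau> n - 4 * K * \<epsilon> n)" for n
    define s where "s n = min 1 (r n / (4 * t))" for n
    have r: "r \<longlonglongrightarrow> 4 * t" unfolding r_def using inner_radius_lim[OF reg] t by simp
    then have "s \<longlonglongrightarrow> min 1 (4 * t / (4 * t))" unfolding s_def using t by (intro tendsto_intros) auto
    then have s: "s \<longlonglongrightarrow> 1" using t by simp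
    define g where "g n = \<epsilon> n + \<epsilon> n * (4 * t / c) + (1 - s n) * (4 * t / c) + 2 * K * \<epsilon> n / c" for n
    have "g \<longlonglongrightarrow> 0 + 0 * (4 * t / c) + (1 - 1) * (4 * t / c) + 2 * K * 0 / c"
      unfolding g_def using c(1) by (intro tendsto_intros eps0 s) auto
    then have "g \<longlonglongrightarrow> 0" by simp
    moreover have "\<forall>\<^sub>F n in sequentially. 0 < s n" "\<forall>\<^sub>F n in sequentially. \<epsilon> n < 1"
      using order_tendstoD[OF s] order_tendstoD[OF eps0] by auto
    then have "\<forall>\<^sub>F n in sequentially. hausdorff_distance (D n t) (norm_ball \<phi> (4 * t)) \<le> ennreal (g n)"
    proof eventually_elim
      case (elim n)
      have "s n * (4 * t) \<le> r n" using t by (simp add: s_def min_def field_simps)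
      moreover have "\<tau> n * step_index (\<tau> n) t \<le> t" using step_index_bounds(1) pos(2) t by simp
      moreover have "s n \<le> 1" by (simp add: s_def)
      ultimately show ?case
        unfolding g_def using t elim I(2)[of t n]
          hausdorff_distance_scheme_le[OF norm pos(1) elim(2) pos(2) I(1) K c t, of "step_index (\<tau> n) t" "s n"]
        by (simp add: r_def)
    qed
    ultimately show ?thesis by blast
  qed
  then obtain g where g: "g \<longlonglongrightarrow> 0"
    "\<forall>\<^sub>F n in sequentially. hausdorff_distance (D n t) (norm_ball \<phi> (4 * t)) \<le> ennreal (g n)" by blast
  have lim: "(\<lambda>n. ennreal (g n)) \<longlonglongrightarrow> 0" using tendsto_ennrealI[OF g(1)] by simp
  show ?thesis by (rule tendsto_sandwich[OF _ g(2) tendsto_const lim]) auto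
qed

lemma minimizing_movement_norm_ball:
  assumes "is_norm \<phi>" "regime \<epsilon> \<tau>"
  shows "minimizing_movement \<phi> \<epsilon> \<tau> (\<lambda>t. norm_ball \<phi> (4 * t))"
proof -
  have "\<exists>D. discrete_solution (\<epsilon> n) (\<tau> n) \<phi> D" for n
    using assms discrete_solution_exists by (auto simp: regime_def)
  then obtain D where D: "\<And>n. discrete_solution (\<epsilon> n) (\<tau> n) \<phi> (D n)" by metis
  then show ?thesis
    unfolding minimizing_movement_def
    using finite_perimeter_norm_ball[OF assms(1)] discrete_solutions_hausdorff_lim[OF assms D]
    by (intro conjI allI impI exI[of _ D] exI[of _ "\<lambda>n. n"]) (auto simp: strict_mono_def)
qed

lemma minimizing_movement_unique:
  assumes "is_norm \<phi>" "regime \<epsilon> \<tau>" "minimizing_movement \<phi> \<epsilon> \<tau> E" "0 \<le> t"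
  shows "hausdorff_distance (E t) (norm_ball \<phi> (4 * t)) = 0"
proof -
  obtain D r where D: "\<And>n. discrete_solution (\<epsilon> n) (\<tau> n) \<phi> (D n)" and r: "strict_mono (r :: nat \<Rightarrow> nat)"
    and lim: "(\<lambda>n. hausdorff_distance (D (r n) t) (E t)) \<longlonglongrightarrow> 0"
    using assms(3,4) unfolding minimizing_movement_def by blast
  have "(\<lambda>n. hausdorff_distance (D (r n) t) (norm_ball \<phi> (4 * t))) \<longlonglongrightarrow> 0"
    using LIMSEQ_subseq_LIMSEQ[OF discrete_solutions_hausdorff_lim[OF assms(1,2) D assms(4)] r] by (simp add: o_def)
  from tendsto_add[OF lim this]
  have sum: "(\<lambda>n. hausdorff_distance (D (r n) t) (E t) + hausdorff_distance (D (r n) t) (norm_ball \<phi> (4 * t))) \<longlonglongrightarrow> 0"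
    by simp
  have "hausdorff_distance (E t) (norm_ball \<phi> (4 * t)) \<le> 0"
  proof (rule LIMSEQ_le_const[OF sum], intro exI allI impI)
    fix n
    show "hausdorff_distance (E t) (norm_ball \<phi> (4 * t))
        \<le> hausdorff_distance (D (r n) t) (E t) + hausdorff_distance (D (r n) t) (norm_ball \<phi> (4 * t))"
      using hausdorff_distance_triangle[of "E t" "norm_ball \<phi> (4 * t)" "D (r n) t"]
      by (simp add: hausdorff_distance_commute)
  qed
  then show ?thesis by simp
qed

section \<open>Weak-star convergence of characteristic functions\<close>

lemma indicator_mult_integrable:
  fixes h :: "plane \<Rightarrow> real"
  assumes "E \<in> sets lebesgue" "integrable lebesgue h"
  shows "integrable lebesgue (\<lambda>x. indicator E x * h x)"
  using integrable_mult_indicator[OF assms] by simp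

lemma integral_indicator_mult_diff_le:
  fixes h s :: "plane \<Rightarrow> real"
  assumes E: "E \<in> sets lebesgue" and h: "integrable lebesgue h" and s: "integrable lebesgue s"
  shows "\<bar>(LINT x|lebesgue. indicator E x * h x) - (LINT x|lebesgue. indicator E x * s x)\<bar>
      \<le> (LINT x|lebesgue. \<bar>s x - h x\<bar>)"
proof -
  have i1: "integrable lebesgue (\<lambda>x. indicator E x * h x - indicator E x * s x)"
    by (intro Bochner_Integration.integrable_diff indicator_mult_integrable E h s)
  have i2: "integrable lebesgue (\<lambda>x. s x - h x)"
    by (intro Bochner_Integration.integrable_diff h s)
  have "\<bar>(LINT x|lebesgue. indicator E x * h x) - (LINT x|lebesgue. indicator E x * s x)\<bar>
      = \<bar>LINT x|lebesgue. indicator E x * h x - indicator E x * s x\<bar>"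
    using indicator_mult_integrable[OF E] h s by simp
  also have "\<dots> \<le> (LINT x|lebesgue. \<bar>indicator E x * h x - indicator E x * s x\<bar>)"
    by (rule integral_abs_bound)
  also have "\<dots> \<le> (LINT x|lebesgue. \<bar>s x - h x\<bar>)"
  proof (rule integral_mono)
    show "\<bar>indicator E x * h x - indicator E x * s x\<bar> \<le> \<bar>s x - h x\<bar>" for x
      by (cases "x \<in> E") (simp_all add: abs_minus_commute)
  qed (use i1 i2 in auto)
  finally show ?thesis .
qed

text \<open>Characteristic functions are uniformly bounded, so weak-star convergence has to be tested only on
  the characteristic functions of sets of finite measure.\<close>

lemma weak_star_indicatorI:
  assumes E: "\<And>n. E n \<in> sets lebesgue" and B: "B \<in> sets lebesgue"
    and lim: "\<And>A. A \<in> lmeasurable \<Longrightarrow>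
      (\<lambda>n. measure lebesgue (A \<inter> E n)) \<longlonglongrightarrow> 1 / 2 * measure lebesgue (A \<inter> B)"
  shows "weak_star_converges (\<lambda>n. indicator (E n)) (\<lambda>x. 1 / 2 * indicator B x)"
proof -
  have "Linfty (indicator (E n))" for n
    unfolding Linfty_def using E by (auto intro!: exI[of _ 1] simp: indicator_def)
  moreover have "Linfty (\<lambda>x. 1 / 2 * indicator B x)"
    unfolding Linfty_def using B by (auto intro!: exI[of _ 1] simp: indicator_def)
  moreover have "(\<lambda>n. LINT x|lebesgue. indicator (E n) x * h x) \<longlonglongrightarrow> 1 / 2 * (LINT x|lebesgue. indicator B x * h x)"
    if "integrable lebesgue h" for h :: "plane \<Rightarrow> real"
    using that
  proof (induction h rule: integrable_induct)
    case (base A c)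
    then have A: "A \<in> lmeasurable" by (simp add: fmeasurable_def)
    have eq: "(LINT x|lebesgue. indicator S x * (indicator A x * c)) = c * measure lebesgue (A \<inter> S)"
      for S :: "plane set"
    proof -
      have "(\<lambda>x. indicator S x * (indicator A x * c)) = (\<lambda>x. c * indicator (A \<inter> S) x)"
        by (auto simp: indicator_def)
      then show ?thesis by simp
    qed
    from tendsto_mult_left[OF lim[OF A], of c] show ?case by (simp add: eq)
  next
    case (add f g)
    have "(LINT x|lebesgue. indicator S x * (f x + g x))
        = (LINT x|lebesgue. indicator S x * f x) + (LINT x|lebesgue. indicator S x * g x)"
      if "S \<in> sets lebesgue" for S
      using indicator_mult_integrable[OF that] add by (simp add: distrib_left)
    then show ?case using tendsto_add[OF add.IH] E B by (simp add: add_divide_distrib)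
  next
    case (lim f s)
    have s_int: "\<And>i. integrable lebesgue (s i)" and f_int: "integrable lebesgue f"
      and s_lim: "\<And>x. (\<lambda>i. s i x) \<longlonglongrightarrow> f x" and s_le: "\<And>i x. norm (s i x) \<le> 2 * norm (f x)"
      using lim.hyps by auto
    have "(\<lambda>i. LINT x|lebesgue. \<bar>s i x - f x\<bar>) \<longlonglongrightarrow> (LINT x|(lebesgue :: plane measure). (0 :: real))"
    proof (rule integral_dominated_convergence[where w = "\<lambda>x. 3 * \<bar>f x\<bar>"])
      have "\<bar>s i x - f x\<bar> \<le> 3 * \<bar>f x\<bar>" for i x using s_le[of i x] by simp
      then show "AE x in lebesgue. norm \<bar>s i x - f x\<bar> \<le> 3 * \<bar>f x\<bar>" for i by simp
      have "(\<lambda>i. \<bar>s i x - f x\<bar>) \<longlonglongrightarrow> 0" for x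
        using s_lim[of x] by (intro tendsto_rabs_zero) (simp add: LIM_zero)
      then show "AE x in lebesgue. (\<lambda>i. \<bar>s i x - f x\<bar>) \<longlonglongrightarrow> 0" by simp
    qed (use s_int f_int in \<open>auto intro!: borel_measurable_diff borel_measurable_abs borel_measurable_integrable\<close>)
    then have zero: "(\<lambda>i. LINT x|lebesgue. \<bar>s i x - f x\<bar>) \<longlonglongrightarrow> 0" by simp
    let ?F = "\<lambda>n h. LINT x|lebesgue. indicator (E n) x * h x" and ?L = "\<lambda>h. LINT x|lebesgue. indicator B x * h x"
    show ?case
    proof (rule LIMSEQ_I)
      fix r :: real assume "0 < r"
      then have "\<forall>\<^sub>F i in sequentially. (LINT x|lebesgue. \<bar>s i x - f x\<bar>) < r / 3"
        by (intro order_tendstoD(2)[OF zero]) simp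
      then obtain i where i: "(LINT x|lebesgue. \<bar>s i x - f x\<bar>) < r / 3"
        using eventually_happens'[OF sequentially_bot] by blast
      obtain N where N: "\<And>n. n \<ge> N \<Longrightarrow> \<bar>?F n (s i) - 1 / 2 * ?L (s i)\<bar> < r / 3"
        using LIMSEQ_D[OF lim.IH[of i], of "r / 3"] \<open>0 < r\<close> by auto
      show "\<exists>N. \<forall>n\<ge>N. norm (?F n f - 1 / 2 * ?L f) < r"
      proof (intro exI[of _ N] allI impI)
        fix n assume n: "N \<le> n"
        have "\<bar>?F n f - ?F n (s i)\<bar> < r / 3" "\<bar>?L f - ?L (s i)\<bar> < r / 3"
          using integral_indicator_mult_diff_le[OF E f_int s_int] integral_indicator_mult_diff_le[OF B f_int s_int] i
          by (meson order_le_less_trans)+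
        then show "norm (?F n f - 1 / 2 * ?L f) < r"
          using N[OF n] unfolding real_norm_def by linarith
      qed
    qed
  qed
  ultimately show ?thesis unfolding weak_star_converges_def by (simp add: mult.assoc)
qed

section \<open>Continuity of translations in measure\<close>

lemma measure_open_shift_lim:
  fixes U :: "plane set"
  assumes U: "open U" "U \<in> lmeasurable" and v: "v \<longlonglongrightarrow> 0"
  shows "(\<lambda>n. measure lebesgue {x \<in> U. x + v n \<notin> U}) \<longlonglongrightarrow> 0"
proof -
  have open_pre: "open ((\<lambda>x. x + v n) -` U)" for n
    by (intro open_vimage U continuous_intros)
  have eq: "{x \<in> U. x + v n \<notin> U} = U - (\<lambda>x. x + v n) -` U" for n by auto
  have meas: "{x \<in> U. x + v n \<notin> U} \<in> sets lebesgue" for n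
    unfolding eq using U(1) open_pre by (intro sets.Diff) auto
  define g :: "nat \<Rightarrow> plane \<Rightarrow> real" where "g n = indicator {x \<in> U. x + v n \<notin> U}" for n
  have gm: "g n \<in> borel_measurable lebesgue" for n
    unfolding g_def by (rule borel_measurable_indicator[OF meas])
  have gU: "norm (g n x) \<le> indicator U x" for n x by (simp add: g_def indicator_def)
  have "(\<lambda>n. LINT x|lebesgue. g n x) \<longlonglongrightarrow> (LINT x|(lebesgue :: plane measure). (0 :: real))"
  proof (rule integral_dominated_convergence[where w = "indicator U"])
    show "integrable lebesgue (indicator U :: plane \<Rightarrow> real)"
      using U(2) by (intro integrable_real_indicator) (auto simp: fmeasurable_def)
    have "(\<lambda>n. g n x) \<longlonglongrightarrow> 0" for x
    proof (cases "x \<in> U")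
      case True
      have "(\<lambda>n. x + v n) \<longlonglongrightarrow> x + 0" by (intro tendsto_intros v)
      then have "\<forall>\<^sub>F n in sequentially. x + v n \<in> U" using True U(1) by (simp add: topological_tendstoD)
      then have "\<forall>\<^sub>F n in sequentially. g n x = 0"
        by eventually_elim (simp add: g_def)
      then show ?thesis by (rule tendsto_eventually)
    qed (simp add: g_def)
    then show "AE x in lebesgue. (\<lambda>n. g n x) \<longlonglongrightarrow> 0" by simp
  qed (use gm gU in auto)
  then show ?thesis by (simp add: g_def)
qed

text \<open>For an open set of finite measure this is dominated convergence; any other set of finite measure is
  contained in an open one with small excess.\<close>

lemma measure_shift_lim:
  fixes S :: "plane set"
  assumes S: "S \<in> lmeasurable" and v: "v \<longlonglongrightarrow> 0"
  shows "(\<lambda>n. measure lebesgue (S - (+) (- v n) ` S)) \<longlonglongrightarrow> 0"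
proof (rule LIMSEQ_I)
  fix r :: real assume r: "0 < r"
  obtain U where U: "open U" "S \<subseteq> U" "U - S \<in> lmeasurable" "emeasure lebesgue (U - S) < ennreal (r / 2)"
    using sets_lebesgue_outer_open[of S "r / 2"] S r by (auto simp: fmeasurable_def)
  have mUS: "measure lebesgue (U - S) < r / 2"
    using U(3,4) r by (simp add: emeasure_eq_measure2 ennreal_less_iff)
  have Um: "U \<in> lmeasurable" using fmeasurable_Diff_D[OF U(3) S U(2)] .
  obtain N where N: "\<And>n. n \<ge> N \<Longrightarrow> measure lebesgue {x \<in> U. x + v n \<notin> U} < r / 2"
    using LIMSEQ_D[OF measure_open_shift_lim[OF U(1) Um v], of "r / 2"] r by auto
  show "\<exists>N. \<forall>n\<ge>N. norm (measure lebesgue (S - (+) (- v n) ` S) - 0) < r"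
  proof (intro exI[of _ N] allI impI)
    fix n assume n: "N \<le> n"
    have pre: "(+) (- v n) ` A = (\<lambda>x. x + v n) -` A" for A by (force simp: image_iff)
    have m1: "{x \<in> U. x + v n \<notin> U} \<in> lmeasurable"
    proof -
      have "{x \<in> U. x + v n \<notin> U} = U - (+) (- v n) ` U" unfolding pre by auto
      then show ?thesis
        using fmeasurable_Diff[OF Um fmeasurableD[OF measurable_translation[OF Um, of "- v n"]]] by argo
    qed
    have m2: "(+) (- v n) ` (U - S) \<in> lmeasurable" by (rule measurable_translation[OF U(3)])
    have m3: "S - (+) (- v n) ` S \<in> sets lebesgue"
      by (intro sets.Diff fmeasurableD S measurable_translation)
    have "S - (+) (- v n) ` S \<subseteq> {x \<in> U. x + v n \<notin> U} \<union> (+) (- v n) ` (U - S)"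
      unfolding pre using U(2) by auto
    then have "measure lebesgue (S - (+) (- v n) ` S)
        \<le> measure lebesgue ({x \<in> U. x + v n \<notin> U} \<union> (+) (- v n) ` (U - S))"
      using m1 m2 m3 by (intro measure_mono_fmeasurable) auto
    also have "\<dots> \<le> measure lebesgue {x \<in> U. x + v n \<notin> U} + measure lebesgue ((+) (- v n) ` (U - S))"
      using m1 m2 by (intro measure_Un_le) auto
    also have "\<dots> < r" using N[OF n] mUS by (simp only: measure_translation)
    finally show "norm (measure lebesgue (S - (+) (- v n) ` S) - 0) < r" by simp
  qed
qed

section \<open>Counting lattice points\<close>

lemma measure_cell: "0 < \<epsilon> \<Longrightarrow> measure lebesgue (cell \<epsilon> z) = \<epsilon>\<^sup>2"
  and measure_open_cell: "0 < \<epsilon> \<Longrightarrow> measure lebesgue (open_cell \<epsilon> z) = \<epsilon>\<^sup>2"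
proof -
  assume eps: "0 < \<epsilon>"
  have "cbox (z - vec (\<epsilon> / 2)) (z + vec (\<epsilon> / 2)) \<noteq> {}"
    using eps by (metis cell_def centre_in_open_cell empty_iff open_cell_subset subsetD)
  from content_cbox_cart[OF this] show 1: "measure lebesgue (cell \<epsilon> z) = \<epsilon>\<^sup>2"
    by (simp add: cell_def measure_completion power2_eq_square UNIV_2)
  show "measure lebesgue (open_cell \<epsilon> z) = \<epsilon>\<^sup>2"
    using 1 unfolding cell_def open_cell_def by (simp add: measure_completion measure_lborel_box_eq measure_lborel_cbox_eq)
qed

lemma open_cells_measure_le:
  assumes "0 < \<epsilon>" "S \<subseteq> grid \<epsilon>" "finite S" "U \<in> lmeasurable" "\<And>z. z \<in> S \<Longrightarrow> open_cell \<epsilon> z \<subseteq> U"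
  shows "\<epsilon>\<^sup>2 * card S \<le> measure lebesgue U"
proof -
  have disj: "disjoint_family_on (open_cell \<epsilon>) S"
    unfolding disjoint_family_on_def
    using open_cell_disjoint[OF assms(1)] open_cell_subset assms(2) by blast
  have "measure lebesgue (\<Union>z\<in>S. open_cell \<epsilon> z) = (\<Sum>z\<in>S. measure lebesgue (open_cell \<epsilon> z))"
  proof (rule measure_finite_Union[OF assms(3) _ disj])
    show "emeasure lebesgue (open_cell \<epsilon> z) \<noteq> \<infinity>" for z
      unfolding open_cell_def using fmeasurableD2[OF lmeasurable_box] by simp
  qed (auto simp: open_cell_def)
  also have "\<dots> = \<epsilon>\<^sup>2 * card S" by (simp add: measure_open_cell[OF assms(1)])
  finally have eq: "measure lebesgue (\<Union>z\<in>S. open_cell \<epsilon> z) = \<epsilon>\<^sup>2 * card S" .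
  have "measure lebesgue (\<Union>z\<in>S. open_cell \<epsilon> z) \<le> measure lebesgue U"
    using assms(3-5) by (intro measure_mono_fmeasurable) (auto simp: open_cell_def)
  then show ?thesis using eq by simp
qed

lemma lmeasurable_cells: "finite I \<Longrightarrow> cells \<epsilon> I \<in> lmeasurable"
  unfolding cells_def cell_def by (intro fmeasurable.finite_UN) auto

lemma measure_cells_le:
  assumes "0 < \<epsilon>" "finite S"
  shows "measure lebesgue (cells \<epsilon> S) \<le> \<epsilon>\<^sup>2 * card S"
proof -
  have "measure lebesgue (cells \<epsilon> S) \<le> (\<Sum>z\<in>S. measure lebesgue (cell \<epsilon> z))"
    unfolding cells_def using assms(2) by (intro measure_UNION_le) (auto simp: cell_def)
  then show ?thesis by (simp add: measure_cell[OF assms(1)] mult.commute)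
qed

text \<open>One of the two colour classes of the checkerboard: lattice points whose coordinates have an even
  sum.\<close>

definition even_grid :: "real \<Rightarrow> plane set" where
  "even_grid \<epsilon> = {z \<in> grid \<epsilon>. \<exists>a b. z $ 1 = \<epsilon> * of_int a \<and> z $ 2 = \<epsilon> * of_int b \<and> even (a + b)}"

lemma even_grid_iff:
  assumes "0 < \<epsilon>" "z $ 1 = \<epsilon> * of_int a" "z $ 2 = \<epsilon> * of_int b"
  shows "z \<in> even_grid \<epsilon> \<longleftrightarrow> even (a + b)"
proof -
  have "z \<in> grid \<epsilon>" using assms(2,3) by (auto simp: grid_def forall_2)
  then show ?thesis using assms by (auto simp: even_grid_def)
qed

lemma axis_nth_2:
  "axis (1 :: 2) (a :: real) $ 1 = a" "axis (1 :: 2) (a :: real) $ 2 = 0"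
  "axis (2 :: 2) (a :: real) $ 1 = 0" "axis (2 :: 2) (a :: real) $ 2 = a"
  by (auto simp: axis_nth_if)

lemma even_grid_shift:
  assumes "0 < \<epsilon>" "z \<in> grid \<epsilon>"
  shows "z + axis i \<epsilon> \<in> even_grid \<epsilon> \<longleftrightarrow> z \<notin> even_grid \<epsilon>"
proof -
  obtain a b :: int where ab: "z $ 1 = \<epsilon> * a" "z $ 2 = \<epsilon> * b" using assms(2) unfolding grid_def by blast
  have "i = 1 \<or> i = 2" using exhaust_2 by blast
  then have "z + axis i \<epsilon> \<in> even_grid \<epsilon> \<longleftrightarrow> even (a + b + 1)"
  proof
    assume "i = 1"
    then show ?thesis using even_grid_iff[OF assms(1), of "z + axis i \<epsilon>" "a + 1" b] ab
      by (simp add: axis_nth_2 distrib_left) blast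
  next
    assume "i = 2"
    then show ?thesis using even_grid_iff[OF assms(1), of "z + axis i \<epsilon>" a "b + 1"] ab
      by (simp add: axis_nth_2 distrib_left)
  qed
  then show ?thesis using even_grid_iff[OF assms(1) ab] by simp
qed

lemma even_grid_nbr:
  assumes "0 < \<epsilon>" "nbr \<epsilon> z w" "z \<in> even_grid \<epsilon>"
  shows "w \<notin> even_grid \<epsilon>"
proof -
  have "z \<in> grid \<epsilon>" using assms(3) by (simp add: even_grid_def)
  then have "w \<in> grid \<epsilon>" using nbr_grid assms(2) by blast
  then show ?thesis
    using assms even_grid_shift[OF assms(1)] \<open>z \<in> grid \<epsilon>\<close> by (auto simp: nbr_def)
qed

text \<open>The cells of a checkerboard are added one by one, each of them isolated from the previous ones.\<close>

lemma per_checkerboard: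
  assumes "0 < \<epsilon>" "finite C" "C \<subseteq> even_grid \<epsilon>"
  shows "4 * \<epsilon> * card C \<le> per \<epsilon> C"
  using assms(2,3)
proof (induction C rule: finite_induct)
  case (insert z C)
  have sub: "C \<subseteq> grid \<epsilon>" "z \<in> grid \<epsilon>" using insert.prems by (auto simp: even_grid_def)
  have "per \<epsilon> C + 4 * \<epsilon> \<le> per \<epsilon> (insert z C)"
    using insert even_grid_nbr[OF assms(1)] by (intro per_insert_isolated[OF assms(1) sub(1) _ sub(2)]) auto
  then show ?case using insert by (simp add: distrib_left)
qed simp

section \<open>Volume of balls\<close>

text \<open>The area of the ball of radius \<open>r\<close>; it is 0 for \<open>r \<le> 0\<close>.\<close>

definition ball_volume :: "(plane \<Rightarrow> real) \<Rightarrow> real \<Rightarrow> real" where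
  "ball_volume \<phi> r = measure lebesgue {x. \<phi> x < r}"

lemma lmeasurable_norm_ball:
  assumes "is_norm \<phi>" shows "{x. \<phi> x < r} \<in> lmeasurable"
proof (rule lmeasurable_open[OF _ is_norm_open_ball[OF assms]])
  show "bounded {x. \<phi> x < r}" using is_norm_bounded_ball[OF assms, of r] by (rule bounded_subset) auto
qed

lemma ball_volume_eq:
  assumes "is_norm \<phi>"
  shows "ball_volume \<phi> r = (max r 0)\<^sup>2 * ball_volume \<phi> 1"
proof (cases "0 < r")
  case True
  have "{x. \<phi> x < r} = (\<lambda>x. r *\<^sub>R x + 0) ` {x. \<phi> x < 1}"
  proof (intro equalityI subsetI)
    fix x assume "x \<in> {x. \<phi> x < r}"
    then have "\<phi> ((1 / r) *\<^sub>R x) < 1" using True by (simp add: is_norm_scale[OF assms])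
    then show "x \<in> (\<lambda>x. r *\<^sub>R x + 0) ` {x. \<phi> x < 1}" using True by (intro image_eqI[of _ _ "(1 / r) *\<^sub>R x"]) auto
  next
    fix x assume "x \<in> (\<lambda>x. r *\<^sub>R x + 0) ` {x. \<phi> x < 1}"
    then show "x \<in> {x. \<phi> x < r}" using True by (auto simp: is_norm_scale[OF assms])
  qed
  then have "ball_volume \<phi> r = \<bar>r\<bar> ^ DIM(plane) * ball_volume \<phi> 1"
    unfolding ball_volume_def by (simp only: measure_lebesgue_affine)
  then show ?thesis using True by simp
next
  case False
  then have "{x. \<phi> x < r} = {}" using is_norm_nonneg[OF assms] by (smt (verit) Collect_empty_eq)
  then show ?thesis using False by (simp add: ball_volume_def)
qed

lemma ball_volume_lim:
  assumes "is_norm \<phi>" "(r \<longlongrightarrow> a) F"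
  shows "((\<lambda>n. ball_volume \<phi> (r n)) \<longlongrightarrow> ball_volume \<phi> a) F"
proof -
  have "((\<lambda>n. (max (r n) 0)\<^sup>2 * ball_volume \<phi> 1) \<longlongrightarrow> (max a 0)\<^sup>2 * ball_volume \<phi> 1) F"
    by (intro tendsto_intros assms(2))
  then show ?thesis by (simp flip: ball_volume_eq[OF assms(1)])
qed

section \<open>Density one half\<close>

text \<open>Comparison of the minimizer \<open>A\<close> with the checkerboard \<open>C\<close> in the ball of radius \<open>\<rho>\<close> that the
  previous set \<open>J\<close> is known to have reached. All points of \<open>C\<close> and of \<open>J\<close> are at distance
  \<open>O(\<epsilon>)\<close> from the boundary of \<open>J\<close>, so the dissipation of \<open>C\<close> is \<open>O(\<epsilon> / \<tau>)\<close>, and \<open>A\<close> has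
  almost as large a perimeter as \<open>C\<close>, namely one corresponding to twice the number of lattice
  points in the ball. Up to an error of the same kind, at most one half of it comes from vertical
  neighbours, and hence almost every horizontal pair is cut.\<close>

lemma cut_volume_ge:
  fixes \<epsilon> \<tau> K R :: real and m :: nat
  assumes norm: "is_norm \<phi>" and eps: "0 < \<epsilon>" and tau: "0 < \<tau>"
    and scheme: "lattice_scheme \<epsilon> \<tau> \<phi> I"
    and K: "0 < K" "\<And>x. \<phi> x \<le> K * norm x" and small: "K * \<epsilon> < 4 * \<tau>"
    and R: "4 * \<tau> * Suc m \<le> R"
  shows "2 * ball_volume \<phi> (m * (4 * \<tau> - 4 * K * \<epsilon>) - 2 * K * \<epsilon>)
       - (1 + 2 * K * (\<epsilon> / \<tau>)) * ball_volume \<phi> (R + 3 * K * \<epsilon>)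
       \<le> \<epsilon>\<^sup>2 * card (cut \<epsilon> (I (Suc m)) 1)"
proof -
  note ctx = norm eps tau scheme K
  define \<rho> where "\<rho> = m * (4 * \<tau> - 4 * K * \<epsilon>)"
  define J where "J = I m"
  define A where "A = I (Suc m)"
  define C where "C = {z \<in> even_grid \<epsilon>. \<phi> z \<le> \<rho>}"
  define V where "V = ball_volume \<phi> (R + 3 * K * \<epsilon>)"
  have Ke: "0 < K * \<epsilon>" using K eps by simp
  have J: "J \<subseteq> grid \<epsilon>" "finite J" "J \<noteq> {}"
    unfolding J_def by (rule scheme_grid[OF norm eps tau scheme], rule scheme_finite[OF norm eps tau scheme], rule scheme_nonempty[OF norm eps tau scheme])
  have A: "A \<subseteq> grid \<epsilon>" "finite A"
    unfolding A_def by (rule scheme_grid[OF norm eps tau scheme], rule scheme_finite[OF norm eps tau scheme])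
  have min: "lattice_minimizer \<epsilon> \<tau> \<phi> J A" unfolding J_def A_def by (rule scheme_minimizer[OF norm eps tau scheme])
  have "C \<subseteq> grid \<epsilon> \<inter> {x. \<phi> x \<le> \<rho>}" by (auto simp: C_def even_grid_def)
  from finite_subset[OF this finite_grid_bounded[OF eps is_norm_bounded_ball[OF norm]]]
  have C: "C \<subseteq> grid \<epsilon>" "finite C" "C \<subseteq> even_grid \<epsilon>"
    by (auto simp: C_def even_grid_def)
  have "\<rho> \<le> m * (4 * \<tau>)" unfolding \<rho>_def using Ke by (intro mult_left_mono) auto
  also have "\<dots> \<le> R" using R tau by (simp add: algebra_simps)
  finally have \<rho>R: "\<rho> \<le> R" .
  have AR: "\<phi> z \<le> R" if "z \<in> A" for z
    using scheme_upper[OF norm eps tau scheme, of z "Suc m"] that R unfolding A_def by linarith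
  have JR: "\<phi> z \<le> R" if "z \<in> J" for z
  proof -
    have "\<phi> z \<le> 4 * \<tau> * m" using scheme_upper[OF norm eps tau scheme, of z m] that unfolding J_def by blast
    also have "\<dots> \<le> 4 * \<tau> * Suc m" using tau by (intro mult_left_mono) auto
    finally show ?thesis using R by linarith
  qed
  have in_ball: "open_cell \<epsilon> z \<subseteq> {x. \<phi> x < R + 3 * K * \<epsilon>}" if "\<phi> z \<le> R + K * \<epsilon>" for z
  proof
    fix x assume "x \<in> open_cell \<epsilon> z"
    then have "\<phi> (x - z) \<le> K * \<epsilon>" using open_cell_subset norm_in_cell_le[OF eps K] by blast
    then show "x \<in> {x. \<phi> x < R + 3 * K * \<epsilon>}"
      using is_norm_triangle_diff[OF norm, of x z] that Ke by simp
  qed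
  have count: "\<epsilon>\<^sup>2 * card S \<le> V" if "S \<subseteq> grid \<epsilon>" "finite S" "\<And>z. z \<in> S \<Longrightarrow> \<phi> z \<le> R + K * \<epsilon>" for S
    unfolding V_def ball_volume_def
    by (rule open_cells_measure_le[OF eps that(1,2) lmeasurable_norm_ball[OF norm] in_ball[OF that(3)]])
  have dd: "bdry_dist_real \<epsilon> \<phi> J z \<le> 2 * K * \<epsilon>" if "z \<in> sym_diff C J" for z
  proof (cases "z \<in> J")
    case True
    obtain w where w: "nbr \<epsilon> z w" "w \<notin> J"
      using scheme_has_gaps[OF norm eps tau scheme K(2) small, of z m] True unfolding J_def by blast
    have "w \<in> grid \<epsilon> - J" using nbr_grid[OF w(1)] True J(1) w(2) by blast
    then have "bdry_dist_real \<epsilon> \<phi> J z \<le> \<phi> (z - w)" by (rule bdry_dist_real_le_inside[OF norm True])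
    also have "\<dots> \<le> K * \<epsilon>" by (rule norm_nbr_le[OF eps K(2) w(1)])
    finally show ?thesis using Ke by simp
  next
    case False
    then have "\<phi> z \<le> m * (4 * \<tau> - 4 * K * \<epsilon>)" using that by (auto simp: C_def \<rho>_def)
    then obtain j where j: "j \<in> J" "\<phi> (z - j) \<le> 2 * K * \<epsilon>"
      using scheme_lower[OF ctx, of z m] unfolding J_def by blast
    then show ?thesis using bdry_dist_real_le_outside[OF norm False j(1), of \<epsilon>] by simp
  qed
  have costC: "cost \<epsilon> \<tau> \<phi> C J \<le> 2 * K * (\<epsilon> / \<tau>) * V"
  proof -
    have "(\<Sum>z\<in>sym_diff C J. bdry_dist_real \<epsilon> \<phi> J z) \<le> (\<Sum>z\<in>sym_diff C J. 2 * K * \<epsilon>)"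
      by (intro sum_mono dd)
    then have "cost \<epsilon> \<tau> \<phi> C J \<le> \<epsilon>\<^sup>2 / \<tau> * (card (sym_diff C J) * (2 * K * \<epsilon>))"
      unfolding cost_def using tau by (intro mult_left_mono) auto
    also have "\<dots> = 2 * K * (\<epsilon> / \<tau>) * (\<epsilon>\<^sup>2 * card (sym_diff C J))" by (simp add: field_simps)
    also have "\<dots> \<le> 2 * K * (\<epsilon> / \<tau>) * V"
    proof (intro mult_left_mono count)
      show "sym_diff C J \<subseteq> grid \<epsilon>" "finite (sym_diff C J)" using C J by auto
      show "\<phi> z \<le> R + K * \<epsilon>" if z: "z \<in> sym_diff C J" for z
      proof (cases "z \<in> J")
        case True then show ?thesis using JR[of z] Ke by simp
      next
        case False then show ?thesis using z \<rho>R Ke by (auto simp: C_def)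
      qed
    qed (use K eps tau in auto)
    finally show ?thesis .
  qed
  have "2 * (\<epsilon>\<^sup>2 * card C) \<ge> ball_volume \<phi> (\<rho> - 2 * K * \<epsilon>)"
  proof -
    let ?v = "- axis 1 \<epsilon> :: plane"
    have mC: "cells \<epsilon> C \<in> lmeasurable" by (rule lmeasurable_cells[OF C(2)])
    have mC': "(+) ?v ` cells \<epsilon> C \<in> lmeasurable" by (rule measurable_translation[OF mC])
    have "{x. \<phi> x < \<rho> - 2 * K * \<epsilon>} \<subseteq> cells \<epsilon> C \<union> (+) ?v ` cells \<epsilon> C"
    proof
      fix x assume "x \<in> {x. \<phi> x < \<rho> - 2 * K * \<epsilon>}"
      then have x: "\<phi> x < \<rho> - 2 * K * \<epsilon>" by simp
      obtain z where z: "z \<in> grid \<epsilon>" "x \<in> cell \<epsilon> z" using cover_grid[OF eps] by blast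
      have \<phi>z: "\<phi> z \<le> \<phi> x + K * \<epsilon>"
        using is_norm_triangle_diff[OF norm, of z x] norm_in_cell_le[OF eps K z(2)] is_norm_diff_commute[OF norm, of z x] by simp
      show "x \<in> cells \<epsilon> C \<union> (+) ?v ` cells \<epsilon> C"
      proof (cases "z \<in> even_grid \<epsilon>")
        case True
        then have "z \<in> C" using \<phi>z x Ke by (simp add: C_def)
        then show ?thesis using z(2) by (auto simp: cells_def)
      next
        case False
        let ?w = "z + axis 1 \<epsilon>"
        have "?w \<in> even_grid \<epsilon>" using even_grid_shift[OF eps z(1)] False by blast
        moreover have "\<phi> ?w \<le> \<phi> z + K * \<epsilon>"
          using is_norm_triangle[OF norm, of z "axis 1 \<epsilon>"] K(2)[of "axis 1 \<epsilon>"] eps by simp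
        ultimately have "?w \<in> C" using \<phi>z x by (simp add: C_def)
        moreover have "x + axis 1 \<epsilon> \<in> cell \<epsilon> ?w" using z(2) by (simp add: mem_cell)
        ultimately have "x + axis 1 \<epsilon> \<in> cells \<epsilon> C" by (auto simp: cells_def)
        then have "x \<in> (+) ?v ` cells \<epsilon> C" by (intro image_eqI[of _ _ "x + axis 1 \<epsilon>"]) auto
        then show ?thesis by blast
      qed
    qed
    then have "ball_volume \<phi> (\<rho> - 2 * K * \<epsilon>) \<le> measure lebesgue (cells \<epsilon> C \<union> (+) ?v ` cells \<epsilon> C)"
      unfolding ball_volume_def using mC mC' lmeasurable_norm_ball[OF norm]
      by (intro measure_mono_fmeasurable) auto
    also have "\<dots> \<le> measure lebesgue (cells \<epsilon> C) + measure lebesgue ((+) ?v ` cells \<epsilon> C)"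
      using mC mC' by (intro measure_Un_le) auto
    also have "\<dots> \<le> \<epsilon>\<^sup>2 * card C + \<epsilon>\<^sup>2 * card C"
      unfolding measure_translation by (intro add_mono measure_cells_le[OF eps C(2)])
    finally show ?thesis by (simp add: mult.commute)
  qed
  moreover have "4 * (\<epsilon>\<^sup>2 * card C) \<le> \<epsilon> * per \<epsilon> C"
  proof -
    have "\<epsilon> * (4 * \<epsilon> * card C) \<le> \<epsilon> * per \<epsilon> C"
      using per_checkerboard[OF eps C(2,3)] eps by (intro mult_left_mono) auto
    then show ?thesis by (simp add: power2_eq_square mult_ac)
  qed
  moreover have "\<epsilon> * per \<epsilon> C \<le> \<epsilon> * per \<epsilon> A + 2 * K * (\<epsilon> / \<tau>) * V"
  proof -
    have "lattice_energy \<epsilon> \<tau> \<phi> A J \<le> lattice_energy \<epsilon> \<tau> \<phi> C J"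
      using min C by (simp add: lattice_minimizer_def)
    then show ?thesis using costC cost_nonneg[OF tau, of \<epsilon> \<phi> A J] by (simp add: lattice_energy_def)
  qed
  moreover have "\<epsilon> * per \<epsilon> A \<le> \<epsilon>\<^sup>2 * card (cut \<epsilon> A 1) + \<epsilon>\<^sup>2 * card (cut \<epsilon> A 2)"
  proof -
    have "\<epsilon> * per \<epsilon> A \<le> \<epsilon> * (\<epsilon> * (\<Sum>i\<in>UNIV. card (cut \<epsilon> A i)))"
      using per_le_cut[OF eps A] eps by (intro mult_left_mono) auto
    then show ?thesis by (simp add: sum_2 power2_eq_square distrib_left)
  qed
  moreover have "\<epsilon>\<^sup>2 * card (cut \<epsilon> A 2) \<le> V"
  proof (rule count[OF _ finite_cut[OF A(2)]])
    show "cut \<epsilon> A 2 \<subseteq> grid \<epsilon>" by (auto simp: cut_def)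
    fix z assume "z \<in> cut \<epsilon> A 2"
    then have "z \<in> A \<or> z + axis 2 \<epsilon> \<in> A" by (auto simp: cut_def)
    moreover have "\<phi> z \<le> \<phi> (z + axis 2 \<epsilon>) + K * \<epsilon>"
      using is_norm_triangle_diff[OF norm, of z "z + axis 2 \<epsilon>"] K(2)[of "- axis 2 \<epsilon>"] eps by simp
    ultimately show "\<phi> z \<le> R + K * \<epsilon>" using AR Ke by force
  qed
  ultimately show ?thesis
    unfolding A_def[symmetric] V_def[symmetric] \<rho>_def[symmetric] by (simp add: algebra_simps)
qed

text \<open>If the symmetric difference of \<open>E\<close> and \<open>E'\<close> almost fills \<open>B'\<close>, and \<open>B\<close> almost does, then the
  two sets nearly partition \<open>B\<close>, and within every \<open>S\<close> their measures nearly add up to that of \<open>B\<close>.\<close>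

lemma measure_two_shifts:
  assumes S: "S \<in> lmeasurable" and E: "E \<in> lmeasurable" "E' \<in> lmeasurable" and B: "B \<in> lmeasurable" "B' \<in> lmeasurable"
    and sub: "E \<union> E' \<subseteq> B'" "B \<subseteq> B'"
  shows "\<bar>measure lebesgue (S \<inter> E) + measure lebesgue (S \<inter> E') - measure lebesgue (S \<inter> B)\<bar>
    \<le> (measure lebesgue B' - measure lebesgue (sym_diff E E')) + (measure lebesgue B' - measure lebesgue B)"
proof -
  let ?m = "measure lebesgue" and ?X = "sym_diff E E'"
  have X: "?X \<in> lmeasurable" "?X \<subseteq> B'" using E sub by auto
  have diff: "?m (B' - Y) = ?m B' - ?m Y" if "Y \<in> lmeasurable" "Y \<subseteq> B'" for Y
    using measure_Diff_Int[OF B(2) that(1)] that(2) by (simp add: Int_absorb1)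
  have mono: "?m Y \<le> ?m Z" if "Y \<subseteq> Z" "Y \<in> lmeasurable" "Z \<in> lmeasurable" for Y Z
    using that by (intro measure_mono_fmeasurable) auto
  have un: "?m (Y \<union> Z) \<le> ?m Y + ?m Z" if "Y \<in> lmeasurable" "Z \<in> lmeasurable" for Y Z
    using that by (intro measure_Un_le) auto
  have "?m ((S \<inter> E) \<union> (S \<inter> E')) = ?m (S \<inter> E) + ?m (S \<inter> E') - ?m ((S \<inter> E) \<inter> (S \<inter> E'))"
    using S E by (intro measure_Un3) auto
  also have "(S \<inter> E) \<inter> (S \<inter> E') = S \<inter> (E \<inter> E')" by blast
  finally have sum: "?m (S \<inter> E) + ?m (S \<inter> E') = ?m ((S \<inter> E) \<union> (S \<inter> E')) + ?m (S \<inter> (E \<inter> E'))" by simp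
  have "?m ((S \<inter> E) \<union> (S \<inter> E')) \<le> ?m ((S \<inter> B) \<union> (B' - B))"
    using S E B sub by (intro mono) auto
  also have "\<dots> \<le> ?m (S \<inter> B) + (?m B' - ?m B)"
    using un[of "S \<inter> B" "B' - B"] diff[OF B(1) sub(2)] S B by auto
  finally have up1: "?m ((S \<inter> E) \<union> (S \<inter> E')) \<le> ?m (S \<inter> B) + (?m B' - ?m B)" .
  have "?m (S \<inter> (E \<inter> E')) \<le> ?m (B' - ?X)" using S E B sub by (intro mono) auto
  then have up2: "?m (S \<inter> (E \<inter> E')) \<le> ?m B' - ?m ?X" using diff[OF X] by simp
  have "?m (S \<inter> B) \<le> ?m (((S \<inter> E) \<union> (S \<inter> E')) \<union> (B' - ?X))"
    using S E B sub by (intro mono) auto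
  also have "\<dots> \<le> ?m ((S \<inter> E) \<union> (S \<inter> E')) + (?m B' - ?m ?X)"
    using un[of "(S \<inter> E) \<union> (S \<inter> E')" "B' - ?X"] diff[OF X] S E B X by auto
  finally have low: "?m (S \<inter> B) \<le> ?m ((S \<inter> E) \<union> (S \<inter> E')) + (?m B' - ?m ?X)" .
  have "0 \<le> ?m (S \<inter> (E \<inter> E'))" "?m B \<le> ?m B'" using mono[OF sub(2) B] by auto
  then show ?thesis using sum up1 up2 low by linarith
qed

lemma measure_shift_difference_le:
  assumes S: "S \<in> lmeasurable" and E: "E \<in> lmeasurable"
  shows "\<bar>measure lebesgue (S \<inter> (+) (- v) ` E) - measure lebesgue (S \<inter> E)\<bar>
      \<le> measure lebesgue (S - (+) (- v) ` S)"
proof -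
  let ?m = "measure lebesgue" and ?S = "(+) (- v) ` S" and ?E = "(+) (- v) ` E"
  have mS: "?S \<in> lmeasurable" and mE: "?E \<in> lmeasurable" using measurable_translation S E by blast+
  have sh: "?m (S \<inter> E) = ?m (?S \<inter> ?E)"
  proof -
    have "?S \<inter> ?E = (+) (- v) ` (S \<inter> E)" by auto
    then show ?thesis by (simp only: measure_translation)
  qed
  have le: "?m (P \<inter> ?E) \<le> ?m (Q \<inter> ?E) + ?m (P - Q)" if "P \<in> lmeasurable" "Q \<in> lmeasurable" for P Q
  proof -
    have "?m (P \<inter> ?E) \<le> ?m ((Q \<inter> ?E) \<union> (P - Q))"
      using that mE by (intro measure_mono_fmeasurable) auto
    also have "\<dots> \<le> ?m (Q \<inter> ?E) + ?m (P - Q)" using that mE by (intro measure_Un_le) auto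
    finally show ?thesis .
  qed
  have "?m (?S - S) = ?m (S - ?S)"
    using measure_Diff_Int[OF mS S] measure_Diff_Int[OF S mS] measure_translation[of "- v" S]
    by (simp add: Int_commute)
  then show ?thesis using le[OF S mS] le[OF mS S] sh by linarith
qed

text \<open>The set and its shift by one lattice step nearly partition the ball, and the shift hardly changes
  the measure within a fixed set \<open>S\<close>. So the set occupies nearly half of the ball within \<open>S\<close>.\<close>

lemma scheme_density:
  fixes \<epsilon> \<tau> K R :: real and m :: nat
  assumes norm: "is_norm \<phi>" and eps: "0 < \<epsilon>" and tau: "0 < \<tau>"
    and scheme: "lattice_scheme \<epsilon> \<tau> \<phi> I"
    and K: "0 < K" "\<And>x. \<phi> x \<le> K * norm x" and small: "K * \<epsilon> < 4 * \<tau>"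
    and R: "4 * \<tau> * Suc m \<le> R" and S: "S \<in> lmeasurable"
  defines "V \<equiv> ball_volume \<phi> (R + 3 * K * \<epsilon>)"
    and "W \<equiv> ball_volume \<phi> (m * (4 * \<tau> - 4 * K * \<epsilon>) - 2 * K * \<epsilon>)"
  shows "\<bar>2 * measure lebesgue (S \<inter> cells \<epsilon> (I (Suc m))) - measure lebesgue (S \<inter> {x. \<phi> x < R})\<bar>
    \<le> (V - (2 * W - (1 + 2 * K * (\<epsilon> / \<tau>)) * V)) + (V - ball_volume \<phi> R)
      + measure lebesgue (S - (+) (- axis 1 \<epsilon>) ` S)"
proof -
  note ctx = norm eps tau scheme K
  define A where "A = I (Suc m)"
  define E where "E = cells \<epsilon> A"
  let ?v = "axis 1 \<epsilon> :: plane"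
  let ?E' = "(+) (- ?v) ` E" and ?B = "{x. \<phi> x < R}" and ?B' = "{x. \<phi> x < R + 3 * K * \<epsilon>}"
  have Ke: "0 < K * \<epsilon>" using K eps by simp
  have A: "A \<subseteq> grid \<epsilon>" "finite A"
    unfolding A_def by (rule scheme_grid[OF norm eps tau scheme], rule scheme_finite[OF norm eps tau scheme])
  have E: "E \<in> lmeasurable" unfolding E_def by (rule lmeasurable_cells[OF A(2)])
  have E': "?E' \<in> lmeasurable" by (rule measurable_translation[OF E])
  have memE': "x \<in> ?E' \<longleftrightarrow> x + ?v \<in> E" for x
  proof
    assume "x + ?v \<in> E"
    then show "x \<in> ?E'" by (intro image_eqI[of _ _ "x + ?v"]) auto
  qed auto
  have \<phi>E: "\<phi> x \<le> R + K * \<epsilon>" if x: "x \<in> E" for x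
  proof -
    obtain z where z: "z \<in> A" "x \<in> cell \<epsilon> z" using x by (auto simp: E_def cells_def)
    have "\<phi> z \<le> R" using scheme_upper[OF norm eps tau scheme, of z "Suc m"] z(1) R unfolding A_def by linarith
    then show ?thesis using is_norm_triangle_diff[OF norm, of x z] norm_in_cell_le[OF eps K z(2)] by linarith
  qed
  have sub: "E \<union> ?E' \<subseteq> ?B'"
  proof
    fix x assume "x \<in> E \<union> ?E'"
    then have "x \<in> E \<or> x + ?v \<in> E" using memE' by blast
    moreover have "\<phi> x \<le> \<phi> (x + ?v) + K * \<epsilon>"
      using is_norm_triangle_diff[OF norm, of x "x + ?v"] K(2)[of "- ?v"] eps by simp
    ultimately have "\<phi> x \<le> R + 2 * K * \<epsilon>" using \<phi>E[of x] \<phi>E[of "x + ?v"] Ke by auto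
    then show "x \<in> ?B'" using Ke by simp
  qed
  have BB: "?B \<subseteq> ?B'" using Ke by auto
  have "\<epsilon>\<^sup>2 * card (cut \<epsilon> A 1) \<le> measure lebesgue (sym_diff E ?E')"
  proof (rule open_cells_measure_le[OF eps _ finite_cut[OF A(2)]])
    show "cut \<epsilon> A 1 \<subseteq> grid \<epsilon>" by (auto simp: cut_def)
    show "sym_diff E ?E' \<in> lmeasurable" using E E' by auto
    fix z assume z: "z \<in> cut \<epsilon> A 1"
    then have zg: "z \<in> grid \<epsilon>" "z + ?v \<in> grid \<epsilon>" using grid_add axis_in_grid by (auto simp: cut_def)
    have mem: "x \<in> E \<longleftrightarrow> w \<in> A" if "x \<in> open_cell \<epsilon> w" "w \<in> grid \<epsilon>" for x w
    proof
      assume "x \<in> E"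
      then obtain u where u: "u \<in> A" "x \<in> cell \<epsilon> u" by (auto simp: E_def cells_def)
      then have "w = u" using open_cell_disjoint[OF eps that(2) _ that(1) u(2)] A(1) by blast
      then show "w \<in> A" using u by simp
    next
      assume "w \<in> A"
      then show "x \<in> E" using that open_cell_subset by (auto simp: E_def cells_def)
    qed
    show "open_cell \<epsilon> z \<subseteq> sym_diff E ?E'"
    proof
      fix x assume x: "x \<in> open_cell \<epsilon> z"
      then have "x + ?v \<in> open_cell \<epsilon> (z + ?v)" by (simp add: mem_open_cell)
      then have "x \<in> ?E' \<longleftrightarrow> z + ?v \<in> A" using memE' mem zg(2) by blast
      moreover have "x \<in> E \<longleftrightarrow> z \<in> A" using mem x zg(1) by blast
      ultimately show "x \<in> sym_diff E ?E'" using z by (auto simp: cut_def)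
    qed
  qed
  then have X: "2 * W - (1 + 2 * K * (\<epsilon> / \<tau>)) * V \<le> measure lebesgue (sym_diff E ?E')"
    using cut_volume_ge[OF ctx small R] unfolding A_def V_def W_def by linarith
  have "\<bar>measure lebesgue (S \<inter> E) + measure lebesgue (S \<inter> ?E') - measure lebesgue (S \<inter> ?B)\<bar>
      \<le> (V - measure lebesgue (sym_diff E ?E')) + (V - ball_volume \<phi> R)"
    using measure_two_shifts[OF S E E' lmeasurable_norm_ball[OF norm] lmeasurable_norm_ball[OF norm] sub BB]
    by (simp add: V_def ball_volume_def)
  then show ?thesis
    using X measure_shift_difference_le[OF S E, of ?v] unfolding E_def[symmetric] A_def[symmetric] by linarith
qed

lemma discrete_solutions_weak_star_lim:
  assumes norm: "is_norm \<phi>" and reg: "regime \<epsilon> \<tau>"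
    and D: "\<And>n. discrete_solution (\<epsilon> n) (\<tau> n) \<phi> (D n)" and t: "0 \<le> t"
  shows "weak_star_converges (\<lambda>n. indicator (D n t)) (\<lambda>x. 1 / 2 * indicator (norm_ball \<phi> (4 * t)) x)"
proof -
  have pos: "\<And>n. 0 < \<epsilon> n" "\<And>n. 0 < \<tau> n" and eps0: "\<epsilon> \<longlonglongrightarrow> 0" and tau0: "\<tau> \<longlonglongrightarrow> 0"
    and ratio: "(\<lambda>n. \<epsilon> n / \<tau> n) \<longlonglongrightarrow> 0" using reg by (auto simp: regime_def)
  have "\<exists>I. lattice_scheme (\<epsilon> n) (\<tau> n) \<phi> I \<and> (\<forall>t\<ge>0. D n t = cells (\<epsilon> n) (I (step_index (\<tau> n) t)))" for n
    using discrete_solution_lattice[OF norm pos D] by metis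
  then obtain I where I: "\<And>n. lattice_scheme (\<epsilon> n) (\<tau> n) \<phi> (I n)"
    "\<And>n t. 0 \<le> t \<Longrightarrow> D n t = cells (\<epsilon> n) (I n (step_index (\<tau> n) t))" by metis
  obtain K where K: "0 < K" "\<And>x. \<phi> x \<le> K * norm x" using is_norm_upper_bound[OF norm] by blast
  define k where "k n = step_index (\<tau> n) t" for n
  have Dm: "D n t \<in> lmeasurable" for n
    unfolding I(2)[OF t] by (rule lmeasurable_cells[OF scheme_finite[OF norm pos I(1)]])
  show ?thesis
  proof (rule weak_star_indicatorI)
    show "D n t \<in> sets lebesgue" for n by (rule fmeasurableD[OF Dm])
    show "norm_ball \<phi> (4 * t) \<in> sets lebesgue"
      using finite_perimeter_norm_ball[OF norm, of "4 * t"] t by (simp add: finite_perimeter_def)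
    fix S :: "plane set" assume S: "S \<in> lmeasurable"
    show "(\<lambda>n. measure lebesgue (S \<inter> D n t)) \<longlonglongrightarrow> 1 / 2 * measure lebesgue (S \<inter> norm_ball \<phi> (4 * t))"
    proof (cases "t = 0")
      case True
      have le: "measure lebesgue (S \<inter> D n t) \<le> (\<epsilon> n)\<^sup>2" for n
      proof -
        have "I n 0 = {0}" using I(1) by (simp add: lattice_scheme_def)
        then have "D n t = cell (\<epsilon> n) 0" using I(2)[OF t] True by (simp add: step_index_def cells_def)
        moreover have "measure lebesgue (S \<inter> D n t) \<le> measure lebesgue (D n t)"
          using S Dm by (intro measure_mono_fmeasurable) auto
        ultimately show ?thesis by (simp add: measure_cell[OF pos(1)])
      qed
      have sq: "(\<lambda>n. (\<epsilon> n)\<^sup>2) \<longlonglongrightarrow> 0" using tendsto_power[OF eps0, of 2] by simp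
      have ev: "\<forall>\<^sub>F n in sequentially. norm (measure lebesgue (S \<inter> D n t)) \<le> (\<epsilon> n)\<^sup>2"
        by (intro always_eventually allI) (simp add: le)
      have lim: "(\<lambda>n. measure lebesgue (S \<inter> D n t)) \<longlonglongrightarrow> 0"
        by (rule Lim_null_comparison[OF ev sq])
      have "measure lebesgue (S \<inter> {0}) = 0" by (cases "0 \<in> S") auto
      then show ?thesis using lim True by (simp add: norm_ball_def)
    next
      case False
      with t have t: "0 < t" by simp
      let ?R = "4 * t"
      have ball: "norm_ball \<phi> ?R = {x. \<phi> x < ?R}" using t by (simp add: norm_ball_def)
      \<comment> \<open>With \<open>k n = Suc m\<close>, the radius in \<open>W\<close> is \<open>m * (4 * \<tau> n - 4 * K * \<epsilon> n) - 2 * K * \<epsilon> n\<close>.\<close>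
      define V where "V n = ball_volume \<phi> (?R + 3 * K * \<epsilon> n)" for n
      define W where "W n = ball_volume \<phi> ((k n * (4 * \<tau> n - 4 * K * \<epsilon> n) - (4 * \<tau> n - 4 * K * \<epsilon> n)) - 2 * K * \<epsilon> n)" for n
      define g where "g n = (V n - (2 * W n - (1 + 2 * K * (\<epsilon> n / \<tau> n)) * V n)) + (V n - ball_volume \<phi> ?R)
          + measure lebesgue (S - (+) (- axis 1 (\<epsilon> n)) ` S)" for n
      have "(\<lambda>n. ?R + 3 * K * \<epsilon> n) \<longlonglongrightarrow> ?R + 3 * K * 0" by (intro tendsto_intros eps0)
      then have V: "V \<longlonglongrightarrow> ball_volume \<phi> ?R" unfolding V_def by (intro ball_volume_lim[OF norm]) simp
      have "(\<lambda>n. (k n * (4 * \<tau> n - 4 * K * \<epsilon> n) - (4 * \<tau> n - 4 * K * \<epsilon> n)) - 2 * K * \<epsilon> n)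
          \<longlonglongrightarrow> (4 * t - (4 * 0 - 4 * K * 0)) - 2 * K * 0"
        unfolding k_def using t by (intro tendsto_intros eps0 tau0 inner_radius_lim[OF reg]) auto
      then have W: "W \<longlonglongrightarrow> ball_volume \<phi> ?R" unfolding W_def by (intro ball_volume_lim[OF norm]) simp
      have "(\<lambda>n. axis 1 (\<epsilon> n) :: plane) \<longlonglongrightarrow> 0"
        by (rule tendsto_norm_zero_cancel) (simp only: norm_axis_real tendsto_rabs_zero[OF eps0])
      then have sh: "(\<lambda>n. measure lebesgue (S - (+) (- axis 1 (\<epsilon> n)) ` S)) \<longlonglongrightarrow> 0"
        by (rule measure_shift_lim[OF S])
      let ?b = "ball_volume \<phi> ?R"
      have "g \<longlonglongrightarrow> (?b - (2 * ?b - (1 + 2 * K * 0) * ?b)) + (?b - ?b) + 0"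
        unfolding g_def by (intro tendsto_intros V W sh ratio)
      then have g: "g \<longlonglongrightarrow> 0" by simp
      have "\<forall>\<^sub>F n in sequentially. \<epsilon> n / \<tau> n < 4 / K" using order_tendstoD(2)[OF ratio] K(1) by simp
      moreover have "\<forall>\<^sub>F n in sequentially. \<tau> n < t" using order_tendstoD(2)[OF tau0 t] .
      ultimately have "\<forall>\<^sub>F n in sequentially.
          norm (2 * measure lebesgue (S \<inter> D n t) - measure lebesgue (S \<inter> norm_ball \<phi> ?R)) \<le> g n"
      proof eventually_elim
        case (elim n)
        have small: "K * \<epsilon> n < 4 * \<tau> n" using elim(1) pos(2)[of n] K(1) by (simp add: field_simps)
        have "1 \<le> t / \<tau> n" using elim(2) pos(2)[of n] by simp
        then have "1 \<le> \<lfloor>t / \<tau> n\<rfloor>" by simp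
        then have "k n \<noteq> 0" by (simp add: k_def step_index_def)
        then obtain m where m: "k n = Suc m" by (cases "k n") auto
        have "\<tau> n * k n \<le> t" unfolding k_def using step_index_bounds(1)[OF pos(2)] t by simp
        then have R: "4 * \<tau> n * Suc m \<le> ?R" using m by simp
        have Wn: "W n = ball_volume \<phi> (m * (4 * \<tau> n - 4 * K * \<epsilon> n) - 2 * K * \<epsilon> n)"
          by (simp add: W_def m algebra_simps)
        have Dn: "D n t = cells (\<epsilon> n) (I n (Suc m))" using I(2)[of t n] t m by (simp add: k_def)
        show ?case
          using scheme_density[OF norm pos I(1) K small R S] unfolding g_def V_def Wn Dn ball real_norm_def .
      qed
      then have "(\<lambda>n. 2 * measure lebesgue (S \<inter> D n t) - measure lebesgue (S \<inter> norm_ball \<phi> ?R)) \<longlonglongrightarrow> 0"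
        using g by (rule Lim_null_comparison)
      then have "(\<lambda>n. 2 * measure lebesgue (S \<inter> D n t)) \<longlonglongrightarrow> measure lebesgue (S \<inter> norm_ball \<phi> ?R)"
        by (simp add: LIM_zero_iff)
      from tendsto_mult_left[OF this, of "1 / 2"] show ?thesis by simp
    qed
  qed
qed

theorem theorem20:
  fixes \<phi> :: "plane \<Rightarrow> real" and \<epsilon> \<tau> :: "nat \<Rightarrow> real"
  assumes "is_norm \<phi>" and "regime \<epsilon> \<tau>"
  shows "minimizing_movement \<phi> \<epsilon> \<tau> (\<lambda>t. norm_ball \<phi> (4 * t)) \<and>
    (\<forall>E. minimizing_movement \<phi> \<epsilon> \<tau> E \<longrightarrow>
       (\<forall>t\<ge>0. hausdorff_distance (E t) (norm_ball \<phi> (4 * t)) = 0)) \<and>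
    (\<forall>D. (\<forall>n. discrete_solution (\<epsilon> n) (\<tau> n) \<phi> (D n)) \<longrightarrow>
       (\<forall>t\<ge>0. weak_star_converges (\<lambda>n. indicator (D n t))
                 (\<lambda>x. 1 / 2 * indicator (norm_ball \<phi> (4 * t)) x)))"
  using minimizing_movement_norm_ball[OF assms] minimizing_movement_unique[OF assms]
    discrete_solutions_weak_star_lim[OF assms] by blast

end
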